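(* Let $G$ be any connected planar graph with $n \ge 2$ vertices and $m$ edges. If for some $\epsilon \in (0, \frac{5}{2}]$ one has $\frac{2m}{n} = \frac{9}{2} - \epsilon$, then $$\rho_2(G) \ge \begin{cases} \frac{2}{9}\epsilon & \text{if } \epsilon \le 1,\\[2pt] \frac{2}{9}\epsilon - \frac{1}{n} & \text{otherwise.}\end{cases}$$
   Context: All graphs are finite and simple. Firefighter problem: let $G$ be a connected graph on at least 2 vertices and $k$ a positive integer. A fire breaks out at a vertex $v \in V(G)$. Then, in each turn (round), the firefighters first choose at most $k$ vertices not yet on fire and protect them (protection is permanent, and protected vertices never burn); next the fire spreads to all unprotected neighbours of vertices already on fire. The process ends when the fire can no longer spread. A vertex is saved if it is not on fire at the end. Let $sn_k(G,v)$ denote the maximum number of vertices of $G$ that can be saved with $k$ firefighters when the fire breaks out at $v$. The $k$-surviving rate of $G$ is $$\rho_k(G) = \frac{1}{|V(G)|^2}\sum_{v \in V(G)} sn_k(G,v).$$ *)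

theory Defs
  imports "HOL-Analysis.Analysis" "Graph_Theory.Pair_Digraph" "Graph_Theory.Digraph_Component"
begin

text \<open>
  A finite simple graph is a \<open>pair_graph\<close>: a finite, loop-free digraph without parallel arcs whose
  arc relation is symmetric. Each undirected edge \<open>{u, v}\<close> corresponds to the two arcs
  \<open>(u, v)\<close> and \<open>(v, u)\<close>.
\<close>

definition edges :: "'a pair_pre_digraph \<Rightarrow> 'a set set" where
  "edges G = {{u, v} | u v. (u, v) \<in> parcs G}"

text \<open>
  A graph is planar if it has a drawing in the plane without crossings: \<open>p\<close> places the vertices and
  \<open>\<gamma> e\<close> is the simple arc representing the edge \<open>e\<close>. The plane is the type \<open>complex\<close>.
  Two distinct edges may meet only in the point of a common endvertex.
\<close>

definition planar_drawing ::
  "'a pair_pre_digraph \<Rightarrow> ('a \<Rightarrow> complex) \<Rightarrow> ('a set \<Rightarrow> real \<Rightarrow> complex) \<Rightarrow> bool" where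
  "planar_drawing G p \<gamma> \<longleftrightarrow>
     inj_on p (pverts G) \<and>
     (\<forall>e \<in> edges G. arc (\<gamma> e) \<and> {pathstart (\<gamma> e), pathfinish (\<gamma> e)} = p ` e \<and>
        path_image (\<gamma> e) \<inter> p ` pverts G = p ` e) \<and>
     (\<forall>e \<in> edges G. \<forall>f \<in> edges G. e \<noteq> f \<longrightarrow>
        path_image (\<gamma> e) \<inter> path_image (\<gamma> f) = p ` (e \<inter> f))"

definition planar :: "'a pair_pre_digraph \<Rightarrow> bool" where
  "planar G \<longleftrightarrow> (\<exists>p \<gamma>. planar_drawing G p \<gamma>)"

text \<open>
  \<open>P t\<close> is the set of vertices protected in round \<open>t + 1\<close>, and \<open>burning G P v t\<close> is the set of
  vertices on fire after \<open>t\<close> rounds. As the fire spreads deterministically, a strategy of the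
  firefighters amounts to such a sequence \<open>P\<close>.
\<close>

primrec burning :: "'a pair_pre_digraph \<Rightarrow> (nat \<Rightarrow> 'a set) \<Rightarrow> 'a \<Rightarrow> nat \<Rightarrow> 'a set" where
  "burning G P v 0 = {v}"
| "burning G P v (Suc t) = burning G P v t \<union>
     {w. (\<exists>u \<in> burning G P v t. (u, w) \<in> parcs G) \<and> w \<notin> (\<Union>s\<le>t. P s)}"

definition strategy :: "nat \<Rightarrow> 'a pair_pre_digraph \<Rightarrow> 'a \<Rightarrow> (nat \<Rightarrow> 'a set) \<Rightarrow> bool" where
  "strategy k G v P \<longleftrightarrow>
     (\<forall>t. P t \<subseteq> pverts G \<and> card (P t) \<le> k \<and> P t \<inter> burning G P v t = {})"

text \<open>
  Once every neighbour of a burning vertex is burning or protected, the set of burning vertices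
  never changes again; hence the vertices on fire at the end of the process are those that burn in
  some round.
\<close>

definition saved :: "'a pair_pre_digraph \<Rightarrow> (nat \<Rightarrow> 'a set) \<Rightarrow> 'a \<Rightarrow> 'a set" where
  "saved G P v = pverts G - (\<Union>t. burning G P v t)"

definition sn :: "nat \<Rightarrow> 'a pair_pre_digraph \<Rightarrow> 'a \<Rightarrow> nat" where
  "sn k G v = Max {card (saved G P v) | P. strategy k G v P}"

definition surviving_rate :: "nat \<Rightarrow> 'a pair_pre_digraph \<Rightarrow> real" where
  "surviving_rate k G = (\<Sum>v \<in> pverts G. real (sn k G v)) / (real (card (pverts G)))\<^sup>2"

end

theory Submission
  imports Defs "HOL-Complex_Analysis.Complex_Analysis"
begin

text \<open>
  Why the theorem is true. Give every vertex \<open>u\<close> the charge \<open>9/2 - deg u\<close>. The hypothesis on the average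
  degree says that the total charge is \<open>\<epsilon> n\<close>, so it suffices to save, from a fire at \<open>u\<close>, about \<open>2/9 n\<close>
  vertices per unit of charge that \<open>u\<close> still has after some charge has been moved. A fire at a vertex of
  degree at most 2 is stopped at once. At a vertex of degree 3 one third of the other vertices can be
  saved, which is exactly \<open>2/9 n\<close> times its charge \<open>3/2\<close>. At a vertex of degree 4 about one sixth can be
  saved, more than enough for the charge \<open>1/2\<close>, unless two of its neighbours have degree at least 6. Such
  a crowded vertex sends \<open>1/4\<close> to each of these neighbours and keeps nothing; a vertex of degree
  \<open>d \<ge> 6\<close> receives at most \<open>d/4\<close>, and \<open>9/2 - d + d/4 \<le> 0\<close>. The case \<open>d = 6\<close> of this inequality is what fixes
  the constant \<open>9/2\<close>. Since the separators below only give \<open>(n - 1)/3\<close>, a vertex of degree 3 is short by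
  \<open>1/3\<close>. For \<open>\<epsilon> \<le> 1\<close> the average degree is at least \<open>7/2\<close>, so that the errors \<open>2/3 (deg u - 7/2)\<close> add up to
  a nonnegative number; in general each error is at least \<open>-1\<close>, whence the term \<open>1/n\<close>
  (lemmas \<open>saved_vs_charge\<close> and \<open>surviving_rate_ge\<close>).

  The vertices saved at degrees 3 and 4 come from a separator in the style of Lipton and Tarjan
  (\<open>planar_path_separator\<close>): for every connected spanning subgraph \<open>T\<close> of a plane graph there is a path
  in \<open>T\<close> that an arc through a face closes up to a Jordan curve with at most two thirds of the weight on
  either side. If \<open>T\<close> is a breadth-first search tree of the vertex \<open>v\<close> on fire, the path has at most two
  vertices at each distance from \<open>v\<close>, so that two firefighters can protect it just ahead of the fire. The
  side of the curve that the fire does not enter is saved. The only problem is the first round, when \<open>v\<close>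
  has neighbours on both sides. At degree 3 one side is so poor in neighbours of \<open>v\<close> that two
  firefighters can protect these together with the neighbours on the path.
  At degree 4 there may be one neighbour on either side. Then one lets the fire pass through a path
  neighbour \<open>k\<close> of degree at most 5 and protects the side into which \<open>k\<close> has few edges; the firefighters
  that are missing in the second round are found because the fire reaches the other half of the path one
  round late (\<open>save_side_delayed\<close>). If it is not late, then some geodesic runs through one of the sides
  and cuts it in two, and one of the halves can be saved by protecting geodesics only
  (\<open>save_half_side\<close>).

  The separator is found by a descent. Starting from any arc through a face between two vertices, one
  looks at the face next to the arc inside the heavy side. Either a new vertex is on its frontier, and
  a new arc to this vertex together with a path of \<open>T\<close> cuts the heavy side in two (\<open>theta_split\<close>), or the
  face is a lens between the arc and a parallel edge, and the two may be exchanged. Faces have to be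
  understood for edges that are arbitrary topological arcs. Two facts make this possible: a face that
  touches an edge touches all of it (\<open>arc_in_frontier_of_face\<close>), and the drawing may be assumed straight
  near the vertices (\<open>ex_conic_drawing\<close>), so that vertices are accessible from the faces around them.
\<close>

(* Digraphs and topological spaces both come with a constant of this name; below it is the topological one. *)
hide_const (open) Digraph_Component.connected

section \<open>Arcs as point sets\<close>

text \<open>
  Edges, chords and pieces of them are treated as point sets with marked ends, so that they can be
  joined and cut without parametrisations. A single point counts as an arc, which avoids case
  distinctions when a piece shrinks to its end.
\<close>

definition arc_between :: "complex set \<Rightarrow> complex \<Rightarrow> complex \<Rightarrow> bool" where
  "arc_between S a b \<longleftrightarrow> a = b \<and> S = {a} \<or>
     (\<exists>g. arc g \<and> path_image g = S \<and> pathstart g = a \<and> pathfinish g = b)"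

lemma arc_between_refl [simp]: "arc_between {a} a a"
  by (simp add: arc_between_def)

lemma arc_betweenI: "arc g \<Longrightarrow> arc_between (path_image g) (pathstart g) (pathfinish g)"
  by (auto simp: arc_between_def)

lemma arc_betweenE:
  assumes "arc_between S a b" "a \<noteq> b"
  obtains g where "arc g" "path_image g = S" "pathstart g = a" "pathfinish g = b"
  using assms by (auto simp: arc_between_def)

lemma arc_between_sym: "arc_between S a b \<Longrightarrow> arc_between S b a"
  unfolding arc_between_def
proof (elim disjE exE conjE)
  fix g assume "arc g" "path_image g = S" "pathstart g = a" "pathfinish g = b"
  then show "b = a \<and> S = {b} \<or> (\<exists>g. arc g \<and> path_image g = S \<and> pathstart g = b \<and> pathfinish g = a)"
    by (intro disjI2 exI[of _ "reversepath g"]) (auto simp: arc_reversepath)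
qed auto

lemma arc_between_ends: "arc_between S a b \<Longrightarrow> a \<in> S \<and> b \<in> S"
  unfolding arc_between_def by auto

lemma arc_between_compact: "arc_between S a b \<Longrightarrow> compact S"
  unfolding arc_between_def by (auto intro: compact_arc_image)

lemma arc_between_closed: "arc_between S a b \<Longrightarrow> closed S"
  by (simp add: arc_between_compact compact_imp_closed)

lemma arc_between_segment: "arc_between (closed_segment a b) a b"
proof (cases "a = b")
  case False
  then show ?thesis
    using arc_betweenI[OF arc_linepath[OF False]] by simp
qed simp

lemma arc_between_join:
  assumes "arc_between S a b" "arc_between T b c" "S \<inter> T \<subseteq> {b}"
  shows "arc_between (S \<union> T) a c"
proof -
  have bS: "b \<in> S" and bT: "b \<in> T" using assms arc_between_ends by auto
  consider "a = b" "S = {a}" | "b = c" "T = {b}" | "a \<noteq> b" "b \<noteq> c"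
    using assms(1,2) by (cases "a = b"; cases "b = c") (auto simp: arc_between_def dest: arc_distinct_ends)
  then show ?thesis
  proof cases
    case 1 then show ?thesis using assms(2) bT by (simp add: insert_absorb)
  next
    case 2 then show ?thesis using assms(1) bS by (simp add: insert_absorb)
  next
    case 3
    obtain g where g: "arc g" "path_image g = S" "pathstart g = a" "pathfinish g = b"
      using assms(1) 3 by (auto elim: arc_betweenE)
    obtain h where h: "arc h" "path_image h = T" "pathstart h = b" "pathfinish h = c"
      using assms(2) 3 by (auto elim: arc_betweenE)
    have "arc (g +++ h)"
      using g h assms(3) by (intro arc_join) auto
    from arc_betweenI[OF this] show ?thesis
      using g h by (simp add: path_image_join)
  qed
qed

lemma arc_between_split:
  assumes S: "arc_between S a b" and c: "c \<in> S"
  obtains S1 S2 where "arc_between S1 a c" "arc_between S2 c b" "S1 \<union> S2 = S" "S1 \<inter> S2 = {c}"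
proof -
  consider "c = a" | "c = b" | "c \<noteq> a" "c \<noteq> b" by blast
  then show ?thesis
  proof cases
    case 1 then show ?thesis using that[of "{a}" S] S arc_between_ends[OF S] by auto
  next
    case 2 then show ?thesis using that[of S "{b}"] S arc_between_ends[OF S] by auto
  next
    case 3
    then have "a \<noteq> b" using S c by (auto simp: arc_between_def dest: arc_distinct_ends)
    then obtain g where g: "arc g" "path_image g = S" "pathstart g = a" "pathfinish g = b"
      using S by (auto elim: arc_betweenE)
    then obtain u where u: "u \<in> {0..1}" "g u = c" using c by (auto simp: path_image_def)
    have "u \<noteq> 0" "u \<noteq> 1" using u g 3 by (auto simp: pathstart_def pathfinish_def)
    then have u01: "0 < u" "u < 1" using u by auto
    have inj: "inj_on g {0..1}" using g by (simp add: arc_def)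
    have a1: "arc (subpath 0 u g)" and a2: "arc (subpath u 1 g)"
      using g u01 by (auto intro!: arc_subpath_arc)
    have i1: "path_image (subpath 0 u g) = g ` {0..u}" and i2: "path_image (subpath u 1 g) = g ` {u..1}"
      using u01 by (auto simp: path_image_subpath)
    have "g ` {0..u} \<union> g ` {u..1} = g ` {0..1}"
      using u01 by (subst image_Un[symmetric]) (auto simp: ivl_disj_un_two_touch)
    moreover have "g ` {0..u} \<inter> g ` {u..1} = {c}"
    proof -
      have "g ` {0..u} \<inter> g ` {u..1} = g ` ({0..u} \<inter> {u..1})"
        using u01 by (intro inj_on_image_Int[OF inj, symmetric]) auto
      also have "{0..u} \<inter> {u..1} = {u}" using u01 by auto
      finally show ?thesis using u by simp
    qed
    moreover have "arc_between (g ` {0..u}) a c"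
      using arc_betweenI[OF a1] i1 u g(3) unfolding pathstart_subpath pathfinish_subpath by (simp add: pathstart_def)
    moreover have "arc_between (g ` {u..1}) c b"
      using arc_betweenI[OF a2] i2 u g(4) unfolding pathstart_subpath pathfinish_subpath by (simp add: pathfinish_def)
    ultimately show ?thesis
      using that[of "g ` {0..u}" "g ` {u..1}"] g(2) by (simp add: path_image_def)
  qed
qed

lemma arc_between_subset_path:
  assumes "path g" "pathstart g = a" "pathfinish g = b"
  obtains S where "arc_between S a b" "S \<subseteq> path_image g"
proof (cases "a = b")
  case True
  then show ?thesis using that[of "{a}"] assms pathstart_in_path_image by fastforce
next
  case False
  obtain q where "arc q" "path_image q \<subseteq> path_image g" "pathstart q = a" "pathfinish q = b"
    using path_contains_arc[OF assms False] by blast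
  then show ?thesis using that[of "path_image q"] arc_betweenI[of q] by auto
qed

lemma arc_between_halfopen_connected:
  assumes "arc_between S a b"
  shows "connected (S - {b})"
proof (cases "a = b")
  case True
  then have "S = {a}" using assms by (auto simp: arc_between_def dest: arc_distinct_ends)
  then show ?thesis using True by simp
next
  case False
  then obtain g where g: "arc g" "path_image g = S" "pathstart g = a" "pathfinish g = b"
    using assms by (auto elim: arc_betweenE)
  have inj: "inj_on g {0..1}" and c: "continuous_on {0..1} g" using g by (auto simp: arc_def path_def)
  have "S - {b} = g ` ({0..1} - {1})"
    using g inj by (subst inj_on_image_set_diff[OF inj]) (auto simp: path_image_def pathfinish_def)
  also have "{0..1} - {1} = {0..<1::real}" by auto
  finally have *: "S - {b} = g ` {0..<1}" .
  have "continuous_on {0..<1} g" by (rule continuous_on_subset[OF c]) auto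
  then show ?thesis unfolding * by (intro connected_continuous_image) auto
qed

lemma arc_between_open_connected:
  assumes "arc_between S a b"
  shows "connected (S - {a, b})"
proof (cases "a = b")
  case True
  then have "S = {a}" using assms by (auto simp: arc_between_def dest: arc_distinct_ends)
  then show ?thesis using True by simp
next
  case False
  then obtain g where g: "arc g" "path_image g = S" "pathstart g = a" "pathfinish g = b"
    using assms by (auto elim: arc_betweenE)
  have inj: "inj_on g {0..1}" and c: "continuous_on {0..1} g" using g by (auto simp: arc_def path_def)
  have "S - {a,b} = g ` ({0..1} - {0,1})"
    using g inj by (subst inj_on_image_set_diff[OF inj]) (auto simp: path_image_def pathfinish_def pathstart_def)
  also have "{0..1} - {0,1} = {0<..<1::real}" by auto
  finally have *: "S - {a,b} = g ` {0<..<1}" .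
  have "continuous_on {0<..<1} g" by (rule continuous_on_subset[OF c]) auto
  then show ?thesis unfolding * by (intro connected_continuous_image) auto
qed

lemma arc_between_interior_nonempty:
  assumes "arc_between S a b" "a \<noteq> b"
  shows "infinite (S - {a, b})"
proof -
  obtain g where g: "arc g" "path_image g = S" "pathstart g = a" "pathfinish g = b"
    using assms by (auto elim: arc_betweenE)
  have inj: "inj_on g {0..1}" using g by (auto simp: arc_def)
  have "infinite {0..1::real}" by (rule infinite_Icc) simp
  then have "infinite S" unfolding g(2)[symmetric] path_image_def using finite_imageD[OF _ inj] by blast
  then show ?thesis by simp
qed

lemma arc_between_connected: "arc_between S a b \<Longrightarrow> connected S"
  unfolding arc_between_def by (metis connected_arc_image connected_sing)

lemma arc_between_connected_Compl: "arc_between S a b \<Longrightarrow> connected (- S)"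
  unfolding arc_between_def
  by (auto intro: connected_arc_complement connected_punctured_universe)

section \<open>Theta graphs\<close>

lemma arcs_form_loop:
  assumes "arc_between A P R" "arc_between B P R" "P \<noteq> R" "A \<inter> B = {P, R}"
  obtains g h where "arc g" "arc h" "path_image g = A" "path_image h = B"
    "pathstart g = P" "pathfinish g = R" "pathstart h = P" "pathfinish h = R"
    "simple_path (g +++ reversepath h)" "pathfinish (g +++ reversepath h) = pathstart (g +++ reversepath h)"
    "path_image (g +++ reversepath h) = A \<union> B"
proof -
  obtain g where g: "arc g" "path_image g = A" "pathstart g = P" "pathfinish g = R"
    using assms by (auto elim: arc_betweenE)
  obtain h where h: "arc h" "path_image h = B" "pathstart h = P" "pathfinish h = R"
    using assms by (auto elim: arc_betweenE)
  have "simple_path (g +++ reversepath h)"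
    using g h assms by (intro simple_path_join_loop) (auto simp: arc_reversepath)
  moreover have "path_image (g +++ reversepath h) = A \<union> B"
    using g h by (simp add: path_image_join)
  ultimately show ?thesis using that g h by simp
qed

text \<open>
  The descent may find either side of a Jordan curve to be the heavy one, so inside and outside are
  treated alike throughout.
\<close>

definition side_of :: "complex set \<Rightarrow> complex set \<Rightarrow> bool" where
  "side_of J H \<longleftrightarrow> H = inside J \<or> H = outside J"

lemma side_of_facts:
  assumes "arc_between A P R" "arc_between B P R" "P \<noteq> R" "A \<inter> B = {P, R}" and H: "side_of (A \<union> B) H"
  shows "open H" "connected H" "H \<noteq> {}" "frontier H = A \<union> B" "H \<inter> (A \<union> B) = {}"
    "closure H = H \<union> A \<union> B"
proof -
  obtain g h where c: "simple_path (g +++ reversepath h)"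
    "pathfinish (g +++ reversepath h) = pathstart (g +++ reversepath h)"
    "path_image (g +++ reversepath h) = A \<union> B"
    using arcs_form_loop[OF assms(1-4)] by metis
  note J = Jordan_inside_outside[OF c(1,2), unfolded c(3)]
  show "open H" "connected H" "H \<noteq> {}" and fr: "frontier H = A \<union> B"
    using J H by (auto simp: side_of_def)
  have "inside (A \<union> B) \<inter> (A \<union> B) = {}" "outside (A \<union> B) \<inter> (A \<union> B) = {}"
    by (rule inside_no_overlap, rule outside_no_overlap)
  then show "H \<inter> (A \<union> B) = {}" using H unfolding side_of_def by metis
  show "closure H = H \<union> A \<union> B" using fr closure_Un_frontier[of H] by auto
qed

lemma sides_cover:
  assumes "side_of J H" "side_of J I" "H \<noteq> I"
  shows "H \<union> I = - J" "H \<inter> I = {}"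
proof -
  have "H = inside J \<and> I = outside J \<or> H = outside J \<and> I = inside J"
    using assms unfolding side_of_def by blast
  then show "H \<union> I = - J" "H \<inter> I = {}"
    using inside_Un_outside[of J] inside_Int_outside[of J] by (metis sup_commute, metis inf_commute)
qed

text \<open>
  The winding numbers of the three loops of a theta graph satisfy \<open>w(A - B) = w(A - G) + w(G - B)\<close>. Each of
  them lies in \<open>{-1, 0, 1}\<close> and is nonzero exactly at the points inside its loop, so the three insides add up
  to zero modulo 2.
\<close>

lemma inside_theta_xor:
  assumes A: "arc_between A P R" and B: "arc_between B P R" and G: "arc_between G P R" and "P \<noteq> R"
    and int: "A \<inter> B = {P, R}" "A \<inter> G = {P, R}" "B \<inter> G = {P, R}"
    and z: "z \<notin> A \<union> B \<union> G"
  shows "z \<in> inside (A \<union> B) \<longleftrightarrow> (z \<in> inside (A \<union> G)) \<noteq> (z \<in> inside (B \<union> G))"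
proof -
  obtain a where a: "arc a" "path_image a = A" "pathstart a = P" "pathfinish a = R"
    using A \<open>P \<noteq> R\<close> by (auto elim: arc_betweenE)
  obtain b where b: "arc b" "path_image b = B" "pathstart b = P" "pathfinish b = R"
    using B \<open>P \<noteq> R\<close> by (auto elim: arc_betweenE)
  obtain g where g: "arc g" "path_image g = G" "pathstart g = P" "pathfinish g = R"
    using G \<open>P \<noteq> R\<close> by (auto elim: arc_betweenE)
  have loop: "(z \<in> inside (X \<union> Y) \<longleftrightarrow> winding_number x z - winding_number y z \<noteq> 0) \<and>
      winding_number x z - winding_number y z \<in> {-1, 0, 1}"
    if x: "arc x" "path_image x = X" "pathstart x = P" "pathfinish x = R"
      and y: "arc y" "path_image y = Y" "pathstart y = P" "pathfinish y = R"
      and XY: "X \<inter> Y = {P, R}" "z \<notin> X" "z \<notin> Y" for x y X Y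
  proof -
    let ?c = "x +++ reversepath y"
    have s: "simple_path ?c"
      using x y XY by (intro simple_path_join_loop) (auto simp: arc_reversepath)
    have cl: "pathfinish ?c = pathstart ?c" using x y by simp
    have im: "path_image ?c = X \<union> Y" using x y by (simp add: path_image_join)
    have w: "winding_number ?c z = winding_number x z - winding_number y z"
      using x y XY by (subst winding_number_join) (auto simp: arc_imp_path winding_number_reversepath)
    have "winding_number ?c z \<in> {-1, 0, 1}"
      using simple_closed_path_winding_number_cases[OF s cl] im XY by auto
    moreover have "z \<in> inside (X \<union> Y) \<longleftrightarrow> winding_number ?c z \<noteq> 0"
    proof
      assume "z \<in> inside (X \<union> Y)"
      then show "winding_number ?c z \<noteq> 0"
        using simple_closed_path_norm_winding_number_inside[OF s] im by force
    next
      assume nz: "winding_number ?c z \<noteq> 0"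
      show "z \<in> inside (X \<union> Y)"
      proof (rule ccontr)
        assume "z \<notin> inside (X \<union> Y)"
        then have "z \<in> outside (path_image ?c)"
          using XY im by (simp add: outside_inside)
        then show False
          using winding_number_zero_in_outside[OF simple_path_imp_path[OF s] cl] nz by blast
      qed
    qed
    ultimately show ?thesis using w by simp
  qed
  have "B \<inter> A = {P, R}" "G \<inter> B = {P, R}" using int by auto
  note l = loop[OF a b int(1)] loop[OF a g int(2)] loop[OF g b this(2)]
  define d1 d2 where "d1 = winding_number a z - winding_number g z" and "d2 = winding_number g z - winding_number b z"
  have ab: "winding_number a z - winding_number b z = d1 + d2" by (simp add: d1_def d2_def)
  have "z \<in> inside (A \<union> B) \<longleftrightarrow> d1 + d2 \<noteq> 0" "d1 + d2 \<in> {-1, 0, 1}"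
    "z \<in> inside (A \<union> G) \<longleftrightarrow> d1 \<noteq> 0" "d1 \<in> {-1, 0, 1}"
    "z \<in> inside (B \<union> G) \<longleftrightarrow> d2 \<noteq> 0" "d2 \<in> {-1, 0, 1}"
    using l z unfolding ab d1_def[symmetric] d2_def[symmetric] by (simp_all add: Un_commute)
  moreover have "d1 + d2 \<noteq> 0 \<longleftrightarrow> (d1 \<noteq> 0) \<noteq> (d2 \<noteq> 0)"
    using calculation(2,4,6) by (elim insertE emptyE) simp_all
  ultimately show ?thesis by simp
qed

text \<open>
  A crosscut \<open>G\<close> of a side \<open>H\<close> of a Jordan curve cuts \<open>H\<close> into a side of one and a side of the other new
  curve. The two parts consist of the points that the respective new curve separates from the opposite
  side \<open>I\<close> of the old curve; by the parity of the previous lemma a point of \<open>H\<close> off \<open>G\<close> is separated from \<open>I\<close>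
  by exactly one of the new curves.
\<close>

lemma theta_split:
  assumes A: "arc_between A P R" and B: "arc_between B P R" and G: "arc_between G P R" and "P \<noteq> R"
    and int: "A \<inter> B = {P, R}" "A \<inter> G = {P, R}" "B \<inter> G = {P, R}"
    and H: "side_of (A \<union> B) H" and GH: "G \<inter> H \<noteq> {}"
  obtains H1 H2 where "side_of (A \<union> G) H1" "side_of (B \<union> G) H2" "H1 \<inter> H2 = {}" "H1 \<union> H2 = H - G"
proof -
  define J where "J = A \<union> B"
  define I where "I = (if H = inside J then outside J else inside J)"
  obtain c d where cd: "simple_path (c +++ reversepath d)"
    "pathfinish (c +++ reversepath d) = pathstart (c +++ reversepath d)"
    "path_image (c +++ reversepath d) = A \<union> B"
    using arcs_form_loop[OF A B \<open>P \<noteq> R\<close> int(1)] by metis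
  note Jo = Jordan_inside_outside[OF cd(1,2), unfolded cd(3), folded J_def]
  have I: "side_of J I" "H \<noteq> I" using H Jo by (auto simp: I_def side_of_def J_def)
  have HJ: "side_of J H" using H by (simp add: J_def)
  note HI = sides_cover[OF HJ I]
  note If = side_of_facts[OF A B \<open>P \<noteq> R\<close> int(1) I(1)[unfolded J_def], folded J_def]
  note Hf = side_of_facts[OF A B \<open>P \<noteq> R\<close> int(1) H, folded J_def]
  have GI: "G \<inter> I = {}"
  proof -
    have "G - {P, R} \<subseteq> H \<union> I" using HI int by (auto simp: J_def)
    moreover have "(G - {P, R}) \<inter> H \<noteq> {}" using GH Hf(5) int by (auto simp: J_def)
    ultimately have "(G - {P,R}) \<inter> I = {}"
      using connectedD[OF arc_between_open_connected[OF G] Hf(1) If(1)] HI by blast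
    moreover have "{P,R} \<inter> I = {}" using If(5) int by (auto simp: J_def)
    ultimately show ?thesis by blast
  qed
  obtain i0 where i0: "i0 \<in> I" using If(3) by auto
  \<comment> \<open>the side of \<open>K\<close> that is separated from the old side \<open>I\<close>\<close>
  define pick where "pick K = (if i0 \<in> inside K then outside K else inside K)" for K
  have side_pick: "side_of K (pick K)" for K by (auto simp: pick_def side_of_def)
  have in_pick: "z \<in> pick K \<longleftrightarrow> (z \<in> inside K) \<noteq> (i0 \<in> inside K)" if "z \<notin> K" for z K
    using that by (auto simp: pick_def outside_inside)
  have pick_sub: "pick (X \<union> G) \<subseteq> H - G"
    if X: "arc_between X P R" "X \<inter> G = {P, R}" "X \<subseteq> J" for X
  proof
    note Pf = side_of_facts[OF X(1) G \<open>P \<noteq> R\<close> X(2) side_pick]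
    fix z assume z: "z \<in> pick (X \<union> G)"
    have "I \<inter> pick (X \<union> G) = {}"
    proof (rule ccontr)
      assume *: "I \<inter> pick (X \<union> G) \<noteq> {}"
      have XI: "(X \<union> G) \<inter> I = {}" using GI If(5) X(3) by (auto simp: J_def)
      then have "i0 \<notin> X \<union> G" using i0 by blast
      then have "i0 \<notin> pick (X \<union> G)" using in_pick[of i0 "X \<union> G"] by simp
      then have "I - pick (X \<union> G) \<noteq> {}" using i0 by (metis DiffI empty_iff)
      from connected_Int_frontier[OF If(2) * this] have "I \<inter> (X \<union> G) \<noteq> {}"
        by (simp only: Pf(4) not_False_eq_True)
      then show False using XI by (simp add: Int_commute)
    qed
    moreover have "z \<notin> I" "z \<notin> X \<union> G" using calculation z Pf(5) by auto
    moreover have "z \<notin> J"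
    proof
      assume "z \<in> J"
      then have "z \<in> closure I" using If(6) by (auto simp: J_def)
      then have "pick (X \<union> G) \<inter> I \<noteq> {}"
        using Pf(1) z open_Int_closure_eq_empty by blast
      then show False using calculation by blast
    qed
    ultimately show "z \<in> H - G" using HI by auto
  qed
  have s1: "pick (A \<union> G) \<subseteq> H - G" using pick_sub[OF A int(2)] by (simp add: J_def)
  have s2: "pick (B \<union> G) \<subseteq> H - G" using pick_sub[OF B int(3)] by (simp add: J_def)
  have i0n: "i0 \<notin> A \<union> B \<union> G" using i0 GI If(5) by (auto simp: J_def)
  have one: "(z \<in> pick (A \<union> G)) \<noteq> (z \<in> pick (B \<union> G))" if z: "z \<in> H - G" for z
  proof -
    have zn: "z \<notin> A \<union> B \<union> G" using z Hf(5) by (auto simp: J_def)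
    have "(z \<in> inside J) \<noteq> (i0 \<in> inside J)"
      using z i0 HI HJ I inside_Int_outside[of J] by (auto simp: side_of_def)
    then show ?thesis
      using inside_theta_xor[OF A B G \<open>P \<noteq> R\<close> int zn] inside_theta_xor[OF A B G \<open>P \<noteq> R\<close> int i0n]
        in_pick[of z "A \<union> G"] in_pick[of z "B \<union> G"] zn by (auto simp: J_def)
  qed
  show ?thesis
    using that[of "pick (A \<union> G)" "pick (B \<union> G)"] side_pick s1 s2 one by blast
qed

section \<open>The frontier of a face along an edge\<close>

text \<open>
  Suppose that the frontier of \<open>F\<close> stops on the way from \<open>p\<close> to \<open>b\<close>, with last point \<open>m\<close> before a point \<open>q\<close>
  off the frontier. The open piece of the arc from \<open>m\<close> to \<open>q\<close> can be deleted without changing the face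
  \<open>F\<close>. What is left of the arc before \<open>m\<close> is a dangling end, and by Janiszewski's theorem a dangling
  end separates no points. So near \<open>m\<close> the face \<open>F\<close> would contain points of the deleted piece.
\<close>

lemma arc_in_frontier_aux:
  assumes K0: "compact K0" and S1: "arc_between S1 a p" and S2: "arc_between S2 p b"
    and S12: "S1 \<inter> S2 = {p}" and KS: "K0 \<inter> (S1 \<union> S2) \<subseteq> {a, b}"
    and F: "F \<in> components (- (K0 \<union> (S1 \<union> S2)))" and p: "p \<in> frontier F" "p \<noteq> a" "p \<noteq> b"
  shows "S2 \<subseteq> frontier F"
proof (rule ccontr)
  assume "\<not> S2 \<subseteq> frontier F"
  then obtain q where q: "q \<in> S2" "q \<notin> frontier F" by blast
  obtain R S3 where R: "arc_between R p q" and S3: "arc_between S3 q b" and RS: "R \<union> S3 = S2" "R \<inter> S3 = {q}"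
    using arc_between_split[OF S2 q(1)] by metis
  have pq: "p \<noteq> q" using p q by auto
  obtain h where h: "arc h" "path_image h = R" "pathstart h = p" "pathfinish h = q"
    using R pq by (auto elim: arc_betweenE)
  have inj: "inj_on h {0..1}" and cont: "continuous_on {0..1} h" using h by (auto simp: arc_def path_def)
  define X where "X = {t \<in> {0..1}. h t \<in> frontier F}"
  have "closed X"
    unfolding X_def using continuous_closed_preimage[OF cont _ frontier_closed] by (simp add: vimage_def Int_def)
  then have "compact X" by (auto simp: X_def compact_eq_bounded_closed intro: bounded_subset[of "{0..1}"])
  moreover have X0: "0 \<in> X" using p h by (simp add: X_def pathstart_def)
  ultimately obtain t where t: "t \<in> X" "\<And>s. s \<in> X \<Longrightarrow> s \<le> t"
    using compact_attains_sup[of X] by blast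
  have "t \<noteq> 1" using t q h by (auto simp: X_def pathfinish_def)
  then have t01: "0 \<le> t" "t < 1" using t by (auto simp: X_def)
  \<comment> \<open>the point where the frontier stops\<close>
  define m where "m = h t"
  have mF: "m \<in> frontier F" using t by (simp add: X_def m_def)
  have mR: "m \<in> R" using t01 h by (auto simp: m_def path_image_def)
  have mq: "m \<noteq> q" using mF q by auto
  obtain A where A: "arc_between A p m" "A = h ` {0..t}"
  proof (cases "t = 0")
    case True
    then show ?thesis using that[of "{p}"] h by (simp add: m_def pathstart_def)
  next
    case False
    have "arc (subpath 0 t h)" using h t01 False by (auto intro!: arc_subpath_arc)
    from arc_betweenI[OF this] show ?thesis
      using that[of "h ` {0..t}"] h(3) t01 unfolding pathstart_subpath pathfinish_subpath
      by (simp add: path_image_subpath m_def pathstart_def)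
  qed
  have AR: "A \<subseteq> R" using A t01 h by (auto simp: path_image_def)
  have qA: "q \<notin> A"
  proof
    assume "q \<in> A"
    then obtain s where "s \<in> {0..t}" "h s = h 1" using A h by (auto simp: pathfinish_def)
    then show False using inj_onD[OF inj, of s 1] t01 by auto
  qed
  have pS3: "p \<notin> S3" using RS pq arc_between_ends[OF R] by blast
  have aS2: "a \<notin> S2" using S12 p(2) arc_between_ends[OF S1] by auto
  define \<alpha> where "\<alpha> = S1 \<union> A"
  have \<alpha>: "arc_between \<alpha> a m"
    unfolding \<alpha>_def using S12 AR RS by (intro arc_between_join[OF S1 A(1)]) auto
  have \<alpha>S3: "\<alpha> \<inter> S3 = {}" using S12 pS3 AR RS qA by (auto simp: \<alpha>_def)
  have bS3: "b \<in> S3" using arc_between_ends[OF S3] by simp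
  \<comment> \<open>\<open>K \<union> \<alpha>\<close> is the drawing without the open piece of the arc, and \<open>\<alpha>\<close> is its dangling end\<close>
  define K where "K = K0 \<union> S3"
  have K: "compact K" unfolding K_def using K0 arc_between_compact[OF S3] by (rule compact_Un)
  have "K \<inter> \<alpha> \<subseteq> {a}" using KS \<alpha>S3 AR RS bS3 by (auto simp: K_def \<alpha>_def)
  then have conn: "connected (K \<inter> \<alpha>)" by (auto dest: subset_singletonD)
  have mK: "m \<notin> K"
    using mR RS mq KS aS2 bS3 by (auto simp: K_def)
  then have "m \<in> - K" "open (- K)" using compact_imp_closed[OF K] by auto
  then obtain d where d: "d > 0" "ball m d \<subseteq> - K" by (meson open_contains_ball)
  have Fo: "open F" "connected F" "F \<inter> (K0 \<union> (S1 \<union> S2)) = {}"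
  proof -
    have "closed (K0 \<union> (S1 \<union> S2))"
      using K0 S1 S2 by (intro closed_Un arc_between_closed compact_imp_closed) auto
    then show "open F" using F by (metis open_Compl open_components)
    show "connected F" using F by (rule in_components_connected)
    show "F \<inter> (K0 \<union> (S1 \<union> S2)) = {}" using in_components_subset[OF F] by auto
  qed
  obtain f where f: "f \<in> F" "f \<in> ball m d"
  proof -
    have "m \<in> closure F" using mF by (simp add: frontier_def)
    then show ?thesis using d(1) that unfolding closure_approachable by (metis dist_commute mem_ball)
  qed
  obtain s where s: "t < s" "s < 1" "h s \<in> ball m d"
  proof -
    obtain e where e: "e > 0" "\<And>s. s \<in> {0..1} \<Longrightarrow> dist s t < e \<Longrightarrow> dist (h s) m < d"
      using cont d(1) t01 unfolding continuous_on_iff m_def by (meson atLeastAtMost_iff less_imp_le)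
    define s where "s = t + min (e/2) ((1 - t)/2)"
    have "t < s" "s < 1" "dist s t < e" using e(1) t01 by (auto simp: s_def dist_real_def min_def field_simps)
    then show ?thesis using that[of s] e(2)[of s] t01 by (simp add: dist_commute)
  qed
  define z where "z = h s"
  have zR: "z \<in> R" using s t01 h by (auto simp: z_def path_image_def)
  have inj': "h u = h v \<Longrightarrow> u \<in> {0..1} \<Longrightarrow> v \<in> {0..1} \<Longrightarrow> u = v" for u v using inj_onD[OF inj] .
  have zA: "z \<notin> A" using A s t01 inj'[of s] by (fastforce simp: z_def)
  have zp: "z \<noteq> p" using inj'[of s 0] s t01 h by (auto simp: z_def pathstart_def)
  have z\<alpha>: "z \<notin> \<alpha>" using zA zp zR S12 RS by (auto simp: \<alpha>_def)
  have fz: "connected_component (- (K \<union> \<alpha>)) f z"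
  proof (rule Janiszewski[OF K arc_between_closed[OF \<alpha>] conn])
    have "connected_component (ball m d) f z"
      using f(2) s(3) by (intro connected_componentI[of "ball m d"]) (auto simp: z_def)
    then show "connected_component (- K) f z"
      by (rule connected_component_of_subset) (use d(2) in auto)
    have "f \<notin> \<alpha>" using f(1) Fo(3) AR RS by (auto simp: \<alpha>_def)
    then show "connected_component (- \<alpha>) f z"
      using arc_between_connected_Compl[OF \<alpha>] z\<alpha> by (intro connected_componentI[of "- \<alpha>"]) auto
  qed
  then obtain U where U: "connected U" "U \<subseteq> - (K \<union> \<alpha>)" "f \<in> U" "z \<in> U"
    by (auto simp: connected_component_def)
  have frF: "frontier F \<subseteq> K0 \<union> (S1 \<union> S2)"
  proof -
    have cl: "closed (K0 \<union> (S1 \<union> S2))"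
      using K0 S1 S2 by (intro closed_Un arc_between_closed compact_imp_closed) auto
    have "frontier F \<subseteq> frontier (- (K0 \<union> (S1 \<union> S2)))"
      using frontier_of_components_subset[OF F] by simp
    also have "\<dots> \<subseteq> K0 \<union> (S1 \<union> S2)"
      unfolding frontier_complement using cl by (rule frontier_subset_closed)
    finally show ?thesis .
  qed
  have "U \<inter> frontier F = {}"
  proof (rule ccontr)
    assume "U \<inter> frontier F \<noteq> {}"
    then obtain x where x: "x \<in> U" "x \<in> frontier F" by blast
    then have "x \<in> R - A" using frF U(2) RS by (auto simp: K_def \<alpha>_def)
    then obtain u where u: "u \<in> {0..1}" "x = h u" "u > t" using h A by (fastforce simp: path_image_def)
    then have "u \<in> X" using x by (simp add: X_def)
    then show False using t(2)[of u] u by simp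
  qed
  then have "U \<subseteq> F" using connected_Int_frontier[OF U(1), of F] U(3) f(1) by blast
  then show False using U(4) Fo(3) zR RS by auto
qed

text \<open>
  Hence a face that touches an edge at an inner point has both ends of the edge on its frontier.
\<close>

lemma arc_in_frontier_of_face:
  assumes K0: "compact K0" and S: "arc_between S a b" and KS: "K0 \<inter> S \<subseteq> {a, b}"
    and F: "F \<in> components (- (K0 \<union> S))" and p: "p \<in> frontier F" "p \<in> S - {a, b}"
  shows "S \<subseteq> frontier F"
proof -
  obtain S1 S2 where S12: "arc_between S1 a p" "arc_between S2 p b" "S1 \<union> S2 = S" "S1 \<inter> S2 = {p}"
    using arc_between_split[OF S] p by blast
  have "S2 \<subseteq> frontier F"
    using arc_in_frontier_aux[OF K0 S12(1,2,4)] KS F p S12(3) by auto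
  moreover have "S1 \<subseteq> frontier F"
  proof (rule arc_in_frontier_aux[OF K0 arc_between_sym[OF S12(2)] arc_between_sym[OF S12(1)]])
    show "S2 \<inter> S1 = {p}" "K0 \<inter> (S2 \<union> S1) \<subseteq> {b, a}" "F \<in> components (- (K0 \<union> (S2 \<union> S1)))"
      using S12 KS F by (auto simp: Un_commute)
  qed (use p in auto)
  ultimately show ?thesis using S12(3) by blast
qed

section \<open>Straight ends\<close>

text \<open>
  Near \<open>u\<close> the set \<open>S\<close> is a cone: every point near \<open>u\<close> and off \<open>S\<close> sees \<open>u\<close> along a segment that avoids \<open>S\<close>.
  Thus \<open>u\<close> can be reached from each face of \<open>S\<close> that has \<open>u\<close> on its frontier, which is not clear for arcs
  that wind around their ends.
\<close>

definition conic_at :: "complex set \<Rightarrow> complex \<Rightarrow> bool" where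
  "conic_at S u \<longleftrightarrow> (\<exists>r>0. \<forall>q. dist u q < r \<longrightarrow> q \<notin> S \<longrightarrow> closed_segment u q \<inter> S \<subseteq> {u})"

lemma segment_subset_ball_centre: "dist u (q::complex) < r \<Longrightarrow> closed_segment u q \<subseteq> ball u r"
  using le_less_trans[OF zero_le_dist] by (intro closed_segment_subset) auto

lemma conic_at_Un:
  assumes "conic_at S u" "conic_at T u"
  shows "conic_at (S \<union> T) u"
proof -
  obtain r where r: "r > 0" "\<And>q. dist u q < r \<Longrightarrow> q \<notin> S \<Longrightarrow> closed_segment u q \<inter> S \<subseteq> {u}"
    using assms(1) unfolding conic_at_def by blast
  obtain s where s: "s > 0" "\<And>q. dist u q < s \<Longrightarrow> q \<notin> T \<Longrightarrow> closed_segment u q \<inter> T \<subseteq> {u}"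
    using assms(2) unfolding conic_at_def by blast
  show ?thesis unfolding conic_at_def
  proof (intro exI[of _ "min r s"] conjI allI impI)
    fix q assume "dist u q < min r s" "q \<notin> S \<union> T"
    then show "closed_segment u q \<inter> (S \<union> T) \<subseteq> {u}" using r(2)[of q] s(2)[of q] by auto
  qed (use r s in simp)
qed

lemma conic_at_cong:
  assumes "conic_at S u" "d > 0" "S \<inter> ball u d = T \<inter> ball u d"
  shows "conic_at T u"
proof -
  obtain r where r: "r > 0" "\<And>q. dist u q < r \<Longrightarrow> q \<notin> S \<Longrightarrow> closed_segment u q \<inter> S \<subseteq> {u}"
    using assms(1) unfolding conic_at_def by blast
  have "closed_segment u q \<inter> T \<subseteq> {u}" if q: "dist u q < min r d" "q \<notin> T" for q
  proof -
    have sub: "closed_segment u q \<subseteq> ball u d" using q(1) by (intro segment_subset_ball_centre) simp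
    have "q \<in> ball u d" using q by simp
    then have "q \<notin> S" using q(2) assms(3) by blast
    then have "closed_segment u q \<inter> S \<subseteq> {u}" using r(2) q(1) by simp
    then show ?thesis using sub assms(3) by blast
  qed
  then show ?thesis unfolding conic_at_def using r(1) assms(2) by (intro exI[of _ "min r d"]) auto
qed

lemma conic_at_away:
  assumes "closed S" "u \<notin> S"
  shows "conic_at S u"
proof -
  obtain d where "d > 0" "ball u d \<subseteq> - S"
    using assms by (metis ComplI open_Compl open_contains_ball)
  moreover have "conic_at {} u" unfolding conic_at_def by (intro exI[of _ 1]) auto
  ultimately show ?thesis using conic_at_cong[of "{}" u d S] by auto
qed

lemma conic_at_empty: "conic_at {} u"
  unfolding conic_at_def by (intro exI[of _ 1]) auto

lemma conic_at_UN: "finite I \<Longrightarrow> \<forall>i\<in>I. conic_at (S i) u \<Longrightarrow> conic_at (\<Union>(S ` I)) u"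
  by (induct rule: finite_induct) (simp_all add: conic_at_Un conic_at_empty)

lemma arc_first_entry:
  assumes S: "arc_between S P u" and r: "0 < r" "r < dist u P"
  obtains M q where "M \<subseteq> S" "arc_between M P q" "dist u q = r" "M \<inter> cball u r = {q}"
proof -
  have "P \<noteq> u" using r by auto
  then obtain g where g: "arc g" "path_image g = S" "pathstart g = P" "pathfinish g = u"
    using S by (auto elim: arc_betweenE)
  have inj: "inj_on g {0..1}" and cont: "continuous_on {0..1} g" using g by (auto simp: arc_def path_def)
  define X where "X = {t \<in> {0..1}. g t \<in> cball u r}"
  have "closed X"
    unfolding X_def using continuous_closed_preimage[OF cont _ closed_cball] by (simp add: vimage_def Int_def)
  then have "compact X" by (auto simp: X_def compact_eq_bounded_closed intro: bounded_subset[of "{0..1}"])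
  moreover have "1 \<in> X" using r g by (simp add: X_def pathfinish_def)
  ultimately obtain t where t: "t \<in> X" "\<And>s. s \<in> X \<Longrightarrow> t \<le> s"
    using compact_attains_inf[of X] by blast
  have "t \<noteq> 0"
  proof
    assume "t = 0"
    then have "P \<in> cball u r" using t(1) g(3) by (simp add: X_def pathstart_def)
    then show False using r(2) by simp
  qed
  then have t01: "0 < t" "t \<le> 1" using t(1) by (simp_all add: X_def)
  \<comment> \<open>the part of the arc before it first enters the disc\<close>
  define M where "M = g ` {0..t}"
  have "arc (subpath 0 t g)" using g t01 by (auto intro!: arc_subpath_arc)
  from arc_betweenI[OF this] have M: "arc_between M P (g t)"
    using g(3) t01 unfolding pathstart_subpath pathfinish_subpath
    by (simp add: path_image_subpath M_def pathstart_def)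
  have int: "M \<inter> cball u r = {g t}"
  proof -
    have "s = t" if "s \<in> {0..t}" "g s \<in> cball u r" for s
      using t(2)[of s] that t01 by (auto simp: X_def)
    moreover have "g t \<in> M \<inter> cball u r" using t(1) t01 by (simp add: M_def X_def)
    ultimately show ?thesis unfolding M_def by blast
  qed
  have "dist u (g t) = r"
  proof -
    have "connected M"
      unfolding M_def by (intro connected_continuous_image continuous_on_subset[OF cont]) (use t01 in auto)
    moreover have "M \<inter> cball u r \<noteq> {}" using int by simp
    moreover have "P \<in> M" using arc_between_ends[OF M] by simp
    then have "M - cball u r \<noteq> {}" using r by auto
    ultimately have "M \<inter> frontier (cball u r) \<noteq> {}" by (rule connected_Int_frontier)
    then obtain x where "x \<in> M" "x \<in> frontier (cball u r)" by blast
    then have x: "x \<in> M" "dist u x = r" by simp_all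
    then have "x \<in> M \<inter> cball u r" by simp
    then show ?thesis unfolding int using x by simp
  qed
  moreover have "M \<subseteq> S" using g t01 by (auto simp: M_def path_image_def)
  ultimately show ?thesis using that M int by blast
qed

lemma arc_core:
  assumes S: "arc_between S a b" and r: "0 < r" "2 * r < dist a b"
  obtains M x y where "M \<subseteq> S" "arc_between M x y" "dist a x = r" "dist b y = r"
    "M \<inter> cball a r = {x}" "M \<inter> cball b r = {y}"
proof -
  have "r < dist b a" using r zero_le_dist[of a b] by (simp add: dist_commute)
  then obtain M1 y where M1: "M1 \<subseteq> S" "arc_between M1 a y" "dist b y = r" "M1 \<inter> cball b r = {y}"
    using arc_first_entry[OF S r(1)] by blast
  have "r < dist a y" using r M1(3) dist_triangle[of a b y] by (simp add: dist_commute)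
  then obtain M x where M: "M \<subseteq> M1" "arc_between M y x" "dist a x = r" "M \<inter> cball a r = {x}"
    using arc_first_entry[OF arc_between_sym[OF M1(2)] r(1)] by blast
  have "y \<in> M" using arc_between_ends[OF M(2)] by simp
  then have "M \<inter> cball b r = {y}" using M(1) M1(4) by blast
  then show ?thesis using that[of M x y] M M1 arc_between_sym by blast
qed

text \<open>
  Close to \<open>u\<close> all points on the ray through \<open>q\<close> belong to the set, and no points on any other ray.
\<close>

lemma conic_at_radial_end:
  assumes q: "dist u q = r" "r > 0" and M: "M \<inter> cball u r = {q}"
  shows "conic_at (M \<union> closed_segment q u) u"
  unfolding conic_at_def
proof (intro exI[of _ r] conjI allI impI subsetI)
  fix q' x
  assume q': "dist u q' < r" "q' \<notin> M \<union> closed_segment q u"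
    and x: "x \<in> closed_segment u q' \<inter> (M \<union> closed_segment q u)"
  show "x \<in> {u}"
  proof (rule ccontr)
    assume "x \<notin> {u}"
    then have xu: "x \<noteq> u" by simp
    have "x \<in> ball u r" using segment_subset_ball_centre[OF q'(1)] x by blast
    then have "x \<notin> M" using M q by auto
    then have "x \<in> closed_segment u q" using x by (auto simp: closed_segment_commute)
    then obtain l where l: "0 \<le> l" "l \<le> 1" "x = (1 - l) *\<^sub>R u + l *\<^sub>R q" by (auto simp: in_segment)
    obtain s where s: "0 \<le> s" "s \<le> 1" "x = (1 - s) *\<^sub>R u + s *\<^sub>R q'" using x by (auto simp: in_segment)
    have s0: "s > 0" using s xu by (cases "s = 0") auto
    have eq: "s *\<^sub>R (q' - u) = l *\<^sub>R (q - u)" using l(3) s(3) by (simp add: algebra_simps)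
    then have q'eq: "q' - u = (l / s) *\<^sub>R (q - u)"
      using s0 by (metis divideR_right divide_inverse_commute less_irrefl scaleR_scaleR)
    have "norm (q' - u) = (l / s) * norm (q - u)" using q'eq l s0 by simp
    then have "(l / s) * r < r" using q q'(1) by (simp add: dist_norm norm_minus_commute)
    then have ls: "l / s < 1" using q(2) mult_less_cancel_right2[of "l / s" r] by linarith
    have "q' = (1 - l / s) *\<^sub>R u + (l / s) *\<^sub>R q" using q'eq by (simp add: algebra_simps)
    then have "q' \<in> closed_segment u q" using ls l s0 by (auto simp: in_segment intro!: exI[of _ "l / s"])
    then show False using q'(2) by (simp add: closed_segment_commute)
  qed
qed (use q in simp)

lemma conic_at_segment: "conic_at (closed_segment u w) u"
proof (cases "u = w")
  case True
  have "conic_at {u} u" unfolding conic_at_def by (intro exI[of _ 1]) auto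
  then show ?thesis using True by simp
next
  case False
  then show ?thesis
    using conic_at_radial_end[of u w "dist u w" "{w}"] by (simp add: closed_segment_commute insert_absorb)
qed

section \<open>Plane graphs\<close>

text \<open>
  \<open>D e\<close> is the point set of the edge \<open>e\<close>. The descent below redraws edges but never moves vertices, so the
  positions \<open>p\<close> and the drawing \<open>D\<close> are separate parameters.
\<close>

locale plane_graph =
  fixes V :: "'a set" and E :: "'a set set" and p :: "'a \<Rightarrow> complex" and D :: "'a set \<Rightarrow> complex set"
  assumes finite_V: "finite V"
    and edgeE: "e \<in> E \<Longrightarrow> \<exists>u w. e = {u, w} \<and> u \<in> V \<and> w \<in> V \<and> u \<noteq> w"
    and inj_p: "inj_on p V"
    and arc_edge: "{u, w} \<in> E \<Longrightarrow> arc_between (D {u, w}) (p u) (p w)"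
    and edge_verts: "e \<in> E \<Longrightarrow> D e \<inter> p ` V = p ` e"
    and edge_cross: "e \<in> E \<Longrightarrow> f \<in> E \<Longrightarrow> e \<noteq> f \<Longrightarrow> D e \<inter> D f = p ` (e \<inter> f)"
begin

lemma E_sub: "e \<in> E \<Longrightarrow> e \<subseteq> V" using edgeE by blast
lemma finite_E: "finite E" by (rule finite_subset[of _ "Pow V"]) (use E_sub finite_V in auto)
lemma edge_in_V: "{u, w} \<in> E \<Longrightarrow> u \<in> V \<and> w \<in> V" using E_sub by blast
lemma edge_neq: "{u, w} \<in> E \<Longrightarrow> u \<noteq> w" using edgeE[of "{u,w}"] by (auto simp: doubleton_eq_iff)
lemma p_eq_iff: "u \<in> V \<Longrightarrow> w \<in> V \<Longrightarrow> p u = p w \<longleftrightarrow> u = w" using inj_p by (auto dest: inj_onD)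
lemma compact_edge: "e \<in> E \<Longrightarrow> compact (D e)" using edgeE arc_edge arc_between_compact by metis
lemma p_in_edge: "e \<in> E \<Longrightarrow> u \<in> V \<Longrightarrow> p u \<in> D e \<longleftrightarrow> u \<in> e"
  using edge_verts[of e] p_eq_iff E_sub[of e] by blast

definition skeleton :: "complex set" where "skeleton = p ` V \<union> \<Union> (D ` E)"

lemma compact_skeleton: "compact skeleton"
  unfolding skeleton_def using finite_V finite_E compact_edge
  by (intro compact_Un[OF finite_imp_compact] compact_Union) auto

end

locale conic_plane_graph = plane_graph +
  assumes conic_edge: "e \<in> E \<Longrightarrow> u \<in> e \<Longrightarrow> conic_at (D e) (p u)"
begin

lemma conic_edge': "e \<in> E \<Longrightarrow> u \<in> V \<Longrightarrow> conic_at (D e) (p u)"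
  using conic_edge p_in_edge conic_at_away compact_edge compact_imp_closed by metis

lemma conic_skeleton: "u \<in> V \<Longrightarrow> conic_at skeleton (p u)"
  unfolding skeleton_def
proof (rule conic_at_Un)
  assume u: "u \<in> V"
  have "conic_at {p u} (p u)" using conic_at_segment[of "p u" "p u"] by simp
  moreover have "conic_at (p ` (V - {u})) (p u)"
    using finite_V p_eq_iff u by (intro conic_at_away finite_imp_closed) auto
  ultimately have "conic_at ({p u} \<union> p ` (V - {u})) (p u)" by (rule conic_at_Un)
  moreover have "{p u} \<union> p ` (V - {u}) = p ` V" using u by auto
  ultimately show "conic_at (p ` V) (p u)" by simp
  show "conic_at (\<Union> (D ` E)) (p u)"
    using conic_at_UN[OF finite_E, of D] conic_edge' u by blast
qed

end

text \<open>
  In a small disc around each vertex, replace every edge by the segment from the centre to the point \<open>q\<close>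
  where the edge last leaves the disc. Distinct edges leave at distinct points of the circle, so the
  segments meet only in the centre, and outside the discs nothing has changed.
\<close>

lemma (in plane_graph) ex_conic_drawing: "\<exists>D'. conic_plane_graph V E p D'"
proof -
  have "\<forall>\<^sub>F r in at_right 0. (0::real) < r" by (simp add: eventually_at_right_less)
  moreover have "\<forall>\<^sub>F r in at_right 0. \<forall>u\<in>V. \<forall>w\<in>V. u \<noteq> w \<longrightarrow> 2 * r < dist (p u) (p w)"
  proof (intro eventually_ball_finite[OF finite_V] ballI)
    fix u w assume "u \<in> V" "w \<in> V"
    show "\<forall>\<^sub>F r in at_right 0. u \<noteq> w \<longrightarrow> 2 * r < dist (p u) (p w)"
    proof (cases "u = w")
      case False
      then have "0 < dist (p u) (p w) / 2" using \<open>u \<in> V\<close> \<open>w \<in> V\<close> p_eq_iff by simp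
      from eventually_at_right_real[OF this] show ?thesis by (rule eventually_mono) auto
    qed simp
  qed
  moreover have "\<forall>\<^sub>F r in at_right 0. \<forall>u\<in>V. \<forall>e\<in>E. u \<notin> e \<longrightarrow> cball (p u) r \<inter> D e = {}"
  proof (intro eventually_ball_finite[OF finite_V] eventually_ball_finite[OF finite_E] ballI)
    fix u e assume ue: "u \<in> V" "e \<in> E"
    show "\<forall>\<^sub>F r in at_right 0. u \<notin> e \<longrightarrow> cball (p u) r \<inter> D e = {}"
    proof (cases "u \<in> e")
      case False
      then have "p u \<in> - D e" using ue p_in_edge by simp
      moreover have "open (- D e)" using ue compact_edge compact_imp_closed by blast
      ultimately obtain d where d: "d > 0" "ball (p u) d \<subseteq> - D e" by (meson open_contains_ball)
      have "\<forall>\<^sub>F r in at_right 0. r \<in> {0<..<d}" by (rule eventually_at_right_real[OF d(1)])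
      then show ?thesis
      proof (rule eventually_mono)
        fix r assume "r \<in> {0<..<d}"
        then have "cball (p u) r \<subseteq> ball (p u) d" by auto
        then show "u \<notin> e \<longrightarrow> cball (p u) r \<inter> D e = {}" using d(2) by blast
      qed
    qed simp
  qed
  ultimately have "\<forall>\<^sub>F r in at_right 0. 0 < r \<and> (\<forall>u\<in>V. \<forall>w\<in>V. u \<noteq> w \<longrightarrow> 2 * r < dist (p u) (p w)) \<and>
      (\<forall>u\<in>V. \<forall>e\<in>E. u \<notin> e \<longrightarrow> cball (p u) r \<inter> D e = {})"
    by eventually_elim auto
  then have "\<exists>r. 0 < r \<and> (\<forall>u\<in>V. \<forall>w\<in>V. u \<noteq> w \<longrightarrow> 2 * r < dist (p u) (p w)) \<and>
      (\<forall>u\<in>V. \<forall>e\<in>E. u \<notin> e \<longrightarrow> cball (p u) r \<inter> D e = {})"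
    by (rule eventually_happens'[rotated]) simp
  then obtain r where r: "0 < r"
    and sep': "\<forall>u\<in>V. \<forall>w\<in>V. u \<noteq> w \<longrightarrow> 2 * r < dist (p u) (p w)"
    and away': "\<forall>u\<in>V. \<forall>e\<in>E. u \<notin> e \<longrightarrow> cball (p u) r \<inter> D e = {}"
    by blast
  have sep: "2 * r < dist (p u) (p w)" if "u \<in> V" "w \<in> V" "u \<noteq> w" for u w using sep' that by blast
  have away: "cball (p u) r \<inter> D e = {}" if "u \<in> V" "e \<in> E" "u \<notin> e" for u e using away' that by blast
  define q where "q M u = the_elem (M \<inter> cball (p u) r)" for M u
  \<comment> \<open>\<open>M\<close> is the part of an edge that is kept: it meets the two discs only at its ends\<close>
  define core where "core e M \<longleftrightarrow> M \<subseteq> D e \<and> (\<forall>u\<in>e. dist (p u) (q M u) = r \<and> M \<inter> cball (p u) r = {q M u}) \<and>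
      (\<forall>u w. e = {u, w} \<longrightarrow> arc_between M (q M u) (q M w))" for e M
  have "\<exists>M. core e M" if e: "e \<in> E" for e
  proof -
    obtain u w where uw: "e = {u, w}" "u \<in> V" "w \<in> V" "u \<noteq> w" using edgeE[OF e] by blast
    have "2 * r < dist (p u) (p w)" using sep uw by blast
    then obtain M qu qw where M: "M \<subseteq> D e" "arc_between M qu qw" "dist (p u) qu = r" "dist (p w) qw = r"
      "M \<inter> cball (p u) r = {qu}" "M \<inter> cball (p w) r = {qw}"
      using arc_core[of "D e" "p u" "p w" r] arc_edge e uw r by metis
    have "q M u = qu" "q M w = qw" using M by (simp_all add: q_def)
    then have "core e M"
      unfolding core_def using M uw arc_between_sym by (auto simp: doubleton_eq_iff)
    then show ?thesis by blast
  qed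
  then obtain M where M: "\<And>e. e \<in> E \<Longrightarrow> core e (M e)" by metis
  define s where "s e u = closed_segment (q (M e) u) (p u)" for e u
  define D' where "D' e = M e \<union> (\<Union>u\<in>e. s e u)" for e
  have MD: "M e \<subseteq> D e" if "e \<in> E" for e using M that by (simp add: core_def)
  have qd: "dist (p u) (q (M e) u) = r" "M e \<inter> cball (p u) r = {q (M e) u}" if "e \<in> E" "u \<in> e" for e u
    using M that by (auto simp: core_def)
  have Marc: "arc_between (M {u,w}) (q (M {u,w}) u) (q (M {u,w}) w)" if "{u,w} \<in> E" for u w
    using M[OF that] unfolding core_def by blast
  have sc: "s e u \<subseteq> cball (p u) r" if "e \<in> E" "u \<in> e" for e u
    unfolding s_def using qd(1)[OF that] r by (intro closed_segment_subset) auto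
  have disj: "x \<in> cball (p u) r \<Longrightarrow> x \<in> cball (p w) r \<Longrightarrow> u \<in> V \<Longrightarrow> w \<in> V \<Longrightarrow> u = w" for x u w
    using sep[of u w] dist_triangle2[of "p u" "p w" x] by force
  have Mout: "M e \<inter> cball (p u) r = {}" if "e \<in> E" "u \<in> V" "u \<notin> e" for e u
    using away[OF that(2,1,3)] MD[OF that(1)] by blast
  have qM: "q (M e) u \<in> M e" if "e \<in> E" "u \<in> e" for e u using qd(2)[OF that] by blast
  have end_s: "p u \<in> s e u" for e u by (simp add: s_def)
  show ?thesis
  proof (intro exI[of _ D'] conic_plane_graph.intro plane_graph.intro conic_plane_graph_axioms.intro)
    show "finite V" "inj_on p V" by (fact finite_V inj_p)+
    show "\<exists>u w. e = {u, w} \<and> u \<in> V \<and> w \<in> V \<and> u \<noteq> w" if "e \<in> E" for e using edgeE that .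
  next
    fix u w assume e: "{u, w} \<in> E"
    define e where "e = {u, w}"
    have eE: "e \<in> E" and ue: "u \<in> e" "w \<in> e" "u \<in> V" "w \<in> V" "u \<noteq> w"
      using e edge_neq E_sub by (auto simp: e_def)
    have 1: "s e u \<inter> M e \<subseteq> {q (M e) u}" using sc[OF eE ue(1)] qd(2)[OF eE ue(1)] by blast
    have 2: "s e w \<inter> M e \<subseteq> {q (M e) w}" using sc[OF eE ue(2)] qd(2)[OF eE ue(2)] by blast
    have 3: "s e u \<inter> s e w = {}" using sc[OF eE ue(1)] sc[OF eE ue(2)] disj ue by blast
    have "arc_between (s e u \<union> M e) (p u) (q (M e) w)"
      using 1 Marc[OF e] unfolding s_def e_def
      by (intro arc_between_join[OF arc_between_sym[OF arc_between_segment]]) auto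
    then have "arc_between ((s e u \<union> M e) \<union> s e w) (p u) (p w)"
      using 2 3 unfolding s_def by (intro arc_between_join[OF _ arc_between_segment]) auto
    moreover have "(s e u \<union> M e) \<union> s e w = D' e" by (auto simp: D'_def e_def)
    ultimately show "arc_between (D' {u, w}) (p u) (p w)" by (simp add: e_def)
  next
    fix e assume e: "e \<in> E"
    show "D' e \<inter> p ` V = p ` e"
    proof
      show "p ` e \<subseteq> D' e \<inter> p ` V" using end_s E_sub[OF e] by (auto simp: D'_def)
      show "D' e \<inter> p ` V \<subseteq> p ` e"
      proof
        fix x assume x: "x \<in> D' e \<inter> p ` V"
        then obtain w where w: "w \<in> V" "x = p w" by blast
        consider "x \<in> M e" | u where "u \<in> e" "x \<in> s e u" using x by (auto simp: D'_def)
        then show "x \<in> p ` e"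
        proof cases
          case 1 then show ?thesis using MD[OF e] edge_verts[OF e] w by blast
        next
          case 2
          have "u \<in> V" using 2(1) E_sub[OF e] by blast
          moreover have "x \<in> cball (p w) r" using r w by simp
          moreover have "x \<in> cball (p u) r" using 2(2) sc[OF e 2(1)] by blast
          ultimately have "u = w" using disj w(1) by simp
          then show ?thesis using 2 w by blast
        qed
      qed
    qed
  next
    fix e f assume ef: "e \<in> E" "f \<in> E" "e \<noteq> f"
    show "D' e \<inter> D' f = p ` (e \<inter> f)"
    proof
      show "p ` (e \<inter> f) \<subseteq> D' e \<inter> D' f" using end_s by (auto simp: D'_def)
      have Mseg: "x \<in> p ` (e \<inter> f)" if h: "e \<in> E" "f \<in> E" "e \<noteq> f" "x \<in> M e" "u \<in> f" "x \<in> s f u" for x u e f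
      proof -
        have xc: "x \<in> cball (p u) r" using sc[OF h(2,5)] h(6) by blast
        have uV: "u \<in> V" using E_sub[OF h(2)] h(5) by blast
        have ue: "u \<in> e"
        proof (rule ccontr)
          assume "u \<notin> e"
          from Mout[OF h(1) uV this] show False using h(4) xc by blast
        qed
        have "x \<in> M e \<inter> cball (p u) r" using h(4) xc by blast
        then have xq: "x = q (M e) u" using qd(2)[OF h(1) ue] by blast
        then have xq2: "dist (p u) x = r" using qd(1)[OF h(1) ue] by simp
        have "x = q (M f) u"
        proof -
          obtain l where l: "0 \<le> l" "l \<le> 1" "x = (1 - l) *\<^sub>R q (M f) u + l *\<^sub>R p u"
            using h(6) by (auto simp: s_def in_segment)
          have "p u - x = (1 - l) *\<^sub>R (p u - q (M f) u)" using l(3) by (simp add: algebra_simps)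
          then have "norm (p u - x) = (1 - l) * norm (p u - q (M f) u)" using l by simp
          then have "r = (1 - l) * r" using xq2 qd(1)[OF h(2,5)] by (simp add: dist_norm)
          then have "l = 0" using r by simp
          then show ?thesis using l by simp
        qed
        then have "x \<in> D f" using qM[OF h(2,5)] MD[OF h(2)] by blast
        moreover have "x \<in> D e" using h(4) MD[OF h(1)] by blast
        ultimately show ?thesis using edge_cross[OF h(1-3)] by blast
      qed
      show "D' e \<inter> D' f \<subseteq> p ` (e \<inter> f)"
      proof
        fix x assume "x \<in> D' e \<inter> D' f"
        then consider "x \<in> M e" "x \<in> M f" | u where "x \<in> M e" "u \<in> f" "x \<in> s f u"
          | u where "x \<in> M f" "u \<in> e" "x \<in> s e u" | u w where "u \<in> e" "w \<in> f" "x \<in> s e u" "x \<in> s f w"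
          by (auto simp: D'_def)
        then show "x \<in> p ` (e \<inter> f)"
        proof cases
          case 1 then show ?thesis using MD[OF ef(1)] MD[OF ef(2)] edge_cross[OF ef] by blast
        next
          case 2 then show ?thesis using Mseg[OF ef] by blast
        next
          case 3 then show ?thesis using Mseg[of f e x u] ef by (auto simp: Int_commute)
        next
          case 4
          have uV: "u \<in> V" "w \<in> V" using 4(1,2) E_sub[OF ef(1)] E_sub[OF ef(2)] by blast+
          have "x \<in> cball (p u) r" "x \<in> cball (p w) r" using sc[OF ef(1) 4(1)] sc[OF ef(2) 4(2)] 4(3,4) by auto
          then have "u = w" using disj uV by blast
          show ?thesis
          proof (rule ccontr)
            assume nx: "x \<notin> p ` (e \<inter> f)"
            then have xu: "x \<noteq> p u" using 4(1,2) \<open>u = w\<close> by blast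
            define qe qf where "qe = q (M e) u" and "qf = q (M f) u"
            obtain l where l: "0 \<le> l" "l \<le> 1" "x = (1 - l) *\<^sub>R p u + l *\<^sub>R qe"
              using 4(3) by (auto simp: s_def in_segment closed_segment_commute[of _ "p u"] qe_def)
            have "x \<in> s f u" using 4(4) \<open>u = w\<close> by simp
            then obtain m where m: "0 \<le> m" "m \<le> 1" "x = (1 - m) *\<^sub>R p u + m *\<^sub>R qf"
              by (auto simp: s_def in_segment closed_segment_commute[of _ "p u"] qf_def)
            have eq: "x - p u = l *\<^sub>R (qe - p u)" "x - p u = m *\<^sub>R (qf - p u)"
              by (subst l(3), simp add: algebra_simps) (subst m(3), simp add: algebra_simps)
            have n: "norm (qe - p u) = r" "norm (qf - p u) = r"
              using qd(1)[OF ef(1) 4(1)] qd(1)[OF ef(2) 4(2)] \<open>u = w\<close> by (auto simp: qe_def qf_def dist_norm norm_minus_commute)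
            have "norm (x - p u) = l * r" using eq(1) n l by simp
            moreover have "norm (x - p u) = m * r" using eq(2) n m by simp
            ultimately have "l = m" "l \<noteq> 0" using r xu by auto
            then have "qe = qf" using eq by simp
            moreover have "qe \<in> D e" using qM[OF ef(1) 4(1)] MD[OF ef(1)] unfolding qe_def by blast
            moreover have "qf \<in> D f" using qM[OF ef(2)] MD[OF ef(2)] 4(2) \<open>u = w\<close> unfolding qf_def by blast
            ultimately have "qe \<in> D e \<inter> D f" by simp
            then obtain y where y: "y \<in> e" "qe = p y" using edge_cross[OF ef] by auto
            have "y \<in> V" using y E_sub[OF ef(1)] by blast
            then show False using sep[of u y] uV r n(1) y by (cases "y = u") (auto simp: dist_norm norm_minus_commute)
          qed
        qed
      qed
    qed
  next
    fix e u assume e: "e \<in> E" "u \<in> e"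
    then obtain w where w: "e = {u, w}" "u \<noteq> w" "u \<in> V" "w \<in> V" using edgeE[OF e(1)] by fastforce
    have we: "w \<in> e" using w by simp
    have "(M e \<union> s e w) \<inter> cball (p u) r = {q (M e) u}"
      using qd(2)[OF e] sc[OF e(1) we] disj[of _ u w] w by blast
    from conic_at_radial_end[OF qd(1)[OF e] r this]
    show "conic_at (D' e) (p u)" by (simp add: D'_def w(1) s_def Un_ac)
  qed
qed

fun pedges :: "'a list \<Rightarrow> 'a set set" where
  "pedges (x # y # zs) = insert {x, y} (pedges (y # zs))"
| "pedges _ = {}"

lemma pedges_append: "pedges (xs @ s # ys) = pedges (xs @ [s]) \<union> pedges (s # ys)"
proof (induction xs)
  case (Cons a xs)
  then show ?case by (cases xs) auto
qed simp

lemma pedges_rev [simp]: "pedges (rev xs) = pedges xs"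
proof (induction xs)
  case (Cons a xs)
  show ?case
  proof (cases xs)
    case (Cons b ys)
    then show ?thesis using Cons.IH pedges_append[of "rev ys" b "[a]"] by (simp add: insert_commute)
  qed simp
qed simp

lemma pedgesD: "e \<in> pedges xs \<Longrightarrow> distinct xs \<Longrightarrow> \<exists>a b. e = {a, b} \<and> a \<noteq> b \<and> a \<in> set xs \<and> b \<in> set xs"
proof (induction xs rule: pedges.induct)
  case (1 x y zs)
  then show ?case by auto
qed auto

lemma pedges_sub: "e \<in> pedges xs \<Longrightarrow> e \<subseteq> set xs"
  by (induction xs rule: pedges.induct) auto

lemma pedges_disjoint:
  assumes "distinct xs" "set xs \<inter> set ys \<subseteq> {s}"
  shows "pedges xs \<inter> pedges ys = {}"
proof (rule ccontr)
  assume "pedges xs \<inter> pedges ys \<noteq> {}"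
  then obtain e where e: "e \<in> pedges xs" "e \<in> pedges ys" by blast
  obtain a b where "e = {a, b}" "a \<noteq> b" using pedgesD[OF e(1) assms(1)] by blast
  then show False using pedges_sub[OF e(1)] pedges_sub[OF e(2)] assms(2) by blast
qed

definition spanning_connected :: "'a set \<Rightarrow> 'a set set \<Rightarrow> bool" where
  "spanning_connected V T \<longleftrightarrow> (\<forall>u\<in>V. \<forall>w\<in>V. \<exists>xs. xs \<noteq> [] \<and> hd xs = u \<and> last xs = w \<and>
     distinct xs \<and> set xs \<subseteq> V \<and> pedges xs \<subseteq> T)"

context plane_graph
begin

definition trace :: "'a list \<Rightarrow> complex set" where
  "trace xs = p ` set xs \<union> \<Union> (D ` pedges xs)"

definition gpath :: "'a list \<Rightarrow> bool" where
  "gpath xs \<longleftrightarrow> xs \<noteq> [] \<and> distinct xs \<and> set xs \<subseteq> V \<and> pedges xs \<subseteq> E"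

lemma gpath_rev [simp]: "gpath (rev xs) = gpath xs" by (simp add: gpath_def)
lemma trace_rev [simp]: "trace (rev xs) = trace xs" by (simp add: trace_def)

lemma trace_append: "trace (xs @ s # ys) = trace (xs @ [s]) \<union> trace (s # ys)"
  unfolding trace_def by (subst pedges_append) auto

lemma trace_verts:
  assumes "gpath xs" shows "trace xs \<inter> p ` V = p ` set xs"
proof
  show "p ` set xs \<subseteq> trace xs \<inter> p ` V" using assms by (auto simp: trace_def gpath_def)
  show "trace xs \<inter> p ` V \<subseteq> p ` set xs"
  proof
    fix y assume y: "y \<in> trace xs \<inter> p ` V"
    show "y \<in> p ` set xs"
    proof (cases "y \<in> p ` set xs")
      case False
      then obtain e where e: "e \<in> pedges xs" "y \<in> D e" using y by (auto simp: trace_def)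
      then have "y \<in> p ` e" using edge_verts[of e] y assms by (auto simp: gpath_def)
      then show ?thesis using pedges_sub[OF e(1)] by blast
    qed
  qed
qed

lemma in_trace_iff: "gpath xs \<Longrightarrow> u \<in> V \<Longrightarrow> p u \<in> trace xs \<longleftrightarrow> u \<in> set xs"
  using trace_verts[of xs] p_eq_iff by (auto simp: gpath_def)

lemma edge_trace:
  assumes "gpath xs" "e \<in> E" "e \<notin> pedges xs"
  shows "D e \<inter> trace xs \<subseteq> p ` (e \<inter> set xs)"
proof
  fix y assume y: "y \<in> D e \<inter> trace xs"
  then consider "y \<in> p ` set xs" | f where "f \<in> pedges xs" "y \<in> D f" by (auto simp: trace_def)
  then show "y \<in> p ` (e \<inter> set xs)"
  proof cases
    case 1
    then obtain u where u: "u \<in> set xs" "y = p u" by blast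
    then have "u \<in> e" using p_in_edge[OF assms(2), of u] y assms(1) by (auto simp: gpath_def)
    then show ?thesis using u by blast
  next
    case 2
    have "y \<in> p ` (e \<inter> f)" using edge_cross[of e f] 2 y assms by (auto simp: gpath_def)
    then show ?thesis using pedges_sub[OF 2(1)] by blast
  qed
qed

lemma trace_Int:
  assumes xs: "gpath xs" and ys: "gpath ys" and "pedges xs \<inter> pedges ys = {}"
  shows "trace xs \<inter> trace ys = p ` (set xs \<inter> set ys)"
proof
  show "p ` (set xs \<inter> set ys) \<subseteq> trace xs \<inter> trace ys" by (auto simp: trace_def)
  show "trace xs \<inter> trace ys \<subseteq> p ` (set xs \<inter> set ys)"
  proof
    fix y assume y: "y \<in> trace xs \<inter> trace ys"
    then consider "y \<in> p ` set ys" | e where "e \<in> pedges ys" "y \<in> D e" by (auto simp: trace_def)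
    then show "y \<in> p ` (set xs \<inter> set ys)"
    proof cases
      case 1
      then obtain u where "u \<in> set ys" "y = p u" by blast
      then show ?thesis using in_trace_iff[OF xs, of u] y ys by (auto simp: gpath_def)
    next
      case 2
      have "e \<in> E" "e \<notin> pedges xs" using 2 assms by (auto simp: gpath_def)
      from edge_trace[OF xs this] have "y \<in> p ` (e \<inter> set xs)" using y 2 by blast
      then show ?thesis using pedges_sub[OF 2(1)] by blast
    qed
  qed
qed

lemma arc_trace: "gpath xs \<Longrightarrow> arc_between (trace xs) (p (hd xs)) (p (last xs))"
proof (induction xs)
  case (Cons x xs)
  show ?case
  proof (cases xs)
    case Nil
    then show ?thesis by (simp add: trace_def)
  next
    case (Cons y ys)
    have g: "gpath xs" "gpath [x, y]" and e: "{x, y} \<in> E" and d: "x \<noteq> y" "x \<notin> set xs"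
      using Cons.prems Cons by (auto simp: gpath_def)
    have tr: "trace (x # xs) = D {x, y} \<union> trace xs"
      using Cons e p_in_edge[OF e, of x] edge_in_V[OF e] by (auto simp: trace_def)
    have "{x, y} \<notin> pedges xs" using pedges_sub[of "{x,y}" xs] d by auto
    from edge_trace[OF g(1) e this] have "D {x, y} \<inter> trace xs \<subseteq> {p y}" using d by auto
    from arc_between_join[OF arc_edge[OF e] _ this] Cons.IH[OF g(1)] Cons
    show ?thesis unfolding tr by simp
  qed
qed (simp add: gpath_def)

lemma trace_sub_skeleton: "gpath xs \<Longrightarrow> trace xs \<subseteq> skeleton"
  by (auto simp: trace_def skeleton_def gpath_def)

lemma skeleton_verts: "p ` V \<subseteq> skeleton" by (auto simp: skeleton_def)

text \<open>
  A path of the graph and an arc that joins its ends through a single face; together they form the Jordan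
  curve whose sides are to be balanced.
\<close>

definition is_chord :: "'a list \<Rightarrow> complex set \<Rightarrow> bool" where
  "is_chord xs \<eta> \<longleftrightarrow> gpath xs \<and> hd xs \<noteq> last xs \<and> arc_between \<eta> (p (hd xs)) (p (last xs)) \<and>
     \<eta> \<inter> skeleton = {p (hd xs), p (last xs)}"

definition verts_in :: "complex set \<Rightarrow> 'a set" where
  "verts_in H = {u \<in> V. p u \<in> H}"

lemma is_chord_rev: "is_chord xs \<eta> \<Longrightarrow> is_chord (rev xs) \<eta>"
  unfolding is_chord_def using arc_between_sym by (auto simp: hd_rev last_rev)

lemma chord_ends:
  assumes "is_chord xs \<eta>"
  shows "hd xs \<in> V" "last xs \<in> V" "p (hd xs) \<noteq> p (last xs)" "hd xs \<in> set xs" "last xs \<in> set xs"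
proof -
  have "xs \<noteq> []" "set xs \<subseteq> V" using assms by (auto simp: is_chord_def gpath_def)
  then show "hd xs \<in> V" "last xs \<in> V" "hd xs \<in> set xs" "last xs \<in> set xs" by auto
  then show "p (hd xs) \<noteq> p (last xs)" using assms p_eq_iff by (simp add: is_chord_def)
qed

lemma chord_trace:
  assumes "is_chord xs \<eta>" shows "trace xs \<inter> \<eta> = {p (hd xs), p (last xs)}"
  using assms trace_sub_skeleton[of xs] in_trace_iff[of xs] chord_ends[OF assms] by (auto simp: is_chord_def)

lemma chord_sides:
  assumes c: "is_chord xs \<eta>" and H: "side_of (trace xs \<union> \<eta>) H"
  shows "open H" "connected H" "H \<noteq> {}" "frontier H = trace xs \<union> \<eta>" "H \<inter> (trace xs \<union> \<eta>) = {}"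
    "closure H = H \<union> trace xs \<union> \<eta>"
proof -
  have g: "gpath xs" and \<eta>: "arc_between \<eta> (p (hd xs)) (p (last xs))" using c by (auto simp: is_chord_def)
  show "open H" "connected H" "H \<noteq> {}" "frontier H = trace xs \<union> \<eta>" "H \<inter> (trace xs \<union> \<eta>) = {}"
    "closure H = H \<union> trace xs \<union> \<eta>"
    using side_of_facts[OF arc_trace[OF g] \<eta> chord_ends(3)[OF c] chord_trace[OF c] H] by auto
qed

lemma connected_stays_in_side:
  assumes "connected S" "S \<inter> H \<noteq> {}" "S \<inter> frontier H = {}"
  shows "S \<subseteq> H"
  using connected_Int_frontier[OF assms(1,2)] assms(3) by blast

lemma edge_stays_in_face:
  assumes fr: "frontier H = J" and e: "{u, w} \<in> E" and u: "p u \<in> H" and dis: "D {u, w} \<inter> J = {}"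
  shows "p w \<in> H"
proof -
  have arc: "arc_between (D {u, w}) (p u) (p w)" using arc_edge[OF e] .
  have "D {u, w} \<inter> H \<noteq> {}" using arc_between_ends[OF arc] u by auto
  moreover have "D {u, w} \<inter> frontier H = {}" using dis fr by simp
  ultimately have "D {u, w} \<subseteq> H" by (rule connected_stays_in_side[OF arc_between_connected[OF arc]])
  then show ?thesis using arc_between_ends[OF arc] by auto
qed

lemma edge_misses_trace:
  assumes g: "gpath xs" and e: "{u, w} \<in> E" and "u \<notin> set xs" "w \<notin> set xs"
  shows "D {u, w} \<inter> trace xs = {}"
proof -
  have "{u, w} \<notin> pedges xs" using pedges_sub[of "{u, w}" xs] assms(3) by auto
  from edge_trace[OF g e this] show ?thesis using assms(3,4) by auto
qed

lemma edge_misses_chord: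
  assumes c: "is_chord xs \<eta>" and e: "{u, w} \<in> E" and "u \<notin> {hd xs, last xs}" "w \<notin> {hd xs, last xs}"
  shows "D {u, w} \<inter> \<eta> = {}"
proof -
  have "D {u, w} \<subseteq> skeleton" using e by (auto simp: skeleton_def)
  then have "D {u, w} \<inter> \<eta> \<subseteq> \<eta> \<inter> skeleton" by auto
  also have "\<dots> = {p (hd xs), p (last xs)}" using c by (simp add: is_chord_def)
  finally have sub: "D {u, w} \<inter> \<eta> \<subseteq> {p (hd xs), p (last xs)}" .
  have "p (hd xs) \<notin> D {u, w}" "p (last xs) \<notin> D {u, w}"
    using p_in_edge[OF e] chord_ends[OF c] assms(3,4) by auto
  then show ?thesis using sub by auto
qed

lemma side_closed_under_edges:
  assumes c: "is_chord xs \<eta>" and H: "side_of (trace xs \<union> \<eta>) H"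
    and e: "{u, w} \<in> E" and u: "u \<in> verts_in H" and w: "w \<notin> set xs"
  shows "w \<in> verts_in H"
proof -
  have g: "gpath xs" using c by (simp add: is_chord_def)
  have uV: "u \<in> V" "p u \<in> H" using u by (auto simp: verts_in_def)
  have us: "u \<notin> set xs" using in_trace_iff[OF g uV(1)] chord_sides(5)[OF c H] uV(2) by blast
  have "u \<notin> {hd xs, last xs}" "w \<notin> {hd xs, last xs}" using chord_ends(4,5)[OF c] us w by auto
  from edge_misses_chord[OF c e this] edge_misses_trace[OF g e us w]
  have "D {u, w} \<inter> (trace xs \<union> \<eta>) = {}" by auto
  from edge_stays_in_face[OF chord_sides(4)[OF c H] e uV(2) this] show ?thesis
    using edge_in_V[OF e] by (simp add: verts_in_def)
qed

end

context conic_plane_graph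
begin

lemma chord_compact:
  assumes "is_chord xs \<eta>" shows "compact \<eta>" "compact (skeleton \<union> \<eta>)"
  using assms arc_between_compact compact_skeleton by (auto simp: is_chord_def)

lemma chord_skeleton: "is_chord xs \<eta> \<Longrightarrow> \<eta> \<inter> skeleton = {p (hd xs), p (last xs)}"
  by (simp add: is_chord_def)

lemma chord_gpath: "is_chord xs \<eta> \<Longrightarrow> gpath xs" by (simp add: is_chord_def)

lemma chord_vertex:
  assumes "is_chord xs \<eta>" "u \<in> V" "p u \<in> \<eta>" shows "u = hd xs \<or> u = last xs"
proof -
  have "p u \<in> \<eta> \<inter> skeleton" using assms skeleton_verts by blast
  then have "p u = p (hd xs) \<or> p u = p (last xs)" unfolding chord_skeleton[OF assms(1)] by blast
  then show ?thesis using p_eq_iff[OF assms(2)] chord_ends[OF assms(1)] by blast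
qed

text \<open>
  A point \<open>h\<close> of \<open>H\<close> close enough to an inner point of the chord has its closest point \<open>c'\<close> of the curve on
  the chord, and the segment between them meets neither the curve nor the graph before \<open>c'\<close>.
\<close>

lemma face_at_chord:
  assumes c: "is_chord xs \<eta>" and H: "side_of (trace xs \<union> \<eta>) H"
  obtains F c' h where "F = connected_component_set (- (skeleton \<union> \<eta>)) h" "h \<in> F" "F \<subseteq> H"
    "c' \<in> \<eta>" "c' \<noteq> p (hd xs)" "c' \<noteq> p (last xs)" "c' \<noteq> h" "closed_segment c' h - {c'} \<subseteq> F" "c' \<in> closure F"
proof -
  let ?J = "trace xs \<union> \<eta>"
  note sides = chord_sides[OF c H]
  have \<eta>: "arc_between \<eta> (p (hd xs)) (p (last xs))" using c by (simp add: is_chord_def)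
  have sk: "\<eta> \<inter> skeleton = {p (hd xs), p (last xs)}" by (rule chord_skeleton[OF c])
  have tr: "trace xs \<subseteq> skeleton" using trace_sub_skeleton chord_gpath[OF c] by blast
  obtain c0 where c0: "c0 \<in> \<eta>" "c0 \<noteq> p (hd xs)" "c0 \<noteq> p (last xs)"
    using arc_between_interior_nonempty[OF \<eta> chord_ends(3)[OF c]] by (metis Diff_iff ex_in_conv finite.emptyI insertCI)
  have "c0 \<in> - skeleton" using c0 sk by blast
  moreover have "open (- skeleton)" using compact_skeleton compact_imp_closed by blast
  ultimately obtain d where d: "d > 0" "ball c0 d \<subseteq> - skeleton" by (meson open_contains_ball)
  have "c0 \<in> closure H" using sides(6) c0 by blast
  then obtain h where h: "h \<in> H" "dist h c0 < d / 2"
    using d(1) half_gt_zero unfolding closure_approachable by blast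
  have "compact ?J"
    using arc_between_compact[OF \<eta>] arc_between_compact[OF arc_trace[OF chord_gpath[OF c]]] by (rule compact_Un[rotated])
  then have "closed ?J" by (rule compact_imp_closed)
  moreover have "?J \<noteq> {}" using c0 by blast
  ultimately obtain c' where c': "c' \<in> ?J" "\<And>y. y \<in> ?J \<Longrightarrow> dist h c' \<le> dist h y"
    using distance_attains_inf[of ?J h] by blast
  have c'h: "dist h c' < d / 2" using c'(2)[of c0] c0(1) h(2) by simp
  have near: "ball h (dist h c') \<subseteq> - skeleton"
  proof
    fix y assume "y \<in> ball h (dist h c')"
    then have "dist c0 y < d" using h(2) c'h dist_triangle[of c0 y h] by (simp add: dist_commute)
    then show "y \<in> - skeleton" using d(2) by auto
  qed
  have "dist c0 c' < d" using h(2) c'h dist_triangle[of c0 c' h] by (simp add: dist_commute)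
  then have "c' \<notin> skeleton" using d(2) by auto
  then have c'\<eta>: "c' \<in> \<eta>" "c' \<noteq> p (hd xs)" "c' \<noteq> p (last xs)" using c'(1) tr sk by auto
  have "c' \<notin> H" using c'(1) sides(5) by blast
  then have c'neh: "c' \<noteq> h" using h(1) by blast
  have ballJ: "ball h (dist h c') \<inter> ?J = {}"
  proof (rule ccontr)
    assume "ball h (dist h c') \<inter> ?J \<noteq> {}"
    then obtain y where "y \<in> ?J" "y \<in> ball h (dist h c')" by blast
    then have "y \<in> ?J" "dist h y < dist h c'" by (simp_all only: mem_ball)
    then show False using c'(2)[of y] by simp
  qed
  define F where "F = connected_component_set (- (skeleton \<union> \<eta>)) h"
  have hb: "h \<in> ball h (dist h c')" using c'neh by simp
  have bF: "ball h (dist h c') \<subseteq> F"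
    unfolding F_def by (rule connected_component_maximal[OF hb]) (use near ballJ in auto)
  have FH: "F \<subseteq> H"
  proof (rule connected_stays_in_side)
    show "connected F" by (simp add: F_def)
    show "F \<inter> H \<noteq> {}" using bF hb h(1) by blast
    have "F \<subseteq> - (skeleton \<union> \<eta>)" unfolding F_def by (rule connected_component_subset)
    then show "F \<inter> frontier H = {}" unfolding sides(4) using tr by blast
  qed
  have "closed_segment c' h - {c'} \<subseteq> ball h (dist h c')"
  proof
    fix y assume y: "y \<in> closed_segment c' h - {c'}"
    then obtain l where l: "0 \<le> l" "l \<le> 1" "y = (1 - l) *\<^sub>R c' + l *\<^sub>R h" by (auto simp: in_segment)
    have "l \<noteq> 0" using y l by auto
    have "h - y = (1 - l) *\<^sub>R (h - c')" by (subst l(3)) (simp add: algebra_simps)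
    then have "dist h y = (1 - l) * dist h c'" using l by (simp add: dist_norm)
    also have "\<dots> < 1 * dist h c'" using \<open>l \<noteq> 0\<close> l c'neh by (intro mult_strict_right_mono) auto
    finally show "y \<in> ball h (dist h c')" by simp
  qed
  then have seg: "closed_segment c' h - {c'} \<subseteq> F" using bF by blast
  moreover have "c' \<in> closure F"
  proof -
    have "c' \<in> closure (open_segment c' h)" using c'neh by simp
    moreover have "open_segment c' h \<subseteq> F" using seg by (auto simp: open_segment_def)
    ultimately show ?thesis using closure_mono by blast
  qed
  ultimately show ?thesis using that[OF F_def _ FH c'\<eta> c'neh] bF hb by blast
qed

lemma segment_into_face:
  fixes u :: complex
  assumes K: "\<And>q. dist u q < r \<Longrightarrow> q \<notin> K \<Longrightarrow> closed_segment u q \<inter> K \<subseteq> {u}"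
    and F: "F = connected_component_set (- K) h" and q: "q \<in> F" "dist u q < r" and u: "u \<in> K"
  shows "closed_segment u q - {u} \<subseteq> F"
proof -
  have qK: "q \<notin> K" using q(1) connected_component_subset[of "- K" h] unfolding F by blast
  have "arc_between (closed_segment u q) q u" using arc_between_sym[OF arc_between_segment] .
  then have "connected (closed_segment u q - {u})" by (rule arc_between_halfopen_connected)
  moreover have "closed_segment u q - {u} \<subseteq> - K" using K[OF q(2) qK] by blast
  moreover have "q \<in> closed_segment u q - {u}" using qK u by auto
  moreover have "F = connected_component_set (- K) q"
    using q(1) connected_component_eq unfolding F by blast
  ultimately show ?thesis by (metis connected_component_maximal)
qed

lemma accessible_vertex:
  assumes K: "conic_at K (p t)" "closed K" "p t \<in> K"
    and F: "F = connected_component_set (- K) h" and h: "h \<in> F"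
    and cl: "p t \<in> closure F" and c': "c' \<in> K" "c' \<noteq> h" "closed_segment c' h - {c'} \<subseteq> F" "c' \<noteq> p t"
  obtains g where "arc_between g c' (p t)" "g \<subseteq> {c', p t} \<union> F" "conic_at g (p t)"
proof -
  obtain r where r: "r > 0" "\<And>q. dist (p t) q < r \<Longrightarrow> q \<notin> K \<Longrightarrow> closed_segment (p t) q \<inter> K \<subseteq> {p t}"
    using K(1) unfolding conic_at_def by blast
  obtain q where q: "q \<in> F" "dist (p t) q < r"
    using cl r(1) unfolding closure_approachable by (metis dist_commute)
  have seg: "closed_segment (p t) y - {p t} \<subseteq> F" if "y \<in> F" "dist (p t) y < r" for y
    using segment_into_face[OF r(2) F that K(3)] .
  have "open F" unfolding F using K(2) by (intro open_connected_component) auto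
  moreover have "connected F" by (simp add: F)
  ultimately have "path_connected F" using connected_open_path_connected by blast
  then obtain g0 where g0: "path g0" "path_image g0 \<subseteq> F" "pathstart g0 = h" "pathfinish g0 = q"
    using h q(1) unfolding path_connected_def by blast
  define g1 where "g1 = linepath c' h +++ g0 +++ linepath q (p t)"
  have g1: "path g1" "pathstart g1 = c'" "pathfinish g1 = p t" using g0 by (auto simp: g1_def)
  have "path_image g1 \<subseteq> closed_segment c' h \<union> (path_image g0 \<union> closed_segment q (p t))"
    unfolding g1_def using g0 by (simp add: path_image_join)
  then have g1im: "path_image g1 \<subseteq> {c', p t} \<union> F"
    using g0(2) c'(3) seg[OF q] by (auto simp: closed_segment_commute)
  obtain S where S: "arc_between S c' (p t)" "S \<subseteq> path_image g1"
    using arc_between_subset_path[OF g1] by blast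
  \<comment> \<open>so small that the arc does not start in the disc and that the segment to \<open>p t\<close> stays in \<open>F\<close>\<close>
  define r' where "r' = min r (dist (p t) c') / 2"
  have r': "0 < r'" "r' < dist (p t) c'" "r' < r" using r(1) c'(4) by (auto simp: r'_def min_def)
  obtain M y where M: "M \<subseteq> S" "arc_between M c' y" "dist (p t) y = r'" "M \<inter> cball (p t) r' = {y}"
    using arc_first_entry[OF S(1) r'(1,2)] by blast
  have yM: "y \<in> M" using M(4) by blast
  have "y \<noteq> c'" "y \<noteq> p t" using M(3) r' by auto
  then have yF: "y \<in> F" using yM M(1) S(2) g1im by blast
  have segy: "closed_segment y (p t) - {p t} \<subseteq> F" using seg[OF yF] M(3) r'(3) by (simp add: closed_segment_commute)
  have "closed_segment y (p t) \<subseteq> cball (p t) r'" using M(3) r'(1) by (intro closed_segment_subset) auto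
  then have "M \<inter> closed_segment y (p t) \<subseteq> {y}" using M(4) by blast
  from arc_between_join[OF M(2) arc_between_segment this]
  have "arc_between (M \<union> closed_segment y (p t)) c' (p t)" .
  moreover have "M \<union> closed_segment y (p t) \<subseteq> {c', p t} \<union> F" using M(1) S(2) g1im segy by blast
  moreover have "conic_at (M \<union> closed_segment y (p t)) (p t)"
    using conic_at_radial_end[OF M(3) r'(1) M(4)] .
  ultimately show ?thesis using that by blast
qed

lemma edge_in_frontier_of_face:
  assumes Y: "compact Y" "Y \<inter> skeleton \<subseteq> p ` V" and F: "F \<in> components (- (skeleton \<union> Y))"
    and f: "f \<in> E" and y: "y \<in> frontier F" "y \<in> D f" "y \<notin> p ` V"
  shows "p ` f \<subseteq> closure F"
proof -
  obtain a b where ab: "f = {a, b}" "a \<in> V" "b \<in> V" "a \<noteq> b" using edgeE[OF f] by blast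
  define K0 where "K0 = p ` V \<union> \<Union> (D ` (E - {f})) \<union> Y"
  have K0: "compact K0" unfolding K0_def using finite_V finite_E compact_edge Y(1)
    by (intro compact_Un[OF compact_Un[OF finite_imp_compact]] compact_Union) auto
  have eq: "K0 \<union> D f = skeleton \<union> Y" using f by (auto simp: K0_def skeleton_def)
  have Vf: "p ` V \<inter> D f \<subseteq> {p a, p b}" using edge_verts[OF f] ab(1) by auto
  have "D f' \<inter> D f \<subseteq> {p a, p b}" if "f' \<in> E - {f}" for f'
  proof -
    have "D f' \<inter> D f = p ` (f' \<inter> f)" using edge_cross[of f' f] f that by blast
    then show ?thesis using ab(1) by auto
  qed
  moreover have "D f \<subseteq> skeleton" using f by (auto simp: skeleton_def)
  then have "Y \<inter> D f \<subseteq> {p a, p b}" using Y(2) Vf by blast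
  ultimately have K0f: "K0 \<inter> D f \<subseteq> {p a, p b}" using Vf unfolding K0_def by blast
  have arc: "arc_between (D f) (p a) (p b)" using arc_edge[of a b] f ab(1) by simp
  have "y \<in> D f - {p a, p b}" using y(2,3) ab by blast
  then have "D f \<subseteq> frontier F"
    using arc_in_frontier_of_face[OF K0 arc K0f _ y(1)] F[folded eq] by blast
  then show ?thesis using arc_between_ends[OF arc] ab(1) by (auto simp: frontier_def)
qed

text \<open>
  Every edge that the frontier of \<open>F\<close> touches has both ends on the frontier, so if these can only be the two
  ends of the chord, there is at most one such edge.
\<close>

lemma face_frontier:
  assumes c: "is_chord xs \<eta>" and F: "F = connected_component_set (- (skeleton \<union> \<eta>)) h" "h \<in> F"
    and fr: "\<And>t. t \<in> V \<Longrightarrow> p t \<in> closure F \<Longrightarrow> t = hd xs \<or> t = last xs"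
    and y: "y \<in> frontier F" "y \<notin> \<eta>"
  shows "{hd xs, last xs} \<in> E" "y \<in> D {hd xs, last xs}"
proof -
  have cl: "closed (skeleton \<union> \<eta>)" using chord_compact(2)[OF c] compact_imp_closed by blast
  have comp: "F \<in> components (- (skeleton \<union> \<eta>))"
  proof -
    have "h \<in> - (skeleton \<union> \<eta>)" using F connected_component_subset by blast
    then show ?thesis unfolding F(1) components_def by blast
  qed
  have "frontier F \<subseteq> frontier (- (skeleton \<union> \<eta>))" by (rule frontier_of_components_subset[OF comp])
  also have "\<dots> \<subseteq> skeleton \<union> \<eta>" unfolding frontier_complement using cl by (rule frontier_subset_closed)
  finally have frK: "frontier F \<subseteq> skeleton \<union> \<eta>" .
  have clF: "frontier F \<subseteq> closure F" by (simp add: frontier_def)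
  have hdl: "p (hd xs) \<in> \<eta>" "p (last xs) \<in> \<eta>" using chord_skeleton[OF c] by auto
  have "y \<notin> p ` V"
  proof
    assume "y \<in> p ` V"
    then obtain t where t: "t \<in> V" "y = p t" by blast
    then have "t = hd xs \<or> t = last xs" using fr[OF t(1)] y(1) clF by blast
    then show False using hdl t y(2) by blast
  qed
  then obtain f where f: "f \<in> E" "y \<in> D f" using frK y by (auto simp: skeleton_def)
  obtain a b where ab: "f = {a, b}" "a \<in> V" "b \<in> V" "a \<noteq> b" using edgeE[OF f(1)] by blast
  have "\<eta> \<inter> skeleton \<subseteq> p ` V" unfolding chord_skeleton[OF c] using chord_ends[OF c] by auto
  from edge_in_frontier_of_face[OF chord_compact(1)[OF c] this comp f(1) y(1) f(2) \<open>y \<notin> p ` V\<close>]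
  have "p a \<in> closure F" "p b \<in> closure F" using ab(1) by auto
  then have "a = hd xs \<or> a = last xs" "b = hd xs \<or> b = last xs" using fr ab(2,3) by blast+
  then have "f = {hd xs, last xs}" using ab(1,4) by auto
  then show "{hd xs, last xs} \<in> E" "y \<in> D {hd xs, last xs}" using f by simp_all
qed

text \<open>
  Consider the face \<open>F\<close> of \<open>H\<close> next to the chord. A vertex on its frontier other than the ends of the chord
  can be reached by an arc \<open>g\<close> through \<open>F\<close>. If there is none, then the frontier of \<open>F\<close> lies on the chord and
  on the edge parallel to it. This edge must run through \<open>H\<close>, since otherwise \<open>F\<close> would be all of \<open>H\<close>,
  which contains vertices. So \<open>F\<close> is the lens between the chord and the edge, and beyond the edge all
  vertices of \<open>H\<close> are found again.
\<close>

lemma chord_hits_vertex_or_parallel_edge: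
  assumes c: "is_chord xs \<eta>" and H: "side_of (trace xs \<union> \<eta>) H" and ne: "verts_in H \<noteq> {}"
  shows "(\<exists>c' t g. c' \<in> \<eta> \<and> c' \<noteq> p (hd xs) \<and> c' \<noteq> p (last xs) \<and> t \<noteq> hd xs \<and> t \<noteq> last xs \<and>
            t \<in> verts_in H \<union> set xs \<and> arc_between g c' (p t) \<and> g - {c', p t} \<subseteq> H \<and>
            g \<inter> (skeleton \<union> \<eta>) = {c', p t} \<and> conic_at g (p t)) \<or>
         (\<exists>H'. {hd xs, last xs} \<in> E - pedges xs \<and> D {hd xs, last xs} \<inter> H \<noteq> {} \<and>
            side_of (trace xs \<union> D {hd xs, last xs}) H' \<and> H' \<subseteq> H - D {hd xs, last xs} \<and>
            verts_in H' = verts_in H)"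
proof -
  let ?J = "trace xs \<union> \<eta>" and ?K = "skeleton \<union> \<eta>"
  note sides = chord_sides[OF c H]
  have sk: "\<eta> \<inter> skeleton = {p (hd xs), p (last xs)}" by (rule chord_skeleton[OF c])
  have g: "gpath xs" by (rule chord_gpath[OF c])
  have \<eta>: "arc_between \<eta> (p (hd xs)) (p (last xs))" using c by (simp add: is_chord_def)
  obtain F c' h where F: "F = connected_component_set (- ?K) h" "h \<in> F" "F \<subseteq> H"
    and c': "c' \<in> \<eta>" "c' \<noteq> p (hd xs)" "c' \<noteq> p (last xs)" "c' \<noteq> h" "closed_segment c' h - {c'} \<subseteq> F" "c' \<in> closure F"
    using face_at_chord[OF c H] by metis
  have FK: "F \<inter> ?K = {}" using connected_component_subset[of "- ?K" h] unfolding F(1) by blast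
  have conF: "connected F" by (simp add: F(1))
  have clFH: "closure F \<subseteq> H \<union> ?J" using closure_mono[OF F(3)] sides(6) by blast
  show ?thesis
  proof (cases "\<exists>t\<in>V. p t \<in> closure F \<and> t \<noteq> hd xs \<and> t \<noteq> last xs")
    case True
    then obtain t where t: "t \<in> V" "p t \<in> closure F" "t \<noteq> hd xs" "t \<noteq> last xs" by blast
    have ptsk: "p t \<in> skeleton" using t(1) skeleton_verts by blast
    have pt\<eta>: "p t \<notin> \<eta>" using chord_vertex[OF c t(1)] t(3,4) by blast
    have "closed \<eta>" using chord_compact(1)[OF c] compact_imp_closed by blast
    then have con: "conic_at ?K (p t)"
      using conic_at_Un[OF conic_skeleton[OF t(1)] conic_at_away] pt\<eta> by blast
    have clK: "closed ?K" using chord_compact(2)[OF c] compact_imp_closed by blast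
    have "p t \<in> ?K" using ptsk by blast
    moreover have "c' \<in> ?K" "c' \<noteq> p t" using c'(1) pt\<eta> by auto
    ultimately obtain g' where g': "arc_between g' c' (p t)" "g' \<subseteq> {c', p t} \<union> F" "conic_at g' (p t)"
      using accessible_vertex[OF con clK _ F(1,2) t(2) _ c'(4,5)] by blast
    have "t \<in> verts_in H \<union> set xs"
    proof (cases "p t \<in> H")
      case False
      then have "p t \<in> trace xs" using t(2) clFH pt\<eta> by blast
      then show ?thesis using in_trace_iff[OF g t(1)] by blast
    qed (simp add: verts_in_def t(1))
    moreover have "g' - {c', p t} \<subseteq> H" using g'(2) F(3) by blast
    moreover have "g' \<inter> ?K = {c', p t}"
      using g'(2) FK arc_between_ends[OF g'(1)] c'(1) ptsk by blast
    ultimately show ?thesis using c' t g' by blast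
  next
    case False
    then have fr: "\<And>t. t \<in> V \<Longrightarrow> p t \<in> closure F \<Longrightarrow> t = hd xs \<or> t = last xs" by blast
    let ?e = "{hd xs, last xs}"
    \<comment> \<open>a frontier on the curve alone would make \<open>F\<close> all of \<open>H\<close>\<close>
    have "\<not> frontier F \<subseteq> ?J"
    proof
      assume sub: "frontier F \<subseteq> ?J"
      have "H \<subseteq> F"
      proof (rule connected_stays_in_side[OF sides(2)])
        show "H \<inter> F \<noteq> {}" using F(2,3) by blast
        show "H \<inter> frontier F = {}" using sub sides(5) by blast
      qed
      moreover obtain u where "u \<in> V" "p u \<in> H" using ne by (auto simp: verts_in_def)
      ultimately show False using FK skeleton_verts by blast
    qed
    then obtain y where y: "y \<in> frontier F" "y \<notin> ?J" by blast
    have y\<eta>: "y \<notin> \<eta>" using y(2) by blast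
    note e = face_frontier[OF c F(1,2) fr y(1) y\<eta>]
    have eG: "?e \<notin> pedges xs" using e(2) y(2) by (auto simp: trace_def)
    have yH: "y \<in> H" using y clFH by (auto simp: frontier_def)
    have tre: "trace xs \<inter> D ?e = {p (hd xs), p (last xs)}"
      using edge_trace[OF g e(1) eG] p_in_edge[OF e(1)] in_trace_iff[OF g] chord_ends[OF c] by auto
    have esk: "D ?e \<subseteq> skeleton" using e(1) by (auto simp: skeleton_def)
    have \<eta>e: "\<eta> \<inter> D ?e = {p (hd xs), p (last xs)}"
      using sk esk p_in_edge[OF e(1)] chord_ends[OF c] by blast
    obtain H1 H2 where H12: "side_of (\<eta> \<union> D ?e) H1" "side_of (trace xs \<union> D ?e) H2"
      "H1 \<inter> H2 = {}" "H1 \<union> H2 = H - D ?e"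
    proof (rule theta_split[OF \<eta> arc_trace[OF g] arc_edge[OF e(1)] chord_ends(3)[OF c] _ \<eta>e tre])
      show "\<eta> \<inter> trace xs = {p (hd xs), p (last xs)}" using chord_trace[OF c] by blast
      show "side_of (\<eta> \<union> trace xs) H" using H by (simp add: Un_commute)
      show "D ?e \<inter> H \<noteq> {}" using e(2) yH by blast
    qed blast
    note s1 = side_of_facts[OF \<eta> arc_edge[OF e(1)] chord_ends(3)[OF c] \<eta>e H12(1)]
    note s2 = side_of_facts[OF arc_trace[OF g] arc_edge[OF e(1)] chord_ends(3)[OF c] tre H12(2)]
    have frF: "frontier F \<subseteq> \<eta> \<union> D ?e" using face_frontier(2)[OF c F(1,2) fr] by blast
    have FnD: "F \<subseteq> H - D ?e"
    proof
      fix z assume z: "z \<in> F"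
      then have "z \<notin> skeleton" using FK by auto
      then show "z \<in> H - D ?e" using z F(3) esk by auto
    qed
    \<comment> \<open>The face touches the chord at \<open>c'\<close>, which is not in the closure of the part of \<open>H\<close> beyond the edge.\<close>
    have "F \<inter> H1 \<noteq> {}"
    proof
      assume "F \<inter> H1 = {}"
      then have "F \<subseteq> H2" using FnD unfolding H12(4)[symmetric] by auto
      then have "c' \<in> closure H2" using c'(6) closure_mono by blast
      then have "c' \<in> H2 \<union> trace xs \<union> D ?e" by (simp only: s2(6))
      then have "c' \<in> H2 \<or> c' \<in> skeleton" using esk trace_sub_skeleton[OF g] by auto
      moreover have "c' \<notin> H" using c'(1) sides(5) by auto
      then have "c' \<notin> H2" using H12(4) by auto
      moreover have "c' \<notin> skeleton"
      proof
        assume "c' \<in> skeleton"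
        then have "c' \<in> \<eta> \<inter> skeleton" using c'(1) by simp
        then show False unfolding sk using c'(2,3) by simp
      qed
      ultimately show False by simp
    qed
    then have "H1 \<inter> F \<noteq> {}" by (simp add: Int_commute)
    moreover have "H1 \<inter> frontier F = {}" using frF s1(5) by (auto simp: set_eq_iff)
    ultimately have H1F: "H1 \<subseteq> F" using connected_stays_in_side[OF s1(2), of F] by simp
    have "verts_in H1 = {}"
    proof (rule ccontr)
      assume "verts_in H1 \<noteq> {}"
      then obtain u where "u \<in> V" "p u \<in> F" using H1F by (auto simp: verts_in_def)
      then show False using FK skeleton_verts by auto
    qed
    moreover have "verts_in H \<subseteq> verts_in H1 \<union> verts_in H2"
    proof
      fix u assume u: "u \<in> verts_in H"
      then have uV: "u \<in> V" "p u \<in> H" by (auto simp: verts_in_def)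
      have "p u \<notin> D ?e"
      proof
        assume "p u \<in> D ?e"
        then have "u \<in> set xs" using p_in_edge[OF e(1) uV(1)] chord_ends[OF c] by blast
        then show False using in_trace_iff[OF g uV(1)] uV(2) sides(5) by blast
      qed
      then show "u \<in> verts_in H1 \<union> verts_in H2" using uV H12(4) by (auto simp: verts_in_def)
    qed
    moreover have "verts_in H2 \<subseteq> verts_in H" using H12(4) by (auto simp: verts_in_def)
    ultimately have "verts_in H2 = verts_in H" by blast
    moreover have "H2 \<subseteq> H - D ?e" using H12(4) by blast
    moreover have "?e \<in> E - pedges xs" using e(1) eG by blast
    moreover have "D ?e \<inter> H \<noteq> {}" using e(2) yH by blast
    ultimately show ?thesis using H12(2) by blast
  qed
qed

end

context plane_graph
begin

section \<open>Descent to a balanced chord\<close>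

text \<open>
  The chord is straight near its ends, so that it may later be exchanged with an edge.
\<close>

definition chord_state :: "'a set set \<Rightarrow> 'a list \<Rightarrow> complex set \<Rightarrow> complex set \<Rightarrow> bool" where
  "chord_state T xs \<eta> H \<longleftrightarrow> is_chord xs \<eta> \<and> pedges xs \<subseteq> T \<and> conic_at \<eta> (p (hd xs)) \<and>
     conic_at \<eta> (p (last xs)) \<and> side_of (trace xs \<union> \<eta>) H"

end

context conic_plane_graph
begin

lemma chord_end_parts:
  assumes "g \<inter> (S \<union> X) = {c, q}" "c \<in> X" "c \<notin> S" "q \<in> S" "q \<notin> X"
  shows "g \<inter> S = {q}" "g \<inter> X = {c}"
  using assms by (auto simp: set_eq_iff)

text \<open>
  Half of the old chord and the new arc \<open>g\<close> form a chord for the path that leaves the old path at \<open>s\<close> and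
  runs to \<open>t\<close>.
\<close>

lemma chord_reroute:
  assumes c: "is_chord (xs1 @ s # xs2) \<eta>" and con: "conic_at \<eta> (p (hd (xs1 @ s # xs2)))"
    and ys: "gpath (as @ [s])" "hd (as @ [s]) = t" "set as \<inter> set (xs1 @ s # xs2) = {}"
    and t: "t \<noteq> hd (xs1 @ s # xs2)" "t \<noteq> last (xs1 @ s # xs2)"
    and c': "c' \<in> \<eta>" "c' \<noteq> p (hd (xs1 @ s # xs2))" "c' \<noteq> p (last (xs1 @ s # xs2))"
    and g: "arc_between g c' (p t)" "g \<inter> (skeleton \<union> \<eta>) = {c', p t}" "conic_at g (p t)"
    and \<eta>12: "arc_between \<eta>1 (p (hd (xs1 @ s # xs2))) c'" "arc_between \<eta>2 c' (p (last (xs1 @ s # xs2)))"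
      "\<eta>1 \<union> \<eta>2 = \<eta>" "\<eta>1 \<inter> \<eta>2 = {c'}"
  shows "is_chord (xs1 @ s # rev as) (\<eta>1 \<union> g)" "conic_at (\<eta>1 \<union> g) (p (hd (xs1 @ s # rev as)))"
    "conic_at (\<eta>1 \<union> g) (p (last (xs1 @ s # rev as)))"
    "hd (xs1 @ s # rev as) = hd (xs1 @ s # xs2)" "last (xs1 @ s # rev as) = t"
proof -
  let ?xs = "xs1 @ s # xs2" and ?zs = "xs1 @ s # rev as"
  note ends = chord_ends[OF c]
  have gx: "gpath ?xs" by (rule chord_gpath[OF c])
  have hdz: "hd ?zs = hd ?xs" by (cases xs1) auto
  have lz: "last ?zs = t" using ys(2) by (cases as) (auto simp: last_append)
  show "hd ?zs = hd ?xs" "last ?zs = t" by fact+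
  have tV: "t \<in> V" using ys(1,2) by (cases as) (auto simp: gpath_def)
  have "pedges ?zs = pedges (xs1 @ [s]) \<union> pedges (rev (as @ [s]))"
    using pedges_append[of xs1 s "rev as"] by simp
  then have pz: "pedges ?zs = pedges (xs1 @ [s]) \<union> pedges (as @ [s])" by (simp only: pedges_rev)
  have "pedges (xs1 @ [s]) \<subseteq> E" using gx pedges_append[of xs1 s xs2] by (auto simp: gpath_def)
  then have gz: "gpath ?zs" using gx ys(1,3) pz by (auto simp: gpath_def)
  have sk: "\<eta> \<inter> skeleton = {p (hd ?xs), p (last ?xs)}" by (rule chord_skeleton[OF c])
  have pt\<eta>: "p t \<notin> \<eta>" using chord_vertex[OF c tV] t by blast
  have c'sk: "c' \<notin> skeleton"
  proof
    assume "c' \<in> skeleton"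
    with c'(1) have "c' \<in> \<eta> \<inter> skeleton" by simp
    then show False unfolding sk using c'(2,3) by simp
  qed
  have ptsk: "p t \<in> skeleton" using tV skeleton_verts by blast
  have gsk: "g \<inter> skeleton = {p t}" by (rule chord_end_parts(1)[OF g(2) c'(1) c'sk ptsk pt\<eta>])
  have g\<eta>: "g \<inter> \<eta> = {c'}" by (rule chord_end_parts(2)[OF g(2) c'(1) c'sk ptsk pt\<eta>])
  have pl: "p (last ?xs) \<notin> \<eta>1" using \<eta>12(4) arc_between_ends[OF \<eta>12(2)] c'(3) by auto
  have ph: "p (hd ?xs) \<notin> \<eta>2" using \<eta>12(4) arc_between_ends[OF \<eta>12(1)] c'(2) by auto
  have \<eta>1sk: "\<eta>1 \<inter> skeleton = {p (hd ?xs)}"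
  proof (rule set_eqI)
    fix z
    have "p (hd ?xs) \<in> skeleton" using sk by auto
    moreover have "z = p (hd ?xs) \<or> z = p (last ?xs)" if "z \<in> \<eta>1" "z \<in> skeleton"
    proof -
      have "z \<in> \<eta> \<inter> skeleton" using that \<eta>12(3) by auto
      then show ?thesis by (simp only: sk insert_iff empty_iff) simp
    qed
    ultimately show "z \<in> \<eta>1 \<inter> skeleton \<longleftrightarrow> z \<in> {p (hd ?xs)}"
      using pl arc_between_ends[OF \<eta>12(1)] by auto
  qed
  have "\<eta>1 \<inter> g \<subseteq> {c'}" using g\<eta> \<eta>12(3) by auto
  from arc_between_join[OF \<eta>12(1) g(1) this]
  have "arc_between (\<eta>1 \<union> g) (p (hd ?zs)) (p (last ?zs))" unfolding hdz lz .
  moreover have "(\<eta>1 \<union> g) \<inter> skeleton = {p (hd ?zs), p (last ?zs)}" unfolding hdz lz Int_Un_distrib2 \<eta>1sk gsk by (simp add: insert_commute)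
  ultimately show "is_chord ?zs (\<eta>1 \<union> g)" using gz hdz lz t(1) by (simp add: is_chord_def)
  have cl: "closed (\<eta>2 \<union> g)" using arc_between_closed \<eta>12(2) g(1) by blast
  have "p (hd ?xs) \<notin> g"
  proof
    assume "p (hd ?xs) \<in> g"
    then have "p (hd ?xs) \<in> g \<inter> \<eta>" using \<eta>12(3) arc_between_ends[OF \<eta>12(1)] by auto
    then show False using g\<eta> c'(2) by simp
  qed
  then have "p (hd ?xs) \<in> - (\<eta>2 \<union> g)" using ph by blast
  then obtain d where d: "d > 0" "ball (p (hd ?xs)) d \<subseteq> - (\<eta>2 \<union> g)"
    using cl by (meson open_Compl open_contains_ball)
  have "\<eta> \<inter> ball (p (hd ?xs)) d = (\<eta>1 \<union> g) \<inter> ball (p (hd ?xs)) d" using d(2) \<eta>12(3) by auto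
  from conic_at_cong[OF con d(1) this] show "conic_at (\<eta>1 \<union> g) (p (hd ?zs))" unfolding hdz .
  have "p t \<notin> \<eta>1" using pt\<eta> \<eta>12(3) by blast
  from conic_at_Un[OF conic_at_away[OF arc_between_closed[OF \<eta>12(1)] this] g(3)]
  show "conic_at (\<eta>1 \<union> g) (p (last ?zs))" unfolding lz .
qed

text \<open>
  The arc \<open>g\<close> to \<open>t\<close>, continued along a path of \<open>T\<close> from \<open>t\<close> to the first vertex \<open>s\<close> of the old path, is a
  crosscut of \<open>H\<close>. Both parts are smaller: they have lost \<open>t\<close> if \<open>t\<close> is inside \<open>H\<close>, and otherwise \<open>s = t\<close> is an
  inner vertex of the old path and the two paths are proper pieces of it.
\<close>

lemma chord_split:
  assumes T: "spanning_connected V T" "T \<subseteq> E" and st: "chord_state T xs \<eta> H"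
    and c': "c' \<in> \<eta>" "c' \<noteq> p (hd xs)" "c' \<noteq> p (last xs)"
    and t: "t \<noteq> hd xs" "t \<noteq> last xs" "t \<in> verts_in H \<union> set xs"
    and g: "arc_between g c' (p t)" "g - {c', p t} \<subseteq> H" "g \<inter> (skeleton \<union> \<eta>) = {c', p t}" "conic_at g (p t)"
  shows "\<exists>xs1 \<eta>1 H1 xs2 \<eta>2 H2. chord_state T xs1 \<eta>1 H1 \<and> chord_state T xs2 \<eta>2 H2 \<and>
     verts_in H1 \<inter> verts_in H2 = {} \<and> verts_in H1 \<union> verts_in H2 \<subseteq> verts_in H \<and>
     verts_in H - (verts_in H1 \<union> verts_in H2) \<subseteq> set xs1 \<inter> set xs2 \<and>
     (verts_in H1 \<subset> verts_in H \<or> verts_in H1 \<subseteq> verts_in H \<and> length xs1 < length xs) \<and>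
     (verts_in H2 \<subset> verts_in H \<or> verts_in H2 \<subseteq> verts_in H \<and> length xs2 < length xs)"
proof -
  have c: "is_chord xs \<eta>" and xT: "pedges xs \<subseteq> T" and con: "conic_at \<eta> (p (hd xs))" "conic_at \<eta> (p (last xs))"
    and H: "side_of (trace xs \<union> \<eta>) H" using st by (auto simp: chord_state_def)
  have gx: "gpath xs" by (rule chord_gpath[OF c])
  note ends = chord_ends[OF c]
  note sides = chord_sides[OF c H]
  have tV: "t \<in> V" using t(3) gx by (auto simp: verts_in_def gpath_def)
  obtain zs where zs: "zs \<noteq> []" "hd zs = t" "last zs = hd xs" "distinct zs" "set zs \<subseteq> V" "pedges zs \<subseteq> T"
    using T(1) tV ends(1) unfolding spanning_connected_def by blast
  have "\<exists>x\<in>set zs. x \<in> set xs" using zs(1,3) ends(4) last_in_set by metis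
  then obtain as s bs where asb: "zs = as @ s # bs" "s \<in> set xs" "\<forall>a\<in>set as. a \<notin> set xs"
    using split_list_first_prop[of zs "\<lambda>x. x \<in> set xs"] by blast
  obtain xs1 xs2 where xs: "xs = xs1 @ s # xs2" using split_list[OF asb(2)] by blast
  have pas: "pedges (as @ [s]) \<subseteq> T" using zs(6) pedges_append[of as s bs] asb(1) by auto
  have ys: "gpath (as @ [s])" using zs(4,5) pas T(2) asb(1) by (auto simp: gpath_def)
  have hdt: "hd (as @ [s]) = t" using zs(2) asb(1) by (cases as) auto
  have dis: "set as \<inter> set xs = {}" using asb(3) by blast
  obtain \<eta>1 \<eta>2 where \<eta>12: "arc_between \<eta>1 (p (hd xs)) c'" "arc_between \<eta>2 c' (p (last xs))" "\<eta>1 \<union> \<eta>2 = \<eta>" "\<eta>1 \<inter> \<eta>2 = {c'}"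
    using arc_between_split[of \<eta> "p (hd xs)" "p (last xs)" c'] c c'(1) unfolding is_chord_def by metis
  define zs1 where "zs1 = xs1 @ s # rev as"
  define zs2 where "zs2 = rev xs2 @ s # rev as"
  note r1 = chord_reroute[OF c[unfolded xs] con(1)[unfolded xs] ys hdt dis[unfolded xs] t(1,2)[unfolded xs]
      c'[unfolded xs] g(1,3,4) \<eta>12[unfolded xs], folded zs1_def xs]
  have revxs: "rev xs = rev xs2 @ s # rev xs1" by (simp add: xs)
  have xsne: "xs \<noteq> []" by (simp add: xs)
  have hr: "hd (rev xs) = last xs" "last (rev xs) = hd xs" using xsne by (auto simp: hd_rev last_rev)
  have r2: "is_chord zs2 (\<eta>2 \<union> g)" "conic_at (\<eta>2 \<union> g) (p (hd zs2))" "conic_at (\<eta>2 \<union> g) (p (last zs2))"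
    "hd zs2 = last xs" "last zs2 = t"
  proof -
    have a1: "is_chord (rev xs) \<eta>" by (rule is_chord_rev[OF c])
    have a2: "conic_at \<eta> (p (hd (rev xs)))" using con(2) hr by simp
    have a3: "set as \<inter> set (rev xs) = {}" using dis by simp
    have a4: "t \<noteq> hd (rev xs)" "t \<noteq> last (rev xs)" using t hr by auto
    have a5: "c' \<noteq> p (hd (rev xs))" "c' \<noteq> p (last (rev xs))" using c' hr by auto
    have a6: "arc_between \<eta>2 (p (hd (rev xs))) c'" "arc_between \<eta>1 c' (p (last (rev xs)))"
      using \<eta>12 hr by (auto intro: arc_between_sym)
    have a7: "\<eta>2 \<union> \<eta>1 = \<eta>" "\<eta>2 \<inter> \<eta>1 = {c'}" using \<eta>12 by auto
    note r = chord_reroute[OF a1[unfolded revxs] a2[unfolded revxs] ys hdt a3[unfolded revxs] a4[unfolded revxs]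
        c'(1) a5[unfolded revxs] g(1,3,4) a6[unfolded revxs] a7, folded zs2_def revxs]
    show "is_chord zs2 (\<eta>2 \<union> g)" "conic_at (\<eta>2 \<union> g) (p (hd zs2))" "conic_at (\<eta>2 \<union> g) (p (last zs2))"
      "hd zs2 = last xs" "last zs2 = t"
      using r hr(1) by simp_all
  qed
  have pt\<eta>: "p t \<notin> \<eta>" using chord_vertex[OF c tV] t by blast
  have sk: "\<eta> \<inter> skeleton = {p (hd xs), p (last xs)}" by (rule chord_skeleton[OF c])
  have c'sk: "c' \<notin> skeleton"
  proof
    assume "c' \<in> skeleton"
    with c'(1) have "c' \<in> \<eta> \<inter> skeleton" by simp
    then show False unfolding sk using c'(2,3) by simp
  qed
  have ptsk: "p t \<in> skeleton" using tV skeleton_verts by blast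
  have gsk: "g \<inter> skeleton = {p t}" by (rule chord_end_parts(1)[OF g(3) c'(1) c'sk ptsk pt\<eta>])
  have g\<eta>: "g \<inter> \<eta> = {c'}" by (rule chord_end_parts(2)[OF g(3) c'(1) c'sk ptsk pt\<eta>])
  have \<eta>sk: "z = p (hd xs) \<or> z = p (last xs)" if "z \<in> \<eta>" "z \<in> skeleton" for z
  proof -
    have "z \<in> \<eta> \<inter> skeleton" using that by simp
    then show ?thesis unfolding sk by simp
  qed
  have lastn: "p (last xs) \<notin> \<eta>1" using \<eta>12(4) arc_between_ends[OF \<eta>12(2)] c'(3) by auto
  have hdn: "p (hd xs) \<notin> \<eta>2" using \<eta>12(4) arc_between_ends[OF \<eta>12(1)] c'(2) by auto
  have g1: "gpath (xs1 @ [s])" and g2: "gpath (s # xs2)"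
    using gx pedges_append[of xs1 s xs2] by (auto simp: gpath_def xs)
  have trxs: "trace xs = trace (xs1 @ [s]) \<union> trace (s # xs2)" unfolding xs by (rule trace_append)
  define L where "L = trace (as @ [s])"
  \<comment> \<open>the three arcs of a theta graph between \<open>c'\<close> and \<open>p s\<close>; \<open>G\<close> is the crosscut\<close>
  define A where "A = \<eta>1 \<union> trace (xs1 @ [s])"
  define B where "B = \<eta>2 \<union> trace (s # xs2)"
  define G where "G = g \<union> L"
  have hd1: "hd (xs1 @ [s]) = hd xs" by (cases xs1) (auto simp: xs)
  have last2: "last (s # xs2) = last xs" by (simp add: xs)
  have Lsk: "L \<subseteq> skeleton" unfolding L_def by (rule trace_sub_skeleton[OF ys])
  have tr1sk: "trace (xs1 @ [s]) \<subseteq> skeleton" "trace (s # xs2) \<subseteq> skeleton"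
    using trace_sub_skeleton g1 g2 by blast+
  have arcA: "arc_between A c' (p s)"
  proof -
    have "\<eta>1 \<inter> trace (xs1 @ [s]) \<subseteq> {p (hd xs)}"
    proof
      fix z assume z: "z \<in> \<eta>1 \<inter> trace (xs1 @ [s])"
      then have "z \<in> \<eta>" "z \<in> skeleton" using \<eta>12(3) tr1sk(1) by auto
      from \<eta>sk[OF this] show "z \<in> {p (hd xs)}" using z lastn by auto
    qed
    from arc_between_join[OF arc_between_sym[OF \<eta>12(1)] _ this] arc_trace[OF g1]
    show ?thesis unfolding A_def hd1 by simp
  qed
  have arcB: "arc_between B c' (p s)"
  proof -
    have "\<eta>2 \<inter> trace (s # xs2) \<subseteq> {p (last xs)}"
    proof
      fix z assume z: "z \<in> \<eta>2 \<inter> trace (s # xs2)"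
      then have "z \<in> \<eta>" "z \<in> skeleton" using \<eta>12(3) tr1sk(2) by auto
      from \<eta>sk[OF this] show "z \<in> {p (last xs)}" using z hdn by auto
    qed
    from arc_between_join[OF \<eta>12(2) _ this] arc_between_sym[OF arc_trace[OF g2]]
    show ?thesis unfolding B_def last2 by simp
  qed
  have arcL: "arc_between L (p t) (p s)" using arc_trace[OF ys] hdt by (simp add: L_def)
  have gL: "g \<inter> L \<subseteq> {p t}" using gsk Lsk by (metis Int_mono order_refl)
  have arcG: "arc_between G c' (p s)" unfolding G_def by (rule arc_between_join[OF g(1) arcL gL])
  have "p s \<in> skeleton" using skeleton_verts asb(2) gx by (auto simp: gpath_def)
  then have c's: "c' \<noteq> p s" using c'sk by auto
  have in1: "p (hd xs) \<in> trace (s # xs2) \<Longrightarrow> hd xs = s"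
    using in_trace_iff[OF g2 ends(1)] gx by (cases xs1) (auto simp: gpath_def xs)
  have in2: "p (last xs) \<in> trace (xs1 @ [s]) \<Longrightarrow> last xs = s"
    using in_trace_iff[OF g1 ends(2)] gx by (cases xs2 rule: rev_cases) (auto simp: gpath_def xs)
  have inL: "u \<in> set xs \<Longrightarrow> p u \<in> L \<Longrightarrow> u = s" for u
    using in_trace_iff[OF ys, of u] dis gx by (auto simp: L_def gpath_def)
  have ts: "t = s" if "t \<in> set xs"
    using that hdt dis by (cases as) auto
  have tr12: "trace (xs1 @ [s]) \<inter> trace (s # xs2) = {p s}"
  proof -
    have d: "set (xs1 @ [s]) \<inter> set (s # xs2) = {s}" using gx by (auto simp: gpath_def xs)
    have "pedges (xs1 @ [s]) \<inter> pedges (s # xs2) = {}"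
      using d g1 by (intro pedges_disjoint[of _ _ s]) (auto simp: gpath_def)
    from trace_Int[OF g1 g2 this] show ?thesis unfolding d by simp
  qed
  have trL: "trace xs \<inter> L = {p s}"
  proof -
    have d: "set xs \<inter> set (as @ [s]) = {s}" using dis asb(2) by auto
    have "pedges xs \<inter> pedges (as @ [s]) = {}"
      using d gx by (intro pedges_disjoint[of _ _ s]) (auto simp: gpath_def)
    from trace_Int[OF gx ys this] show ?thesis unfolding d L_def by simp
  qed
  have s_mem: "p s \<in> trace (xs1 @ [s])" "p s \<in> trace (s # xs2)" "p s \<in> L" by (auto simp: trace_def L_def)
  have c'_mem: "c' \<in> \<eta>1" "c' \<in> \<eta>2" "c' \<in> g"
    using arc_between_ends[OF \<eta>12(1)] arc_between_ends[OF \<eta>12(2)] arc_between_ends[OF g(1)] by simp_all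
  have AB: "A \<inter> B = {c', p s}"
  proof
    show "{c', p s} \<subseteq> A \<inter> B" using s_mem c'_mem by (auto simp: A_def B_def)
    show "A \<inter> B \<subseteq> {c', p s}"
    proof
      fix z assume "z \<in> A \<inter> B"
      then consider "z \<in> \<eta>1" "z \<in> \<eta>2" | "z \<in> \<eta>1" "z \<in> trace (s # xs2)" | "z \<in> \<eta>2" "z \<in> trace (xs1 @ [s])"
        | "z \<in> trace (xs1 @ [s])" "z \<in> trace (s # xs2)" by (auto simp: A_def B_def)
      then show "z \<in> {c', p s}"
      proof cases
        case 1 then have "z \<in> \<eta>1 \<inter> \<eta>2" by simp
        then show ?thesis unfolding \<eta>12(4) by simp
      next
        case 2
        then have "z \<in> \<eta>" "z \<in> skeleton" using tr1sk(2) \<eta>12(3) by auto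
        then have "z = p (hd xs)" using \<eta>sk[of z] lastn 2(1) by auto
        then show ?thesis using in1 2 by auto
      next
        case 3
        then have "z \<in> \<eta>" "z \<in> skeleton" using tr1sk(1) \<eta>12(3) by auto
        then have "z = p (last xs)" using \<eta>sk[of z] hdn 3(1) by auto
        then show ?thesis using in2 3 by auto
      next
        case 4 then have "z \<in> trace (xs1 @ [s]) \<inter> trace (s # xs2)" by simp
        then show ?thesis unfolding tr12 by simp
      qed
    qed
  qed
  have pt_tr: "z \<in> {c', p s}" if "z \<in> g" "z \<in> trace xs" for z
  proof -
    have "z \<in> g \<inter> skeleton" using that trace_sub_skeleton[OF gx] by auto
    then have "z = p t" unfolding gsk by simp
    then have "t \<in> set xs" using in_trace_iff[OF gx tV] that(2) by blast
    then show ?thesis using ts \<open>z = p t\<close> by simp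
  qed
  have \<eta>L: "z \<in> {c', p s}" if "z \<in> \<eta>" "z \<in> L" for z
  proof -
    have "z \<in> skeleton" using that(2) Lsk by auto
    from \<eta>sk[OF that(1) this] show ?thesis using that(2) inL[OF ends(4)] inL[OF ends(5)] by auto
  qed
  have JG: "z \<in> {c', p s}" if zz: "z \<in> trace xs \<union> \<eta>" "z \<in> G" for z
  proof -
    consider "z \<in> trace xs" "z \<in> g" | "z \<in> trace xs \<inter> L" | "z \<in> \<eta>" "z \<in> L" | "z \<in> g \<inter> \<eta>"
      using zz by (auto simp: G_def)
    then show ?thesis
    proof cases
      case 1 then show ?thesis using pt_tr by simp
    next
      case 2 then show ?thesis unfolding trL by simp
    next
      case 3 then show ?thesis using \<eta>L by simp
    next
      case 4 then show ?thesis unfolding g\<eta> by simp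
    qed
  qed
  have ABJ: "A \<union> B = trace xs \<union> \<eta>" using trxs \<eta>12(3) by (auto simp: A_def B_def)
  have mems: "c' \<in> A" "c' \<in> B" "c' \<in> G" "p s \<in> A" "p s \<in> B" "p s \<in> G"
    using s_mem c'_mem by (simp_all add: A_def B_def G_def)
  have JG': "(trace xs \<union> \<eta>) \<inter> G \<subseteq> {c', p s}" using JG by (intro subsetI) simp
  have AG: "A \<inter> G = {c', p s}"
  proof
    have "A \<inter> G \<subseteq> (A \<union> B) \<inter> G" by auto
    then show "A \<inter> G \<subseteq> {c', p s}" using JG' unfolding ABJ by (rule subset_trans)
  qed (use mems in simp)
  have BG: "B \<inter> G = {c', p s}"
  proof
    have "B \<inter> G \<subseteq> (A \<union> B) \<inter> G" by auto
    then show "B \<inter> G \<subseteq> {c', p s}" using JG' unfolding ABJ by (rule subset_trans)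
  qed (use mems in simp)
  have c't: "c' \<noteq> p t" using c'(1) pt\<eta> by blast
  have "g - {c', p t} \<noteq> {}" using arc_between_interior_nonempty[OF g(1) c't] by (metis finite.emptyI)
  then have GH: "G \<inter> H \<noteq> {}" using g(2) by (auto simp: G_def)
  obtain H1 H2 where H12: "side_of (A \<union> G) H1" "side_of (B \<union> G) H2" "H1 \<inter> H2 = {}" "H1 \<union> H2 = H - G"
    using theta_split[OF arcA arcB arcG c's AB AG BG] H GH unfolding ABJ by metis
  have trr: "trace (s # rev as) = L" using trace_rev[of "as @ [s]"] by (simp add: L_def)
  have tz1: "trace zs1 = trace (xs1 @ [s]) \<union> L" unfolding zs1_def by (subst trace_append) (simp add: trr)
  have tz2: "trace zs2 = trace (s # xs2) \<union> L"
  proof -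
    have "trace zs2 = trace (rev xs2 @ [s]) \<union> L" unfolding zs2_def by (subst trace_append) (simp add: trr)
    also have "trace (rev xs2 @ [s]) = trace (s # xs2)" using trace_rev[of "s # xs2"] by simp
    finally show ?thesis .
  qed
  have prr: "pedges (s # rev as) = pedges (as @ [s])" using pedges_rev[of "as @ [s]"] by simp
  have "pedges zs1 \<subseteq> T"
    using xT pas prr pedges_append[of xs1 s "rev as"] pedges_append[of xs1 s xs2] by (auto simp: zs1_def xs)
  moreover have "side_of (trace zs1 \<union> (\<eta>1 \<union> g)) H1" using H12(1) by (simp add: tz1 A_def G_def Un_ac)
  ultimately have st1: "chord_state T zs1 (\<eta>1 \<union> g) H1" using r1 by (simp add: chord_state_def)
  have "pedges (rev xs2 @ [s]) = pedges (s # xs2)" using pedges_rev[of "s # xs2"] by simp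
  then have "pedges zs2 \<subseteq> T"
    using xT pas prr pedges_append[of "rev xs2" s "rev as"] pedges_append[of xs1 s xs2] by (auto simp: zs2_def xs)
  moreover have "side_of (trace zs2 \<union> (\<eta>2 \<union> g)) H2" using H12(2) by (simp add: tz2 B_def G_def Un_ac)
  ultimately have st2: "chord_state T zs2 (\<eta>2 \<union> g) H2" using r2 by (simp add: chord_state_def)
  have v12: "verts_in H1 \<inter> verts_in H2 = {}" using H12(3) by (auto simp: verts_in_def)
  have vsub: "verts_in H1 \<union> verts_in H2 \<subseteq> verts_in H" using H12(4) by (auto simp: verts_in_def)
  have vrest: "verts_in H - (verts_in H1 \<union> verts_in H2) \<subseteq> set zs1 \<inter> set zs2"
  proof
    fix u assume u: "u \<in> verts_in H - (verts_in H1 \<union> verts_in H2)"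
    then have uV: "u \<in> V" "p u \<in> G" using H12(4) by (auto simp: verts_in_def)
    have "u \<in> set (as @ [s])"
    proof (cases "p u \<in> L")
      case True then show ?thesis using in_trace_iff[OF ys uV(1)] by (simp add: L_def)
    next
      case False
      then have "p u = p t" using uV gsk skeleton_verts by (auto simp: G_def)
      then have "u = t" using p_eq_iff uV(1) tV by blast
      then show ?thesis using hdt by (cases as) auto
    qed
    then show "u \<in> set zs1 \<inter> set zs2" by (auto simp: zs1_def zs2_def)
  qed
  have small: "verts_in H1 \<subset> verts_in H \<and> verts_in H2 \<subset> verts_in H \<or> length zs1 < length xs \<and> length zs2 < length xs"
  proof (cases "t \<in> set xs")
    case True
    have "as = []" using True hdt dis by (cases as) auto
    then have "t = s" using hdt by simp
    then have "xs1 \<noteq> []" "xs2 \<noteq> []" using t(1,2) by (auto simp: xs)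
    then show ?thesis using \<open>as = []\<close> by (simp add: zs1_def zs2_def xs)
  next
    case False
    then have "t \<in> verts_in H" using t(3) by blast
    moreover have "p t \<in> G" using arc_between_ends[OF g(1)] by (simp add: G_def)
    then have "t \<notin> verts_in H1 \<union> verts_in H2" using H12(4) by (auto simp: verts_in_def)
    ultimately show ?thesis using vsub by blast
  qed
  have "verts_in H1 \<subset> verts_in H \<or> verts_in H1 \<subseteq> verts_in H \<and> length zs1 < length xs"
    "verts_in H2 \<subset> verts_in H \<or> verts_in H2 \<subseteq> verts_in H \<and> length zs2 < length xs"
    using small vsub by auto
  then show ?thesis
    using st1 st2 v12 vsub vrest by meson
qed

end

context conic_plane_graph
begin

text \<open>
  The edge is redrawn along the chord, and the old course of the edge becomes the chord.
\<close>

lemma swap_parallel_edge: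
  assumes c: "is_chord xs \<eta>" and con: "conic_at \<eta> (p (hd xs))" "conic_at \<eta> (p (last xs))"
    and e: "{hd xs, last xs} \<in> E - pedges xs"
  defines "D' \<equiv> D({hd xs, last xs} := \<eta>)"
  shows "conic_plane_graph V E p D'" "plane_graph.trace p D' xs = trace xs"
    "plane_graph.is_chord V E p D' xs (D {hd xs, last xs})"
proof -
  let ?e = "{hd xs, last xs}"
  note ends = chord_ends[OF c]
  have eE: "?e \<in> E" using e by simp
  have gx: "gpath xs" by (rule chord_gpath[OF c])
  have \<eta>: "arc_between \<eta> (p (hd xs)) (p (last xs))" using c by (simp add: is_chord_def)
  have sk: "\<eta> \<inter> skeleton = p ` ?e" using chord_skeleton[OF c] by simp
  have esub: "p ` ?e \<subseteq> \<eta>" using sk by auto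
  have D'e: "D' ?e = \<eta>" by (simp add: D'_def)
  have D'f: "D' f = D f" if "f \<noteq> ?e" for f using that by (simp add: D'_def)
  have \<eta>V: "\<eta> \<inter> p ` V = p ` ?e"
  proof
    show "\<eta> \<inter> p ` V \<subseteq> p ` ?e" unfolding sk[symmetric] using skeleton_verts by auto
    show "p ` ?e \<subseteq> \<eta> \<inter> p ` V" using esub ends by auto
  qed
  have \<eta>D: "\<eta> \<inter> D f = p ` (?e \<inter> f)" if f: "f \<in> E" for f
  proof
    have "D f \<subseteq> skeleton" using f by (auto simp: skeleton_def)
    then have "\<eta> \<inter> D f \<subseteq> p ` ?e" unfolding sk[symmetric] by auto
    then show "\<eta> \<inter> D f \<subseteq> p ` (?e \<inter> f)" using p_in_edge[OF f ends(1)] p_in_edge[OF f ends(2)] by auto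
    show "p ` (?e \<inter> f) \<subseteq> \<eta> \<inter> D f"
      using esub p_in_edge[OF f ends(1)] p_in_edge[OF f ends(2)] by auto
  qed
  show cpg: "conic_plane_graph V E p D'"
  proof unfold_locales
    show "finite V" "inj_on p V" by (fact finite_V inj_p)+
    show "\<exists>u w. f = {u, w} \<and> u \<in> V \<and> w \<in> V \<and> u \<noteq> w" if "f \<in> E" for f using edgeE that .
  next
    fix u w assume uw: "{u, w} \<in> E"
    show "arc_between (D' {u, w}) (p u) (p w)"
    proof (cases "{u, w} = ?e")
      case True
      then have "u = hd xs \<and> w = last xs \<or> u = last xs \<and> w = hd xs" by (auto simp: doubleton_eq_iff)
      then show ?thesis using \<eta> arc_between_sym[OF \<eta>] D'e True by auto
    next
      case False
      then show ?thesis using arc_edge[OF uw] D'f by simp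
    qed
  next
    fix f assume f: "f \<in> E"
    show "D' f \<inter> p ` V = p ` f"
      using edge_verts[OF f] \<eta>V D'e D'f[of f] by (cases "f = ?e") auto
  next
    fix f f' assume ff: "f \<in> E" "f' \<in> E" "f \<noteq> f'"
    show "D' f \<inter> D' f' = p ` (f \<inter> f')"
    proof (cases "f = ?e")
      case True
      then have "D' f \<inter> D' f' = \<eta> \<inter> D f'" using ff(3) D'e D'f[of f'] by auto
      then show ?thesis using \<eta>D[OF ff(2)] True by simp
    next
      case False
      show ?thesis
      proof (cases "f' = ?e")
        case True
        then have "D' f \<inter> D' f' = \<eta> \<inter> D f" using False D'e D'f[of f] by (auto simp: Int_commute)
        then show ?thesis using \<eta>D[OF ff(1)] True by (simp add: Int_commute)
      next
        case False
        then show ?thesis using edge_cross[OF ff] D'f[of f'] D'f[of f] \<open>f \<noteq> ?e\<close> by simp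
      qed
    qed
  next
    fix f u assume f: "f \<in> E" "u \<in> f"
    show "conic_at (D' f) (p u)"
      using conic_edge[OF f] con f(2) D'e D'f[of f] by (cases "f = ?e") auto
  qed
  interpret N: conic_plane_graph V E p D' by (rule cpg)
  have "D' ` pedges xs = D ` pedges xs"
    using e by (intro image_cong) (auto simp: D'_def)
  then show tr: "N.trace xs = trace xs" by (simp add: N.trace_def trace_def)
  have gN: "N.gpath xs" using gx by (simp add: N.gpath_def gpath_def)
  have "D ?e \<inter> N.skeleton = {p (hd xs), p (last xs)}"
  proof
    show "{p (hd xs), p (last xs)} \<subseteq> D ?e \<inter> N.skeleton"
      using p_in_edge[OF eE] ends N.skeleton_verts by auto
    show "D ?e \<inter> N.skeleton \<subseteq> {p (hd xs), p (last xs)}"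
    proof
      fix z assume z: "z \<in> D ?e \<inter> N.skeleton"
      then consider "z \<in> p ` V" | f where "f \<in> E" "z \<in> D' f" by (auto simp: N.skeleton_def)
      then show "z \<in> {p (hd xs), p (last xs)}"
      proof cases
        case 1
        then have "z \<in> D ?e \<inter> p ` V" using z by simp
        then show ?thesis unfolding edge_verts[OF eE] by auto
      next
        case 2
        show ?thesis
        proof (cases "f = ?e")
          case True
          then have "z \<in> \<eta> \<inter> D ?e" using 2(2) D'e z by simp
          then show ?thesis unfolding \<eta>D[OF eE] by auto
        next
          case False
          then have "z \<in> D ?e \<inter> D f" using 2(2) D'f z by simp
          then show ?thesis unfolding edge_cross[OF eE 2(1) False[symmetric]] by auto
        qed
      qed
    qed
  qed
  moreover have "arc_between (D ?e) (p (hd xs)) (p (last xs))" using arc_edge[OF eE] .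
  moreover have "hd xs \<noteq> last xs" using c by (simp add: is_chord_def)
  ultimately show "N.is_chord xs (D ?e)" using gN unfolding N.is_chord_def by blast
qed

text \<open>
  The frontier of a face contains more than vertices, because a finite set does not bound a face of an
  infinite drawing. So it contains an inner point of some edge \<open>f\<close>, and both ends of \<open>f\<close> are accessible
  from the face.
\<close>

lemma ex_initial_chord:
  assumes T: "spanning_connected V T" "T \<subseteq> E" and V2: "card V \<ge> 2"
  shows "\<exists>xs \<eta>. is_chord xs \<eta> \<and> pedges xs \<subseteq> T \<and> conic_at \<eta> (p (hd xs)) \<and> conic_at \<eta> (p (last xs))"
proof -
  have E_ne: "E \<noteq> {}"
  proof -
    obtain B where "B \<subseteq> V" "card B = 2" using V2 by (meson obtain_subset_with_card_n)
    then obtain a b where ab: "a \<in> V" "b \<in> V" "a \<noteq> b" by (auto simp: card_2_iff)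
    then obtain xs where xs: "xs \<noteq> []" "hd xs = a" "last xs = b" "pedges xs \<subseteq> T"
      using T(1) unfolding spanning_connected_def by blast
    obtain x y zs where "xs = x # y # zs" using xs(1-3) ab(3) by (cases xs rule: pedges.cases) auto
    then show ?thesis using xs(4) T(2) by auto
  qed
  have clK: "closed skeleton" using compact_skeleton compact_imp_closed by blast
  obtain h where h: "h \<in> - skeleton"
    using compact_skeleton compact_imp_bounded not_bounded_UNIV by (metis Compl_empty_eq ComplI UNIV_eq_I)
  define F where "F = connected_component_set (- skeleton) h"
  have hF: "h \<in> F" using h by (simp add: F_def)
  have comp: "F \<in> components (- skeleton)" using h unfolding F_def components_def by blast
  have Fsub: "F \<subseteq> - skeleton" by (rule in_components_subset[OF comp])
  have "frontier F \<subseteq> frontier (- skeleton)" by (rule frontier_of_components_subset[OF comp])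
  also have "\<dots> \<subseteq> skeleton" unfolding frontier_complement using clK by (rule frontier_subset_closed)
  finally have frK: "frontier F \<subseteq> skeleton" .
  obtain e0 where e0: "e0 \<in> E" using E_ne by blast
  have "\<not> frontier F \<subseteq> p ` V"
  proof
    assume sub: "frontier F \<subseteq> p ` V"
    then have "finite (frontier F)" using finite_V finite_subset by blast
    then have conn: "connected (- frontier F)"
      by (intro path_connected_imp_connected path_connected_complement_countable countable_finite) auto
    have "- frontier F \<subseteq> F"
    proof (rule connected_stays_in_side[OF conn])
      show "- frontier F \<inter> F \<noteq> {}" using hF frK Fsub by blast
    qed simp
    then have "skeleton \<subseteq> frontier F" using Fsub by blast
    moreover obtain a b where "e0 = {a, b}" "a \<in> V" "b \<in> V" "a \<noteq> b" using edgeE[OF e0] by blast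
    then have "infinite (D e0)"
      using arc_between_interior_nonempty[of "D e0" "p a" "p b"] arc_edge[of a b] e0 p_eq_iff finite_Diff by metis
    moreover have "D e0 \<subseteq> skeleton" using e0 by (auto simp: skeleton_def)
    ultimately show False using \<open>finite (frontier F)\<close> by (metis finite_subset)
  qed
  then obtain y where y: "y \<in> frontier F" "y \<notin> p ` V" by blast
  then obtain f where f: "f \<in> E" "y \<in> D f" using frK by (auto simp: skeleton_def)
  obtain a b where ab: "f = {a, b}" "a \<in> V" "b \<in> V" "a \<noteq> b" using edgeE[OF f(1)] by blast
  have "p ` f \<subseteq> closure F"
    using edge_in_frontier_of_face[of "{}" F f y] comp f y by simp
  then have cl: "p a \<in> closure F" "p b \<in> closure F" using ab(1) by auto
  have acc: "\<exists>r>0. \<forall>q\<in>F. dist (p u) q < r \<longrightarrow> closed_segment (p u) q - {p u} \<subseteq> F" if u: "u \<in> V" for u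
  proof -
    obtain r where r: "r > 0" "\<And>q. dist (p u) q < r \<Longrightarrow> q \<notin> skeleton \<Longrightarrow> closed_segment (p u) q \<inter> skeleton \<subseteq> {p u}"
      using conic_skeleton[OF u] unfolding conic_at_def by blast
    have "p u \<in> skeleton" using u skeleton_verts by blast
    then show ?thesis using segment_into_face[OF r(2) F_def] r(1) by blast
  qed
  obtain ra where ra: "ra > 0" "\<And>q. q \<in> F \<Longrightarrow> dist (p a) q < ra \<Longrightarrow> closed_segment (p a) q - {p a} \<subseteq> F"
    using acc[OF ab(2)] by blast
  obtain rb where rb: "rb > 0" "\<And>q. q \<in> F \<Longrightarrow> dist (p b) q < rb \<Longrightarrow> closed_segment (p b) q - {p b} \<subseteq> F"
    using acc[OF ab(3)] by blast
  obtain qa where qa: "qa \<in> F" "dist (p a) qa < ra"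
    using cl(1) ra(1) unfolding closure_approachable by (metis dist_commute)
  obtain qb where qb: "qb \<in> F" "dist (p b) qb < rb"
    using cl(2) rb(1) unfolding closure_approachable by (metis dist_commute)
  have "open F" unfolding F_def using clK by (intro open_connected_component) auto
  moreover have "connected F" by (simp add: F_def)
  ultimately have "path_connected F" using connected_open_path_connected by blast
  then obtain g0 where g0: "path g0" "path_image g0 \<subseteq> F" "pathstart g0 = qa" "pathfinish g0 = qb"
    using qa(1) qb(1) unfolding path_connected_def by blast
  define g1 where "g1 = linepath (p a) qa +++ g0 +++ linepath qb (p b)"
  have g1: "path g1" "pathstart g1 = p a" "pathfinish g1 = p b" using g0 by (auto simp: g1_def)
  have "path_image g1 = closed_segment (p a) qa \<union> (path_image g0 \<union> closed_segment qb (p b))"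
    unfolding g1_def using g0 by (simp add: path_image_join)
  then have g1im: "path_image g1 \<subseteq> {p a, p b} \<union> F"
    using g0(2) ra(2)[OF qa] rb(2)[OF qb] by (auto simp: closed_segment_commute)
  obtain S where S: "arc_between S (p a) (p b)" "S \<subseteq> path_image g1"
    using arc_between_subset_path[OF g1] by blast
  have pab: "p a \<noteq> p b" using p_eq_iff ab by simp
  define r where "r = min (min ra rb) (dist (p a) (p b)) / 3"
  have r: "0 < r" "r < ra" "r < rb" "2 * r < dist (p a) (p b)"
  proof -
    have "0 < dist (p a) (p b)" using pab by simp
    then show "0 < r" "r < ra" "r < rb" "2 * r < dist (p a) (p b)" using ra(1) rb(1) unfolding r_def min_def by auto
  qed
  obtain M x y where M: "M \<subseteq> S" "arc_between M x y" "dist (p a) x = r" "dist (p b) y = r"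
    "M \<inter> cball (p a) r = {x}" "M \<inter> cball (p b) r = {y}"
    using arc_core[OF S(1) r(1,4)] by metis
  have xyM: "x \<in> M" "y \<in> M" using arc_between_ends[OF M(2)] by auto
  have MF: "M \<subseteq> F"
  proof
    fix z assume z: "z \<in> M"
    have "z \<noteq> p a"
    proof
      assume "z = p a"
      then have "p a \<in> M \<inter> cball (p a) r" using z r by simp
      then show False using M(3,5) r(1) by auto
    qed
    moreover have "z \<noteq> p b"
    proof
      assume "z = p b"
      then have "p b \<in> M \<inter> cball (p b) r" using z r by simp
      then show False using M(4,6) r(1) by auto
    qed
    ultimately show "z \<in> F" using z M(1) S(2) g1im by blast
  qed
  let ?sa = "closed_segment x (p a)" and ?sb = "closed_segment y (p b)"
  have sa: "?sa \<subseteq> cball (p a) r" using M(3) r(1) by (intro closed_segment_subset) auto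
  have sb: "?sb \<subseteq> cball (p b) r" using M(4) r(1) by (intro closed_segment_subset) auto
  have cc: "cball (p a) r \<inter> cball (p b) r = {}"
  proof (rule ccontr)
    assume "cball (p a) r \<inter> cball (p b) r \<noteq> {}"
    then obtain z where "dist (p a) z \<le> r" "dist (p b) z \<le> r" by auto
    then show False using r(4) dist_triangle2[of "p a" "p b" z] by simp
  qed
  define \<eta> where "\<eta> = ?sa \<union> M \<union> ?sb"
  have "?sa \<inter> M \<subseteq> {x}" using sa M(5) by auto
  then have "arc_between (?sa \<union> M) (p a) y"
    by (intro arc_between_join[OF arc_between_sym[OF arc_between_segment] M(2)])
  moreover have "(?sa \<union> M) \<inter> ?sb \<subseteq> {y}"
  proof -
    have "?sa \<inter> ?sb = {}" using sa sb cc by (metis Int_mono subset_empty)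
    moreover have "M \<inter> ?sb \<subseteq> {y}" using sb M(6) by auto
    ultimately show ?thesis by auto
  qed
  ultimately have arc\<eta>: "arc_between \<eta> (p a) (p b)"
    unfolding \<eta>_def by (rule arc_between_join[OF _ arc_between_segment])
  have "?sa - {p a} \<subseteq> F" "?sb - {p b} \<subseteq> F"
    using ra(2)[of x] rb(2)[of y] MF xyM M(3,4) r by (auto simp: closed_segment_commute)
  then have "\<eta> \<subseteq> {p a, p b} \<union> F" using MF by (auto simp: \<eta>_def)
  moreover have "p a \<in> skeleton" "p b \<in> skeleton" using ab skeleton_verts by auto
  ultimately have \<eta>sk: "\<eta> \<inter> skeleton = {p a, p b}" using Fsub arc_between_ends[OF arc\<eta>] by auto
  have "(M \<union> ?sb) \<inter> cball (p a) r = {x}" using M(5) sb cc by auto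
  from conic_at_radial_end[OF M(3) r(1) this] have ca: "conic_at \<eta> (p a)" by (simp add: \<eta>_def Un_ac)
  have "(M \<union> ?sa) \<inter> cball (p b) r = {y}" using M(6) sa cc by auto
  from conic_at_radial_end[OF M(4) r(1) this] have cb: "conic_at \<eta> (p b)" by (simp add: \<eta>_def Un_ac)
  obtain xs where xs: "xs \<noteq> []" "hd xs = a" "last xs = b" "distinct xs" "set xs \<subseteq> V" "pedges xs \<subseteq> T"
    using T(1) ab(2,3) unfolding spanning_connected_def by blast
  have "is_chord xs \<eta>" using xs ab(4) arc\<eta> \<eta>sk T(2) by (simp add: is_chord_def gpath_def)
  then show ?thesis using xs ca cb by blast
qed

end

text \<open>
  Compared lexicographically: hitting a vertex of \<open>H\<close> removes it from \<open>H\<close>, hitting a vertex of the path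
  shortens the path, and exchanging the chord with a parallel edge takes this edge out of \<open>H\<close>.
\<close>

definition descent_measure :: "'a set \<Rightarrow> 'a set set \<Rightarrow> ('a \<Rightarrow> complex) \<Rightarrow> ('a set \<Rightarrow> complex set) \<Rightarrow> 'a list \<Rightarrow> complex set \<Rightarrow> nat \<times> nat \<times> nat" where
  "descent_measure V E p D xs H =
     (card (plane_graph.verts_in V p H), length xs, card {e \<in> E. D e \<inter> H \<noteq> {}})"

text \<open>
  Of the two parts of a side with more than two thirds of the weight, the heavier one together with the
  crosscut weighs at least one third. So if that part weighs at most two thirds, its curve is balanced;
  otherwise the descent continues with it.
\<close>

lemma heavy_side_descent:
  fixes w :: "'a \<Rightarrow> real"
  assumes T: "spanning_connected V T" "T \<subseteq> E" and w: "\<And>u. w u \<ge> 0"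
    and "conic_plane_graph V E p D" "plane_graph.chord_state V E p D T xs \<eta> H"
    and "2 * sum w V < 3 * sum w (plane_graph.verts_in V p H)"
  shows "\<exists>D xs \<eta> H. conic_plane_graph V E p D \<and> plane_graph.chord_state V E p D T xs \<eta> H \<and>
    3 * sum w (plane_graph.verts_in V p H) \<le> 2 * sum w V \<and>
    3 * sum w (V - set xs - plane_graph.verts_in V p H) \<le> 2 * sum w V"
  using assms(4-6)
proof (induction "descent_measure V E p D xs H" arbitrary: D xs \<eta> H
    rule: wf_induct_rule[OF wf_lex_prod[OF wf_less_than wf_lex_prod[OF wf_less_than wf_less_than]]])
  case (1 D xs H \<eta>)
  interpret conic_plane_graph V E p D by fact
  note st = "1.prems"(2) and heavy = "1.prems"(3)
  have c: "is_chord xs \<eta>" and con: "conic_at \<eta> (p (hd xs))" "conic_at \<eta> (p (last xs))"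
    and xT: "pedges xs \<subseteq> T" and H: "side_of (trace xs \<union> \<eta>) H" using st by (auto simp: chord_state_def)
  have finv: "finite (verts_in K)" and subv: "verts_in K \<subseteq> V" for K
    using finite_V by (auto simp: verts_in_def)
  have "verts_in H \<noteq> {}"
  proof
    assume "verts_in H = {}"
    then show False using heavy sum_nonneg[of V w] w by simp
  qed
  from chord_hits_vertex_or_parallel_edge[OF c H this] show ?case
  proof (elim disjE exE conjE)
    fix c' t g
    assume c': "c' \<in> \<eta>" "c' \<noteq> p (hd xs)" "c' \<noteq> p (last xs)"
      and t: "t \<noteq> hd xs" "t \<noteq> last xs" "t \<in> verts_in H \<union> set xs"
      and g: "arc_between g c' (p t)" "g - {c', p t} \<subseteq> H" "g \<inter> (skeleton \<union> \<eta>) = {c', p t}" "conic_at g (p t)"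
    obtain xs1 \<eta>1 H1 xs2 \<eta>2 H2 where s: "chord_state T xs1 \<eta>1 H1" "chord_state T xs2 \<eta>2 H2"
      "verts_in H1 \<inter> verts_in H2 = {}" "verts_in H1 \<union> verts_in H2 \<subseteq> verts_in H"
      "verts_in H - (verts_in H1 \<union> verts_in H2) \<subseteq> set xs1 \<inter> set xs2"
      "verts_in H1 \<subset> verts_in H \<or> verts_in H1 \<subseteq> verts_in H \<and> length xs1 < length xs"
      "verts_in H2 \<subset> verts_in H \<or> verts_in H2 \<subseteq> verts_in H \<and> length xs2 < length xs"
      using chord_split[OF T st c' t g] by metis
    have key: ?case if s': "chord_state T xs' \<eta>' H'"
      and rest: "verts_in H - (verts_in H' \<union> verts_in H'') \<subseteq> set xs'"
      and disj: "verts_in H' \<inter> verts_in H'' = {}" and sub: "verts_in H' \<union> verts_in H'' \<subseteq> verts_in H"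
      and small: "verts_in H' \<subset> verts_in H \<or> verts_in H' \<subseteq> verts_in H \<and> length xs' < length xs"
      and le: "sum w (verts_in H'') \<le> sum w (verts_in H')" for xs' \<eta>' H' H''
    proof (cases "3 * sum w (verts_in H') \<le> 2 * sum w V")
      case True
      let ?R = "verts_in H - (verts_in H' \<union> verts_in H'')"
      have "sum w (verts_in H) = sum w (verts_in H' \<union> verts_in H'') + sum w ?R"
        using sub finv by (metis sum.subset_diff add.commute)
      also have "sum w (verts_in H' \<union> verts_in H'') = sum w (verts_in H') + sum w (verts_in H'')"
        using disj finv by (intro sum.union_disjoint) auto
      finally have eq: "sum w (verts_in H) = sum w (verts_in H') + sum w (verts_in H'') + sum w ?R" .
      have "sum w (V - set xs' - verts_in H') \<le> sum w (V - (verts_in H' \<union> ?R))"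
        using rest w finite_V by (intro sum_mono2) auto
      also have "\<dots> = sum w V - sum w (verts_in H' \<union> ?R)"
        using subv finite_V by (intro sum_diff) auto
      also have "sum w (verts_in H' \<union> ?R) = sum w (verts_in H') + sum w ?R"
        using finv by (intro sum.union_disjoint) auto
      finally have "3 * sum w (V - set xs' - verts_in H') \<le> 2 * sum w V"
        using eq le heavy sum_nonneg[of ?R w] w by simp
      then show ?thesis using s' True conic_plane_graph_axioms by blast
    next
      case False
      have "card (verts_in H') < card (verts_in H) \<or> card (verts_in H') \<le> card (verts_in H) \<and> length xs' < length xs"
        using small finv psubset_card_mono card_mono by metis
      then have "(descent_measure V E p D xs' H', descent_measure V E p D xs H) \<in>
          less_than <*lex*> less_than <*lex*> less_than"
        unfolding descent_measure_def by auto
      from "1.hyps"[OF this conic_plane_graph_axioms s'] False show ?thesis by simp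
    qed
    show ?case
    proof (cases "sum w (verts_in H2) \<le> sum w (verts_in H1)")
      case True
      then show ?thesis using key[OF s(1) _ s(3,4,6)] s(5) by blast
    next
      case False
      have "verts_in H2 \<inter> verts_in H1 = {}" "verts_in H2 \<union> verts_in H1 \<subseteq> verts_in H"
        "verts_in H - (verts_in H2 \<union> verts_in H1) \<subseteq> set xs2" using s(3,4,5) by auto
      moreover have "sum w (verts_in H1) \<le> sum w (verts_in H2)" using False by simp
      ultimately show ?thesis using key[OF s(2) _ _ _ s(7), of H1] by simp
    qed
  next
    fix H'
    let ?e = "{hd xs, last xs}"
    assume e: "?e \<in> E - pedges xs" "D ?e \<inter> H \<noteq> {}" and H': "side_of (trace xs \<union> D ?e) H'"
      "H' \<subseteq> H - D ?e" "verts_in H' = verts_in H"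
    let ?D = "D(?e := \<eta>)"
    note sw = swap_parallel_edge[OF c con e(1)]
    have eE: "?e \<in> E" using e(1) by simp
    have st': "plane_graph.chord_state V E p ?D T xs (D ?e) H'"
      unfolding plane_graph.chord_state_def[OF conic_plane_graph.axioms(1)[OF sw(1)]] sw(2)
      using sw(3) xT H'(1) conic_edge[OF eE] by simp
    have "card {f \<in> E. ?D f \<inter> H' \<noteq> {}} < card {f \<in> E. D f \<inter> H \<noteq> {}}"
    proof (rule psubset_card_mono)
      show "finite {f \<in> E. D f \<inter> H \<noteq> {}}" using finite_E by simp
      have "H \<inter> \<eta> = {}" using chord_sides(5)[OF c H] by auto
      then have "\<eta> \<inter> H' = {}" using H'(2) by auto
      then have "?e \<notin> {f \<in> E. ?D f \<inter> H' \<noteq> {}}" by simp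
      moreover have "{f \<in> E. ?D f \<inter> H' \<noteq> {}} \<subseteq> {f \<in> E. D f \<inter> H \<noteq> {}}"
        using H'(2) e(2) by auto
      moreover have "?e \<in> {f \<in> E. D f \<inter> H \<noteq> {}}" using eE e(2) by simp
      ultimately show "{f \<in> E. ?D f \<inter> H' \<noteq> {}} \<subset> {f \<in> E. D f \<inter> H \<noteq> {}}" by blast
    qed
    then have "(descent_measure V E p ?D xs H', descent_measure V E p D xs H) \<in>
        less_than <*lex*> less_than <*lex*> less_than"
      unfolding descent_measure_def H'(3) by auto
    from "1.hyps"[OF this sw(1) st'] heavy show ?case unfolding H'(3) by simp
  qed
qed

theorem balanced_chord:
  fixes w :: "'a \<Rightarrow> real"
  assumes pg: "plane_graph V E p D0" and T: "spanning_connected V T" "T \<subseteq> E" and w: "\<And>u. w u \<ge> 0"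
    and V2: "card V \<ge> 2"
  shows "\<exists>D xs \<eta> H. conic_plane_graph V E p D \<and> plane_graph.chord_state V E p D T xs \<eta> H \<and>
    3 * sum w (plane_graph.verts_in V p H) \<le> 2 * sum w V \<and>
    3 * sum w (V - set xs - plane_graph.verts_in V p H) \<le> 2 * sum w V"
proof -
  obtain D where D: "conic_plane_graph V E p D" using plane_graph.ex_conic_drawing[OF pg] by blast
  interpret conic_plane_graph V E p D by (rule D)
  obtain xs \<eta> where c: "is_chord xs \<eta>" "pedges xs \<subseteq> T" "conic_at \<eta> (p (hd xs))" "conic_at \<eta> (p (last xs))"
    using ex_initial_chord[OF T V2] by blast
  let ?J = "trace xs \<union> \<eta>"
  have st: "chord_state T xs \<eta> (inside ?J)" "chord_state T xs \<eta> (outside ?J)"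
    using c by (auto simp: chord_state_def side_of_def)
  have gx: "gpath xs" using c(1) by (rule chord_gpath)
  have out: "V - set xs - verts_in (inside ?J) = verts_in (outside ?J)"
  proof -
    have "u \<in> verts_in (outside ?J) \<longleftrightarrow> u \<notin> set xs \<and> u \<notin> verts_in (inside ?J)" if u: "u \<in> V" for u
    proof -
      have "p u \<in> ?J \<longleftrightarrow> u \<in> set xs"
        using in_trace_iff[OF gx u] chord_vertex[OF c(1) u] chord_ends[OF c(1)] by auto
      then show ?thesis using u by (simp add: verts_in_def outside_inside) blast
    qed
    then show ?thesis by (auto simp: verts_in_def)
  qed
  show ?thesis
  proof (cases "2 * sum w V < 3 * sum w (verts_in (inside ?J))")
    case True
    from heavy_side_descent[OF T w D st(1) this] show ?thesis .
  next
    case False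
    show ?thesis
    proof (cases "2 * sum w V < 3 * sum w (verts_in (outside ?J))")
      case True
      from heavy_side_descent[OF T w D st(2) this] show ?thesis .
    next
      case F2: False
      have "3 * sum w (verts_in (inside ?J)) \<le> 2 * sum w V" using False by simp
      moreover have "3 * sum w (V - set xs - verts_in (inside ?J)) \<le> 2 * sum w V" unfolding out using F2 by simp
      ultimately show ?thesis using D st(1) by blast
    qed
  qed
qed

section \<open>The separator\<close>

text \<open>
  \<open>X\<close> is the set of vertices on one side of the curve through the path \<open>xs\<close>. Another path \<open>qs\<close> through \<open>X\<close>
  between two vertices \<open>s\<close> and \<open>y\<close> of \<open>xs\<close> cuts \<open>X\<close> in two: the part next to the piece of \<open>xs\<close> between \<open>s\<close>
  and \<open>y\<close>, and the part next to the two remaining pieces.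
\<close>

definition splits_along :: "'a set set \<Rightarrow> 'a list \<Rightarrow> 'a set \<Rightarrow> bool" where
  "splits_along E xs X \<longleftrightarrow> (\<forall>xs1 s mid y xs2 qs. xs = xs1 @ s # mid @ y # xs2 \<longrightarrow> qs \<noteq> [] \<longrightarrow> distinct qs \<longrightarrow>
     set qs \<subseteq> X \<longrightarrow> pedges (s # qs @ [y]) \<subseteq> E \<longrightarrow>
     (\<exists>D1 D2. D1 \<union> D2 = X - set qs \<and> D1 \<inter> D2 = {} \<and>
        (\<forall>u w. {u, w} \<in> E \<longrightarrow> u \<in> D1 \<longrightarrow> w \<in> D1 \<union> set qs \<union> set (s # mid @ [y])) \<and>
        (\<forall>u w. {u, w} \<in> E \<longrightarrow> u \<in> D2 \<longrightarrow> w \<in> D2 \<union> set qs \<union> set (xs1 @ [s]) \<union> set (y # xs2))))"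

context plane_graph
begin

text \<open>
  The path \<open>qs\<close> is a crosscut of the side. One of the two new curves consists of edges only and the other
  one contains the chord, which no edge crosses.
\<close>

lemma chord_splits_along:
  assumes c: "is_chord xs \<eta>" and H: "side_of (trace xs \<union> \<eta>) H"
  shows "splits_along E xs (verts_in H)"
  unfolding splits_along_def
proof (intro allI impI)
  fix xs1 s mid y xs2 qs
  assume xs: "xs = xs1 @ s # mid @ y # xs2" and qs: "qs \<noteq> []" "distinct qs" "set qs \<subseteq> verts_in H"
    and pq: "pedges (s # qs @ [y]) \<subseteq> E"
  note ends = chord_ends[OF c] and sides = chord_sides[OF c H]
  have gx: "gpath xs" using c by (simp add: is_chord_def)
  have \<eta>: "arc_between \<eta> (p (hd xs)) (p (last xs))" using c by (simp add: is_chord_def)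
  have not_xs: "u \<notin> set xs" if "u \<in> verts_in H" for u
    using that in_trace_iff[OF gx, of u] sides(5) by (auto simp: verts_in_def)
  have qdis: "set qs \<inter> set xs = {}" using qs(3) not_xs by auto
  let ?Q = "s # qs @ [y]"
  have sy: "s \<in> V" "y \<in> V" "s \<noteq> y" using gx by (auto simp: gpath_def xs)
  have qV: "set qs \<subseteq> V" using qs(3) by (auto simp: verts_in_def)
  have sq: "s \<notin> set qs" "y \<notin> set qs" using qdis by (auto simp: xs)
  have gQ: "gpath ?Q" using sy qV qs(2) sq pq by (simp add: gpath_def)
  have gA: "gpath (s # mid @ [y])" and g1: "gpath (xs1 @ [s])" and g2: "gpath (y # xs2)"
    using gx pedges_append[of xs1 s "mid @ y # xs2"] pedges_append[of "s # mid" y xs2]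
    by (auto simp: gpath_def xs)
  \<comment> \<open>the three arcs of a theta graph between \<open>p s\<close> and \<open>p y\<close>; \<open>G\<close> is the crosscut\<close>
  define A where "A = trace (s # mid @ [y])"
  define L1 where "L1 = trace (xs1 @ [s])"
  define L2 where "L2 = trace (y # xs2)"
  define B where "B = L1 \<union> \<eta> \<union> L2"
  define G where "G = trace ?Q"
  have trxs: "trace xs = L1 \<union> A \<union> L2"
  proof -
    have "trace xs = L1 \<union> trace (s # mid @ y # xs2)" unfolding xs L1_def by (rule trace_append)
    also have "trace (s # mid @ y # xs2) = A \<union> L2"
      using trace_append[of "s # mid" y xs2] by (simp add: A_def L2_def)
    finally show ?thesis by auto
  qed
  have hd1: "hd (xs1 @ [s]) = hd xs" by (cases xs1) (auto simp: xs)
  have last2: "last (y # xs2) = last xs" by (simp add: xs)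
  have Lsk: "L1 \<subseteq> skeleton" "L2 \<subseteq> skeleton" "A \<subseteq> skeleton" "G \<subseteq> skeleton"
    unfolding L1_def L2_def A_def G_def using trace_sub_skeleton g1 g2 gA gQ by auto
  have \<eta>sk: "z = p (hd xs) \<or> z = p (last xs)" if "z \<in> \<eta>" "z \<in> skeleton" for z
  proof -
    have "\<eta> \<inter> skeleton = {p (hd xs), p (last xs)}" using c by (simp add: is_chord_def)
    moreover have "z \<in> \<eta> \<inter> skeleton" using that by simp
    ultimately show ?thesis by simp
  qed
  have in_hd: "p (hd xs) \<in> trace ys \<longleftrightarrow> hd xs \<in> set ys" "p (last xs) \<in> trace ys \<longleftrightarrow> last xs \<in> set ys"
    if "gpath ys" for ys using in_trace_iff[OF that] ends by auto
  have hdn: "hd xs \<in> set (s # mid @ [y]) \<Longrightarrow> hd xs = s" "hd xs \<notin> set (y # xs2)"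
    using gx by (cases xs1; auto simp: gpath_def xs)+
  have lastn: "last xs \<in> set (s # mid @ [y]) \<Longrightarrow> last xs = y" "last xs \<notin> set (xs1 @ [s])"
    using gx by (cases xs2 rule: rev_cases; auto simp: gpath_def xs)+
  have small: "trace ys \<inter> trace zs = p ` (set ys \<inter> set zs)"
    if "gpath ys" "gpath zs" "set ys \<inter> set zs \<subseteq> {u}" for ys zs u
    using trace_Int[OF that(1,2) pedges_disjoint[OF _ that(3)]] that(1) by (simp add: gpath_def)
  have dxs: "distinct xs" using gx by (simp add: gpath_def)
  have d: "set (xs1 @ [s]) \<inter> set (y # xs2) = {}" using dxs by (auto simp: xs)
  have L12: "L1 \<inter> L2 = {}" unfolding L1_def L2_def by (subst small[OF g1 g2, of s]; simp only: d) simp_all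
  have d: "set (xs1 @ [s]) \<inter> set (s # mid @ [y]) = {s}" using dxs by (auto simp: xs)
  have L1A: "L1 \<inter> A = {p s}" unfolding L1_def A_def by (subst small[OF g1 gA, of s]; simp only: d) simp_all
  have d: "set (y # xs2) \<inter> set (s # mid @ [y]) = {y}" using dxs by (auto simp: xs)
  have L2A: "L2 \<inter> A = {p y}" unfolding L2_def A_def by (subst small[OF g2 gA, of y]; simp only: d) simp_all
  have xQ: "trace xs \<inter> G = {p s, p y}"
  proof -
    have "set xs \<inter> set ?Q = {s, y}" using qdis by (auto simp: xs)
    moreover have "pedges xs \<inter> pedges ?Q = {}"
    proof (rule ccontr)
      assume "pedges xs \<inter> pedges ?Q \<noteq> {}"
      then obtain e where e: "e \<in> pedges xs" "e \<in> pedges ?Q" by blast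
      have "\<exists>q\<in>set qs. q \<in> e"
      proof -
        obtain q qs' where q: "qs = q # qs'" using qs(1) by (cases qs) auto
        have "pedges ?Q = insert {s, q} (pedges (qs @ [y]))" by (simp add: q)
        moreover have "\<exists>q\<in>set qs. q \<in> e" if "e \<in> pedges (qs @ [y])"
          using that sq(2) pedgesD[OF that] qs(2) by auto
        ultimately show ?thesis using e(2) q by auto
      qed
      then show False using pedges_sub[OF e(1)] qdis by auto
    qed
    ultimately show ?thesis using trace_Int[OF gx gQ] by (simp add: G_def)
  qed
  have mems: "p s \<in> L1" "p s \<in> A" "p y \<in> A" "p y \<in> L2" "p s \<in> G" "p y \<in> G"
    by (auto simp: L1_def L2_def A_def G_def trace_def)
  have arcA: "arc_between A (p s) (p y)" using arc_trace[OF gA] by (simp add: A_def)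
  have arcG: "arc_between G (p s) (p y)" using arc_trace[OF gQ] by (simp add: G_def)
  have arcB: "arc_between B (p s) (p y)"
  proof -
    have a1: "arc_between L1 (p s) (p (hd xs))"
      using arc_between_sym[OF arc_trace[OF g1]] unfolding L1_def hd1 by simp
    have a2: "arc_between L2 (p (last xs)) (p y)"
      using arc_between_sym[OF arc_trace[OF g2]] unfolding L2_def last2 by simp
    have "L1 \<inter> \<eta> \<subseteq> {p (hd xs)}"
      using \<eta>sk Lsk(1) in_hd(2)[OF g1] lastn(2) by (fastforce simp: L1_def)
    then have "arc_between (L1 \<union> \<eta>) (p s) (p (last xs))" by (rule arc_between_join[OF a1 \<eta>])
    moreover have "\<eta> \<inter> L2 \<subseteq> {p (last xs)}"
      using \<eta>sk Lsk(2) in_hd(1)[OF g2] hdn(2) by (fastforce simp: L2_def)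
    then have "(L1 \<union> \<eta>) \<inter> L2 \<subseteq> {p (last xs)}" using L12 by auto
    ultimately show ?thesis unfolding B_def by (rule arc_between_join[OF _ a2])
  qed
  have psy: "p s \<noteq> p y" using sy p_eq_iff by simp
  have AB: "A \<inter> B = {p s, p y}"
  proof
    show "{p s, p y} \<subseteq> A \<inter> B" using mems by (simp add: B_def)
    show "A \<inter> B \<subseteq> {p s, p y}"
    proof
      fix z assume z: "z \<in> A \<inter> B"
      then consider "z \<in> L1 \<inter> A" | "z \<in> L2 \<inter> A" | "z \<in> \<eta>" "z \<in> A" by (auto simp: B_def)
      then show "z \<in> {p s, p y}"
      proof cases
        case 3
        then have "z = p (hd xs) \<or> z = p (last xs)" using \<eta>sk[of z] Lsk(3) by auto
        then show ?thesis using 3(2) in_hd[OF gA] hdn(1) lastn(1) by (auto simp: A_def)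
      qed (use L1A L2A in simp_all)
    qed
  qed
  have AG: "A \<inter> G = {p s, p y}"
  proof
    have "A \<inter> G \<subseteq> trace xs \<inter> G" using trxs by auto
    then show "A \<inter> G \<subseteq> {p s, p y}" unfolding xQ .
  qed (use mems in simp)
  have BG: "B \<inter> G = {p s, p y}"
  proof
    show "{p s, p y} \<subseteq> B \<inter> G" using mems by (simp add: B_def)
    show "B \<inter> G \<subseteq> {p s, p y}"
    proof
      fix z assume z: "z \<in> B \<inter> G"
      have "z \<in> trace xs"
      proof (cases "z \<in> \<eta>")
        case True
        then have "z = p (hd xs) \<or> z = p (last xs)" using \<eta>sk[of z] Lsk(4) z by auto
        then show ?thesis using in_trace_iff[OF gx] ends by auto
      qed (use z trxs in \<open>auto simp: B_def\<close>)
      then have "z \<in> trace xs \<inter> G" using z by simp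
      then show "z \<in> {p s, p y}" unfolding xQ .
    qed
  qed
  have ABJ: "A \<union> B = trace xs \<union> \<eta>" using trxs by (auto simp: B_def)
  have GH: "G \<inter> H \<noteq> {}"
  proof -
    obtain q where "q \<in> set qs" using qs(1) by (cases qs) auto
    then have "p q \<in> G" "p q \<in> H" using qs(3) by (auto simp: G_def trace_def verts_in_def)
    then show ?thesis by auto
  qed
  obtain H1 H2 where H12: "side_of (A \<union> G) H1" "side_of (B \<union> G) H2" "H1 \<inter> H2 = {}" "H1 \<union> H2 = H - G"
    using theta_split[OF arcA arcB arcG psy AB AG BG] H GH unfolding ABJ by metis
  note f1 = side_of_facts(4,5)[OF arcA arcG psy AG H12(1)] and f2 = side_of_facts(4,5)[OF arcB arcG psy BG H12(2)]
  show "\<exists>D1 D2. D1 \<union> D2 = verts_in H - set qs \<and> D1 \<inter> D2 = {} \<and>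
        (\<forall>u w. {u, w} \<in> E \<longrightarrow> u \<in> D1 \<longrightarrow> w \<in> D1 \<union> set qs \<union> set (s # mid @ [y])) \<and>
        (\<forall>u w. {u, w} \<in> E \<longrightarrow> u \<in> D2 \<longrightarrow> w \<in> D2 \<union> set qs \<union> set (xs1 @ [s]) \<union> set (y # xs2))"
  proof (rule exI[of _ "verts_in H1"], rule exI[of _ "verts_in H2"], intro conjI allI impI)
    show "verts_in H1 \<inter> verts_in H2 = {}" using H12(3) by (auto simp: verts_in_def)
    show "verts_in H1 \<union> verts_in H2 = verts_in H - set qs"
    proof -
      have "u \<in> verts_in H1 \<union> verts_in H2 \<longleftrightarrow> u \<in> verts_in H - set qs" if u: "u \<in> V" for u
      proof -
        have "u \<in> verts_in H1 \<union> verts_in H2 \<longleftrightarrow> p u \<in> H - G"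
          unfolding H12(4)[symmetric] using u by (auto simp: verts_in_def)
        moreover have "p u \<in> G \<longleftrightarrow> u \<in> set ?Q" unfolding G_def by (rule in_trace_iff[OF gQ u])
        moreover have "s \<notin> verts_in H" "y \<notin> verts_in H" using not_xs[of s] not_xs[of y] by (auto simp: xs)
        ultimately show ?thesis using u by (auto simp: verts_in_def)
      qed
      then show ?thesis by (auto simp: verts_in_def)
    qed
  next
    fix u w assume e: "{u, w} \<in> E" and u: "u \<in> verts_in H1"
    show "w \<in> verts_in H1 \<union> set qs \<union> set (s # mid @ [y])"
    proof (rule ccontr)
      assume w: "w \<notin> verts_in H1 \<union> set qs \<union> set (s # mid @ [y])"
      have uV: "u \<in> V" "p u \<in> H1" using u by (auto simp: verts_in_def)
      have un: "p u \<notin> A \<union> G" using f1(2) uV(2) by auto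
      have "u \<notin> set (s # mid @ [y])" "u \<notin> set ?Q"
        using un in_trace_iff[OF gA uV(1)] in_trace_iff[OF gQ uV(1)] by (auto simp: A_def G_def)
      then have "D {u, w} \<inter> A = {}" "D {u, w} \<inter> G = {}"
        using edge_misses_trace[OF gA e] edge_misses_trace[OF gQ e] w by (auto simp: A_def G_def)
      then have "D {u, w} \<inter> (A \<union> G) = {}" by auto
      from edge_stays_in_face[OF f1(1) e uV(2) this] have "w \<in> verts_in H1"
        using edge_in_V[OF e] by (simp add: verts_in_def)
      then show False using w by simp
    qed
  next
    fix u w assume e: "{u, w} \<in> E" and u: "u \<in> verts_in H2"
    show "w \<in> verts_in H2 \<union> set qs \<union> set (xs1 @ [s]) \<union> set (y # xs2)"
    proof (rule ccontr)
      assume w: "w \<notin> verts_in H2 \<union> set qs \<union> set (xs1 @ [s]) \<union> set (y # xs2)"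
      have uV: "u \<in> V" "p u \<in> H2" using u by (auto simp: verts_in_def)
      have un: "p u \<notin> B \<union> G" using f2(2) uV(2) by auto
      have u2: "u \<notin> set (xs1 @ [s])" "u \<notin> set (y # xs2)" "u \<notin> set ?Q"
        using un in_trace_iff[OF g1 uV(1)] in_trace_iff[OF g2 uV(1)] in_trace_iff[OF gQ uV(1)]
        by (auto simp: B_def L1_def L2_def G_def)
      have hl: "hd xs \<in> set (xs1 @ [s])" using hd1 hd_in_set[of "xs1 @ [s]"] by simp
      have ll: "last xs \<in> set (y # xs2)" using last2 last_in_set[of "y # xs2"] by simp
      have "D {u, w} \<inter> L1 = {}" "D {u, w} \<inter> L2 = {}" "D {u, w} \<inter> G = {}"
        using edge_misses_trace[OF g1 e] edge_misses_trace[OF g2 e] edge_misses_trace[OF gQ e] w u2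
        by (auto simp: L1_def L2_def G_def)
      moreover have "D {u, w} \<inter> \<eta> = {}"
        using edge_misses_chord[OF c e] u2 w hl ll by auto
      ultimately have "D {u, w} \<inter> (B \<union> G) = {}" by (auto simp: B_def)
      from edge_stays_in_face[OF f2(1) e uV(2) this] have "w \<in> verts_in H2"
        using edge_in_V[OF e] by (simp add: verts_in_def)
      then show False using w by simp
    qed
  qed
qed

end

text \<open>
  \<open>A\<close> and \<open>B\<close> are the vertices on the two sides of the curve through a balanced chord. Edges cross neither
  the path nor the chord, so none leads from \<open>A\<close> to \<open>B\<close>.
\<close>

theorem planar_path_separator:
  fixes w :: "'a \<Rightarrow> real"
  assumes pg: "plane_graph V E p D0" and T: "spanning_connected V T" "T \<subseteq> E" and w: "\<And>u. w u \<ge> 0"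
    and V2: "card V \<ge> 2"
  obtains xs A B where "distinct xs" "set xs \<subseteq> V" "pedges xs \<subseteq> T" "length xs \<ge> 2"
    "A \<union> B = V - set xs" "A \<inter> B = {}" "\<And>u w. {u, w} \<in> E \<Longrightarrow> u \<in> A \<Longrightarrow> w \<notin> B"
    "3 * sum w A \<le> 2 * sum w V" "3 * sum w B \<le> 2 * sum w V"
    "splits_along E xs A" "splits_along E (rev xs) A" "splits_along E xs B" "splits_along E (rev xs) B"
proof -
  obtain D xs \<eta> H where D: "conic_plane_graph V E p D" and st: "plane_graph.chord_state V E p D T xs \<eta> H"
    and bal: "3 * sum w (plane_graph.verts_in V p H) \<le> 2 * sum w V"
    "3 * sum w (V - set xs - plane_graph.verts_in V p H) \<le> 2 * sum w V"
    using balanced_chord[where w = w, OF pg T w V2] by blast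
  interpret conic_plane_graph V E p D by (rule D)
  have c: "is_chord xs \<eta>" and xT: "pedges xs \<subseteq> T" and H: "side_of (trace xs \<union> \<eta>) H"
    using st by (auto simp: chord_state_def)
  have gx: "gpath xs" using c by (rule chord_gpath)
  let ?J = "trace xs \<union> \<eta>"
  define I where "I = (if H = inside ?J then outside ?J else inside ?J)"
  have I: "side_of ?J I" by (auto simp: I_def side_of_def)
  have "H \<noteq> I"
  proof
    assume "H = I"
    then have "H = inside ?J" "H = outside ?J" using H by (auto simp: I_def side_of_def split: if_splits)
    then show False using inside_Int_outside[of ?J] chord_sides(3)[OF c H] by simp
  qed
  note cov = sides_cover[OF H I this]
  have HI: "z \<in> I \<longleftrightarrow> z \<notin> ?J \<and> z \<notin> H" for z
  proof -
    have "z \<in> H \<union> I \<longleftrightarrow> z \<notin> ?J" "z \<notin> H \<inter> I" unfolding cov by auto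
    then show ?thesis by blast
  qed
  let ?A = "verts_in H" and ?B = "verts_in I"
  have onJ: "p u \<in> ?J \<longleftrightarrow> u \<in> set xs" if "u \<in> V" for u
    using in_trace_iff[OF gx that] chord_vertex[OF c that] chord_ends[OF c] by auto
  have B: "?B = V - set xs - ?A" using HI onJ by (auto simp: verts_in_def)
  have Adis: "?A \<inter> set xs = {}" using onJ chord_sides(5)[OF c H] by (auto simp: verts_in_def)
  have len: "length xs \<ge> 2" using c by (cases xs rule: pedges.cases) (auto simp: is_chord_def gpath_def)
  have revc: "is_chord (rev xs) \<eta>" by (rule is_chord_rev[OF c])
  show ?thesis
  proof (rule that[of xs ?A ?B])
    show "distinct xs" "set xs \<subseteq> V" using gx by (auto simp: gpath_def)
    show "pedges xs \<subseteq> T" "length xs \<ge> 2" by fact+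
    show "?A \<union> ?B = V - set xs" "?A \<inter> ?B = {}" using B Adis by (auto simp: verts_in_def)
    show "w \<notin> ?B" if "{u, w} \<in> E" "u \<in> ?A" for u w
      using side_closed_under_edges[OF c H that] B by auto
    show "3 * sum w ?A \<le> 2 * sum w V" "3 * sum w ?B \<le> 2 * sum w V" using bal B by simp_all
    show "splits_along E xs ?A" "splits_along E xs ?B" using chord_splits_along[OF c] H I by auto
    show "splits_along E (rev xs) ?A" "splits_along E (rev xs) ?B"
      using chord_splits_along[OF revc] H I by auto
  qed
qed

section \<open>Schedules for the firefighters\<close>

lemma sn_geI:
  assumes "finite (pverts G)" "strategy k G v P" "X \<subseteq> saved G P v"
  shows "card X \<le> sn k G v"
proof -
  have fin: "finite (saved G Q v)" for Q using assms(1) by (simp add: saved_def)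
  have "{card (saved G Q v) | Q. strategy k G v Q} \<subseteq> {..card (pverts G)}"
    using assms(1) by (auto simp: saved_def intro!: card_mono)
  then have "finite {card (saved G Q v) | Q. strategy k G v Q}" by (rule finite_subset) simp
  then have "card (saved G P v) \<le> sn k G v" unfolding sn_def using assms(2) by (intro Max_ge) auto
  moreover have "card X \<le> card (saved G P v)" using fin assms(3) by (intro card_mono)
  ultimately show ?thesis by simp
qed

text \<open>
  To save all of \<open>X\<close> it is enough to protect each entrance \<open>b\<close> of \<open>X\<close> in some round \<open>\<tau> b\<close> before the fire,
  running outside \<open>X\<close>, can arrive there. The value \<open>\<tau> b = 0\<close> means that \<open>b\<close> is never protected.
\<close>

theorem sn_ge_schedule:
  fixes G :: "'a pair_pre_digraph"
  assumes fin: "finite (pverts G)" and X: "X \<subseteq> pverts G" "v \<notin> X"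
    and cap: "\<And>t. card {b \<in> X. \<tau> b = Suc t} \<le> k"
    and deadline: "\<And>n u b. (v, u) \<in> (parcs G \<inter> (- X) \<times> (- X)) ^^ n \<Longrightarrow> u \<notin> X \<Longrightarrow> (u, b) \<in> parcs G \<Longrightarrow> b \<in> X \<Longrightarrow>
       1 \<le> \<tau> b \<and> \<tau> b \<le> Suc n"
  shows "card X \<le> sn k G v"
proof -
  define P where "P t = {b \<in> X. \<tau> b = Suc t}" for t
  have burn: "\<forall>u \<in> burning G P v t. u \<notin> X \<and> (\<exists>n\<le>t. (v, u) \<in> (parcs G \<inter> (- X) \<times> (- X)) ^^ n)" for t
  proof (induction t)
    case 0
    have "(v, v) \<in> (parcs G \<inter> (- X) \<times> (- X)) ^^ 0" by simp
    then show ?case using X(2) by auto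
  next
    case (Suc t)
    show ?case
    proof
      fix w assume w: "w \<in> burning G P v (Suc t)"
      show "w \<notin> X \<and> (\<exists>n\<le>Suc t. (v, w) \<in> (parcs G \<inter> (- X) \<times> (- X)) ^^ n)"
      proof (cases "w \<in> burning G P v t")
        case True
        then show ?thesis using Suc.IH le_SucI by blast
      next
        case False
        then obtain u where u: "u \<in> burning G P v t" "(u, w) \<in> parcs G" "w \<notin> (\<Union>s\<le>t. P s)"
          using w by auto
        then obtain n where n: "u \<notin> X" "n \<le> t" "(v, u) \<in> (parcs G \<inter> (- X) \<times> (- X)) ^^ n"
          using Suc.IH by blast
        have wX: "w \<notin> X"
        proof
          assume "w \<in> X"
          then have d: "1 \<le> \<tau> w" "\<tau> w \<le> Suc n" using deadline[OF n(3,1) u(2)] by auto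
          then have "w \<in> P (\<tau> w - 1)" using \<open>w \<in> X\<close> by (simp add: P_def)
          moreover have "\<tau> w - 1 \<le> t" using d n(2) by simp
          ultimately show False using u(3) by auto
        qed
        have "(u, w) \<in> parcs G \<inter> (- X) \<times> (- X)" using u(2) n(1) wX by simp
        then have "(v, w) \<in> (parcs G \<inter> (- X) \<times> (- X)) ^^ Suc n" using n(3) by auto
        then show ?thesis using wX n(2) by (meson Suc_le_mono)
      qed
    qed
  qed
  have "strategy k G v P"
    unfolding strategy_def using X(1) cap burn by (auto simp: P_def)
  moreover have "X \<subseteq> saved G P v" using X(1) burn by (auto simp: saved_def)
  ultimately show ?thesis by (rule sn_geI[OF fin])
qed

section \<open>Distances and geodesics\<close>

locale fire_graph =
  fixes V :: "'a set" and R :: "'a rel" and v :: 'a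
  assumes finite_V: "finite V" and R_V: "R \<subseteq> V \<times> V" and sym_R: "(u, w) \<in> R \<Longrightarrow> (w, u) \<in> R"
    and irrefl: "(u, u) \<notin> R" and conn: "u \<in> V \<Longrightarrow> w \<in> V \<Longrightarrow> (u, w) \<in> R\<^sup>*" and v_V: "v \<in> V"
begin

definition d :: "'a \<Rightarrow> nat" where "d u = (LEAST n. (v, u) \<in> R ^^ n)"

lemma d_walk: "u \<in> V \<Longrightarrow> (v, u) \<in> R ^^ d u"
  unfolding d_def using conn[OF v_V, of u] rtrancl_power[of "(v, u)" R] by (metis LeastI)

lemma d_le: "(v, u) \<in> R ^^ n \<Longrightarrow> d u \<le> n"
  unfolding d_def by (rule Least_le)

lemma d_v [simp]: "d v = 0" using d_le[of v 0] by simp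

lemma d_0: "u \<in> V \<Longrightarrow> d u = 0 \<longleftrightarrow> u = v"
  using d_walk[of u] by auto

lemma d_edge: "(u, w) \<in> R \<Longrightarrow> d w \<le> Suc (d u)"
proof -
  assume uw: "(u, w) \<in> R"
  then have "u \<in> V" using R_V by auto
  then have "(v, w) \<in> R ^^ Suc (d u)" using d_walk[of u] uw by auto
  then show ?thesis by (rule d_le)
qed

lemma d_walk_le: "(u, w) \<in> R ^^ n \<Longrightarrow> d w \<le> d u + n"
proof (induction n arbitrary: w)
  case (Suc n)
  then obtain x where "(u, x) \<in> R ^^ n" "(x, w) \<in> R" by auto
  then show ?case using Suc.IH[of x] d_edge[of x w] by simp
qed simp

text \<open>
  The neighbours of \<open>v\<close> through which geodesics lead to \<open>x\<close>. If none of them burns after the first round,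
  then the fire reaches \<open>x\<close> at least one round late.
\<close>

definition starts :: "'a \<Rightarrow> 'a set" where
  "starts x = {w. (v, w) \<in> R \<and> (\<exists>n. d x = Suc n \<and> (w, x) \<in> R ^^ n)}"

lemma nbr_d: "(v, w) \<in> R \<Longrightarrow> d w = 1"
proof -
  assume w: "(v, w) \<in> R"
  then have "w \<in> V" "w \<noteq> v" using R_V irrefl by auto
  then show ?thesis using d_edge[OF w] d_0 by (simp add: le_Suc_eq)
qed

lemma starts_nbr: "(v, l) \<in> R \<Longrightarrow> starts l = {l}"
  using nbr_d[of l] by (auto simp: starts_def)

lemma starts_nonempty: "x \<in> V \<Longrightarrow> x \<noteq> v \<Longrightarrow> starts x \<noteq> {}"
proof -
  assume x: "x \<in> V" "x \<noteq> v"
  then obtain n where n: "d x = Suc n" using d_0 by (cases "d x") auto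
  then have "(v, x) \<in> R ^^ Suc n" using d_walk[OF x(1)] by simp
  then obtain w where "(v, w) \<in> R" "(w, x) \<in> R ^^ n" by (metis relpow_Suc_D2)
  then show ?thesis using n by (auto simp: starts_def)
qed

lemma starts_mono:
  assumes "(y, x) \<in> R" "d x = Suc (d y)" "y \<noteq> v"
  shows "starts y \<subseteq> starts x"
proof
  fix w assume "w \<in> starts y"
  then obtain n where n: "(v, w) \<in> R" "d y = Suc n" "(w, y) \<in> R ^^ n" by (auto simp: starts_def)
  have "(w, x) \<in> R ^^ Suc n" using n(3) assms(1) by auto
  then show "w \<in> starts x" using n assms(2) by (auto simp: starts_def)
qed

lemma starts_step:
  assumes w: "w \<in> starts x" and x: "d x \<ge> 2"
  shows "\<exists>y. (y, x) \<in> R \<and> d x = Suc (d y) \<and> w \<in> starts y"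
proof -
  obtain n where n: "(v, w) \<in> R" "d x = Suc n" "(w, x) \<in> R ^^ n" using w by (auto simp: starts_def)
  obtain m where m: "n = Suc m" using x n(2) by (cases n) auto
  then obtain y where y: "(w, y) \<in> R ^^ m" "(y, x) \<in> R" using n(3) by auto
  have "d y \<le> Suc m" using d_walk_le[OF y(1)] nbr_d[OF n(1)] by simp
  moreover have "Suc (Suc m) \<le> Suc (d y)" using d_edge[OF y(2)] n(2) m by simp
  ultimately have "d y = Suc m" by simp
  then show ?thesis using y n m by (auto simp: starts_def)
qed

lemma starts_geodesic:
  assumes w: "w \<in> starts x"
  shows "\<exists>qs. last (qs @ [x]) = x \<and> hd (qs @ [x]) = w \<and> (\<forall>q\<in>set qs. w \<in> starts q \<and> starts q \<subseteq> starts x \<and> d q < d x \<and> q \<in> V) \<and>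
     inj_on d (set qs) \<and> distinct qs \<and> successively (\<lambda>a b. (a, b) \<in> R) (v # qs @ [x])"
  using w
proof (induction "d x" arbitrary: x rule: less_induct)
  case less
  obtain n where n: "(v, w) \<in> R" "d x = Suc n" "(w, x) \<in> R ^^ n" using less.prems by (auto simp: starts_def)
  show ?case
  proof (cases n)
    case 0
    then have "x = w" using n(3) by simp
    then show ?thesis using n(1) by (intro exI[of _ "[]"]) simp
  next
    case (Suc m)
    then obtain y where y: "(y, x) \<in> R" "d x = Suc (d y)" "w \<in> starts y"
      using starts_step[OF less.prems] n(2) by auto
    obtain qs where qs: "hd (qs @ [y]) = w" "\<forall>q\<in>set qs. w \<in> starts q \<and> starts q \<subseteq> starts y \<and> d q < d y \<and> q \<in> V" "inj_on d (set qs)" "distinct qs"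
      "successively (\<lambda>a b. (a, b) \<in> R) (v # qs @ [y])"
      using less.hyps[OF _ y(3)] y(2) by auto
    have yV: "y \<in> V" using y(1) R_V by auto
    have dy: "d y \<notin> d ` set qs" "y \<notin> set qs" using qs(2) by auto
    have suc: "successively (\<lambda>a b. (a, b) \<in> R) ((v # qs @ [y]) @ [x])"
      using qs(5) y(1) by (subst successively_append_iff) auto
    have ynv: "y \<noteq> v" using y(3) by (auto simp: starts_def)
    then have sub: "starts y \<subseteq> starts x" by (rule starts_mono[OF y(1,2)])
    have "\<forall>q\<in>set (qs @ [y]). w \<in> starts q \<and> starts q \<subseteq> starts x \<and> d q < d x \<and> q \<in> V"
    proof
      fix q assume "q \<in> set (qs @ [y])"
      then consider "q \<in> set qs" | "q = y" by auto
      then show "w \<in> starts q \<and> starts q \<subseteq> starts x \<and> d q < d x \<and> q \<in> V"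
      proof cases
        case 1 then show ?thesis using bspec[OF qs(2) 1] sub y(2) by auto
      next
        case 2 then show ?thesis using y sub yV by simp
      qed
    qed
    moreover have "hd ((qs @ [y]) @ [x]) = w" using qs(1) by (cases qs) auto
    ultimately show ?thesis using qs(3,4) dy suc by (intro exI[of _ "qs @ [y]"]) (auto simp: inj_on_insert)
  qed
qed

end

section \<open>Breadth-first search trees with preferences\<close>

lemma rtrancl_distinct_path:
  assumes "(u, w) \<in> {(a, b). {a, b} \<in> T}\<^sup>*" "u \<in> V" "\<And>e. e \<in> T \<Longrightarrow> e \<subseteq> V"
  shows "\<exists>xs. xs \<noteq> [] \<and> hd xs = u \<and> last xs = w \<and> distinct xs \<and> set xs \<subseteq> V \<and> pedges xs \<subseteq> T"
  using assms(1)
proof (induction rule: rtrancl_induct)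
  case base
  then show ?case using assms(2) by (intro exI[of _ "[u]"]) simp
next
  case (step y z)
  then obtain xs where xs: "xs \<noteq> []" "hd xs = u" "last xs = y" "distinct xs" "set xs \<subseteq> V" "pedges xs \<subseteq> T"
    by blast
  have yz: "{y, z} \<in> T" using step by simp
  show ?case
  proof (cases "z \<in> set xs")
    case True
    then obtain as bs where ab: "xs = as @ z # bs" by (auto dest: split_list)
    have "pedges (as @ [z]) \<subseteq> T" using xs(6) pedges_append[of as z bs] ab by auto
    then show ?thesis using xs ab by (intro exI[of _ "as @ [z]"]) (cases as; auto)
  next
    case False
    obtain as where as: "xs = as @ [y]" using xs(1,3) by (metis append_butlast_last_id)
    have "pedges (as @ y # [z]) = pedges xs \<union> {{y, z}}" using pedges_append[of as y "[z]"] as by simp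
    then have "pedges (xs @ [z]) \<subseteq> T" using xs(6) yz as by simp
    moreover have "z \<in> V" using assms(3)[OF yz] by simp
    ultimately show ?thesis using xs False by (intro exI[of _ "xs @ [z]"]) simp
  qed
qed

text \<open>
  The conclusion of the separator theorem for the weight that is 0 at \<open>v\<close> and 1 elsewhere. From here on this
  is all that is used of planarity.
\<close>

definition separable :: "'a set \<Rightarrow> 'a set set \<Rightarrow> 'a \<Rightarrow> bool" where
  "separable V E v \<longleftrightarrow> (\<forall>T. spanning_connected V T \<longrightarrow> T \<subseteq> E \<longrightarrow>
     (\<exists>xs A B. distinct xs \<and> set xs \<subseteq> V \<and> pedges xs \<subseteq> T \<and> length xs \<ge> 2 \<and>
        A \<union> B = V - set xs \<and> A \<inter> B = {} \<and> (\<forall>u w. {u, w} \<in> E \<longrightarrow> u \<in> A \<longrightarrow> w \<notin> B) \<and>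
        3 * card (A - {v}) \<le> 2 * (card V - 1) \<and> 3 * card (B - {v}) \<le> 2 * (card V - 1) \<and>
        splits_along E xs A \<and> splits_along E (rev xs) A \<and> splits_along E xs B \<and> splits_along E (rev xs) B))"

text \<open>
  The rank is a preference among the neighbours of \<open>v\<close>: in the search tree every vertex hangs below the
  neighbour of least rank through which a geodesic leads to it.
\<close>

locale fire_rank =
  fixes G :: "'a pair_pre_digraph" and v :: 'a and rk :: "'a \<Rightarrow> nat"
  assumes fg: "fire_graph (pverts G) (parcs G) v" and rk_inj: "inj_on rk {w. (v, w) \<in> parcs G}"

sublocale fire_rank \<subseteq> fire_graph "pverts G" "parcs G" v by (rule fg)

context fire_rank
begin

abbreviation "V \<equiv> pverts G"
abbreviation "R \<equiv> parcs G"
definition nbrs :: "'a \<Rightarrow> 'a set" where "nbrs u = {w. (u, w) \<in> R}"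

lemma nbrs_V: "nbrs u \<subseteq> V" using R_V by (auto simp: nbrs_def)
lemma finite_nbrs: "finite (nbrs u)" using nbrs_V finite_V finite_subset by blast
lemma edge_iff: "{u, w} \<in> edges G \<longleftrightarrow> (u, w) \<in> R"
  using sym_R by (auto simp: edges_def doubleton_eq_iff)

lemma starts_sub: "starts x \<subseteq> nbrs v" by (auto simp: starts_def nbrs_def)

definition best :: "'a \<Rightarrow> nat" where "best x = Min (rk ` starts x)"

lemma finite_starts: "finite (starts x)" using starts_sub finite_nbrs finite_subset by blast

lemma best_in: "x \<in> V \<Longrightarrow> x \<noteq> v \<Longrightarrow> \<exists>w\<in>starts x. best x = rk w"
  unfolding best_def using Min_in[of "rk ` starts x"] finite_starts starts_nonempty by fastforce

lemma best_le: "w \<in> starts x \<Longrightarrow> best x \<le> rk w"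
  unfolding best_def using finite_starts by (intro Min_le) auto

lemma best_nbr: "(v, l) \<in> R \<Longrightarrow> best l = rk l"
  by (simp add: best_def starts_nbr)

text \<open>
  A parent on a geodesic that starts with the preferred neighbour \<open>best x\<close>. It exists because a vertex
  before \<open>x\<close> on such a geodesic has no preferred neighbour that \<open>x\<close> does not have.
\<close>

definition par :: "'a \<Rightarrow> 'a" where
  "par x = (SOME y. (y, x) \<in> R \<and> d x = Suc (d y) \<and> (y = v \<or> best y = best x))"

lemma par:
  assumes x: "x \<in> V" "x \<noteq> v"
  shows "(par x, x) \<in> R" "d x = Suc (d (par x))" "par x = v \<or> best (par x) = best x"
proof -
  have "\<exists>y. (y, x) \<in> R \<and> d x = Suc (d y) \<and> (y = v \<or> best y = best x)"
  proof (cases "d x \<ge> 2")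
    case True
    obtain w where w: "w \<in> starts x" "best x = rk w" using best_in[OF x] by blast
    obtain y where y: "(y, x) \<in> R" "d x = Suc (d y)" "w \<in> starts y" using starts_step[OF w(1) True] by blast
    have "y \<noteq> v" using y(3) by (auto simp: starts_def)
    moreover have "y \<in> V" using y(1) R_V by auto
    ultimately obtain w' where w': "w' \<in> starts y" "best y = rk w'" using best_in by blast
    have "w' \<in> starts x" using starts_mono[OF y(1,2) \<open>y \<noteq> v\<close>] w'(1) by blast
    then have "best x \<le> best y" using best_le[of w' x] w'(2) by simp
    moreover have "best y \<le> best x" using best_le[OF y(3)] w(2) by simp
    ultimately show ?thesis using y by auto
  next
    case False
    then have "d x = 1" using d_0[OF x(1)] x(2) by simp
    moreover have "(v, x) \<in> R" using d_walk[OF x(1)] calculation by simp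
    ultimately show ?thesis by auto
  qed
  from someI_ex[OF this] show "(par x, x) \<in> R" "d x = Suc (d (par x))" "par x = v \<or> best (par x) = best x"
    unfolding par_def by blast+
qed

definition bfs :: "'a set set" where "bfs = {{x, par x} | x. x \<in> V \<and> x \<noteq> v}"

lemma bfs_edges: "bfs \<subseteq> edges G"
  unfolding bfs_def using par(1) sym_R edge_iff by auto

lemma bfs_V: "e \<in> bfs \<Longrightarrow> e \<subseteq> V"
  using bfs_edges edge_iff R_V by (fastforce simp: edges_def)

lemma bfs_spanning: "spanning_connected V bfs"
proof -
  let ?r = "{(a, b). {a, b} \<in> bfs}"
  have sym: "sym (?r\<^sup>*)" by (intro sym_rtrancl) (auto simp: sym_def insert_commute)
  have tov: "(v, u) \<in> ?r\<^sup>*" if "u \<in> V" for u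
    using that
  proof (induction "d u" arbitrary: u rule: less_induct)
    case less
    show ?case
    proof (cases "u = v")
      case False
      note p = par[OF less.prems False]
      have "par u \<in> V" using p(1) R_V by auto
      then have "(v, par u) \<in> ?r\<^sup>*" using less.hyps[of "par u"] p(2) by simp
      moreover have "{u, par u} \<in> bfs" using less.prems False by (auto simp: bfs_def)
      then have "(par u, u) \<in> ?r" by (simp add: insert_commute)
      ultimately show ?thesis by (rule rtrancl_into_rtrancl)
    qed simp
  qed
  show ?thesis
    unfolding spanning_connected_def
  proof (intro ballI)
    fix u w assume uw: "u \<in> V" "w \<in> V"
    have "(u, v) \<in> ?r\<^sup>*" using symD[OF sym tov[OF uw(1)]] .
    then have "(u, w) \<in> ?r\<^sup>*" using tov[OF uw(2)] by (rule rtrancl_trans)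
    from rtrancl_distinct_path[OF this uw(1) bfs_V]
    show "\<exists>xs. xs \<noteq> [] \<and> hd xs = u \<and> last xs = w \<and> distinct xs \<and> set xs \<subseteq> V \<and> pedges xs \<subseteq> bfs" by blast
  qed
qed

text \<open>
  The list of vertices met when descending in the tree from \<open>z\<close>, without \<open>z\<close> itself.
\<close>

fun desc :: "'a \<Rightarrow> 'a list \<Rightarrow> bool" where
  "desc z [] \<longleftrightarrow> True"
| "desc z (y # ys) \<longleftrightarrow> y \<in> V \<and> y \<noteq> v \<and> par y = z \<and> desc y ys"

lemma desc_append: "desc z (xs @ y # ys) \<longleftrightarrow> desc z xs \<and> y \<in> V \<and> y \<noteq> v \<and> par y = last (z # xs) \<and> desc y ys"
  by (induction xs arbitrary: z) auto

lemma desc_levels: "desc z ys \<Longrightarrow> (\<forall>y\<in>set ys. d z < d y) \<and> inj_on d (set ys) \<and> distinct ys \<and> set ys \<subseteq> V - {v}"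
proof (induction ys arbitrary: z)
  case (Cons y ys)
  then have y: "y \<in> V" "y \<noteq> v" "par y = z" and IH: "\<forall>x\<in>set ys. d y < d x" "inj_on d (set ys)" "distinct ys" "set ys \<subseteq> V - {v}"
    by auto
  have "d y = Suc (d z)" using par(2)[OF y(1,2)] y(3) by simp
  moreover have "d y \<notin> d ` set ys" using IH(1) by auto
  ultimately show ?case using IH y by (auto simp: inj_on_insert)
qed simp

lemma desc_best: "desc v (l # ys) \<Longrightarrow> x \<in> set (l # ys) \<Longrightarrow> (v, l) \<in> R \<and> best x = rk l"
proof (induction ys arbitrary: x rule: rev_induct)
  case Nil
  then have "(v, l) \<in> R" using par(1)[of l] by auto
  then show ?case using Nil best_nbr by simp
next
  case (snoc y ys)
  have p: "desc v (l # ys)" "y \<in> V" "y \<noteq> v" "par y = last (l # ys)"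
    using snoc.prems(1) desc_append[of v "l # ys" y "[]"] by auto
  have "par y \<in> set (l # ys)" using p(4) by (metis last_in_set list.distinct(1))
  then have "best (par y) = rk l" "(v, l) \<in> R" using snoc.IH[OF p(1)] by auto
  moreover have "par y \<noteq> v" using desc_levels[OF p(1)] \<open>par y \<in> set (l # ys)\<close> by auto
  ultimately have "best y = rk l" using par(3)[OF p(2,3)] by simp
  then show ?case using snoc.IH[OF p(1)] snoc.prems(2) \<open>(v, l) \<in> R\<close> by auto
qed

text \<open>
  A path in a rooted tree that has turned away from the root never turns back, as it would have to return
  to the vertex that it came from.
\<close>

lemma bfs_path_shape:
  "distinct xs \<Longrightarrow> xs \<noteq> [] \<Longrightarrow> set xs \<subseteq> V \<Longrightarrow> pedges xs \<subseteq> bfs \<Longrightarrow> \<exists>as z bs. xs = rev as @ z # bs \<and> desc z as \<and> desc z bs"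
proof (induction xs rule: pedges.induct)
  case (1 x y zs)
  then obtain as z bs where IH: "y # zs = rev as @ z # bs" "desc z as" "desc z bs" by auto
  have "{x, y} \<in> bfs" using 1 by simp
  then obtain c where c: "{x, y} = {c, par c}" "c \<in> V" "c \<noteq> v" by (auto simp: bfs_def)
  show ?case
  proof (cases "c = x")
    case True
    have pc: "par x \<noteq> x" using par(2)[of x] c True by auto
    then have "par x = y" using c True by (auto simp: doubleton_eq_iff)
    moreover have "last (z # as) = y" using IH(1) by (cases as rule: rev_cases) auto
    ultimately have "desc z (as @ [x])" using IH(2) c True by (simp add: desc_append)
    moreover have "x # y # zs = rev (as @ [x]) @ z # bs" using IH(1) by simp
    ultimately show ?thesis using IH(3) by blast
  next
    case False
    then have "c = y" "par y = x" using c by (auto simp: doubleton_eq_iff)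
    show ?thesis
    proof (cases as rule: rev_cases)
      case Nil
      then have "z = y" "bs = zs" using IH(1) by auto
      then have "desc x (y # zs)" using IH(3) c \<open>c = y\<close> \<open>par y = x\<close> by simp
      then show ?thesis by (intro exI[of _ "[]"] exI[of _ x] exI[of _ "y # zs"]) simp
    next
      case (snoc as' y')
      then have "y' = y" using IH(1) by simp
      then have "par y = last (z # as')" using IH(2) snoc by (simp add: desc_append)
      moreover have "last (z # as') \<in> set zs"
        using IH(1) snoc by (cases as' rule: rev_cases) auto
      ultimately show ?thesis using 1(2) \<open>par y = x\<close> by auto
    qed
  qed
next
  case "2_1"
  then show ?case by simp
next
  case ("2_2" x)
  then show ?case by (intro exI[of _ "[]"] exI[of _ x] exI[of _ "[]"]) simp
qed

section \<open>Saving a side of the separator\<close>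

lemma level_le_1: "inj_on d Y \<Longrightarrow> card {b \<in> Y. d b = t} \<le> 1"
proof -
  assume inj: "inj_on d Y"
  show ?thesis
  proof (cases "{b \<in> Y. d b = t} = {}")
    case False
    then obtain c where "c \<in> Y" "d c = t" by auto
    then have "{b \<in> Y. d b = t} \<subseteq> {c}" using inj by (auto dest: inj_onD)
    then show ?thesis using card_mono[of "{c}"] by fastforce
  next
    case True
    then show ?thesis by (simp only: card.empty)
  qed
qed

lemma level_le_2:
  assumes "inj_on d Y" "inj_on d Z"
  shows "card {b \<in> Y \<union> Z. d b = t} \<le> 2"
proof -
  have "{b \<in> Y \<union> Z. d b = t} = {b \<in> Y. d b = t} \<union> {b \<in> Z. d b = t}" by auto
  then show ?thesis using card_Un_le[of "{b \<in> Y. d b = t}" "{b \<in> Z. d b = t}"]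
      level_le_1[OF assms(1), of t] level_le_1[OF assms(2), of t] by simp
qed

lemma walk_restrict: "(u, w) \<in> (R \<inter> S) ^^ n \<Longrightarrow> (u, w) \<in> R ^^ n"
  by (induction n arbitrary: w) auto

text \<open>
  The set \<open>N\<close> contains all entrances of \<open>X\<close>. An entrance at distance \<open>t\<close> from \<open>v\<close> is protected in round \<open>t\<close>, which
  is early enough for every course of the fire.
\<close>

lemma save_by_levels:
  assumes X: "X \<subseteq> V" "v \<notin> X" and N: "\<And>u b. (u, b) \<in> R \<Longrightarrow> u \<notin> X \<Longrightarrow> b \<in> X \<Longrightarrow> b \<in> N"
    and cap: "\<And>t. card {b \<in> X \<inter> N. d b = Suc t} \<le> 2"
  shows "card X \<le> sn 2 G v"
proof (rule sn_ge_schedule[OF finite_V X, where \<tau> = "\<lambda>b. if b \<in> N then d b else 0"])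
  fix t
  have "{b \<in> X. (if b \<in> N then d b else 0) = Suc t} = {b \<in> X \<inter> N. d b = Suc t}" by auto
  then show "card {b \<in> X. (if b \<in> N then d b else 0) = Suc t} \<le> 2" using cap by simp
next
  fix n u b
  assume h: "(v, u) \<in> (R \<inter> (- X) \<times> (- X)) ^^ n" "u \<notin> X" "(u, b) \<in> R" "b \<in> X"
  have "b \<in> N" using N h by blast
  moreover have "(v, b) \<in> R ^^ Suc n" using walk_restrict[OF h(1)] h(3) by auto
  then have "d b \<le> Suc n" by (rule d_le)
  moreover have "d b \<noteq> 0" using d_0[of b] h(4) X by auto
  ultimately show "1 \<le> (if b \<in> N then d b else 0) \<and> (if b \<in> N then d b else 0) \<le> Suc n" by simp
qed

lemma nbrs_d: "w \<in> nbrs v \<longleftrightarrow> w \<in> V \<and> d w = 1"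
proof
  assume "w \<in> nbrs v" then show "w \<in> V \<and> d w = 1" using nbr_d R_V by (auto simp: nbrs_def)
next
  assume "w \<in> V \<and> d w = 1" then show "w \<in> nbrs v" using d_walk[of w] by (simp add: nbrs_def)
qed

text \<open>
  If \<open>v\<close> is not on the path, then the path separates the fire from the other side, and it has at most two
  vertices at each distance from \<open>v\<close>.
\<close>

lemma save_side_off_path:
  assumes xs: "distinct xs" "set xs \<subseteq> V" "pedges xs \<subseteq> bfs" "xs \<noteq> []"
    and AB: "A \<union> B = V - set xs" "A \<inter> B = {}" and no: "\<And>u w. (u, w) \<in> R \<Longrightarrow> u \<in> A \<Longrightarrow> w \<notin> B" and v: "v \<in> B"
  shows "card (A \<union> set xs) \<le> sn 2 G v"
proof (rule save_by_levels[where N = "set xs"])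
  show "A \<union> set xs \<subseteq> V" "v \<notin> A \<union> set xs" using xs AB v by auto
next
  fix u b assume h: "(u, b) \<in> R" "u \<notin> A \<union> set xs" "b \<in> A \<union> set xs"
  have "u \<in> B" using h R_V AB by auto
  then show "b \<in> set xs" using no[of b u] sym_R[OF h(1)] h(3) by auto
next
  fix t
  obtain as z bs where s: "xs = rev as @ z # bs" "desc z as" "desc z bs"
    using bfs_path_shape[OF xs(1,4,2,3)] by blast
  have "inj_on d (insert z (set as))" "inj_on d (set bs)"
    using desc_levels[OF s(2)] desc_levels[OF s(3)] by (force simp: inj_on_insert)+
  from level_le_2[OF this, of "Suc t"] have "card {b \<in> set xs. d b = Suc t} \<le> 2" by (simp add: s(1) insert_commute Un_ac)
  moreover have "(A \<union> set xs) \<inter> set xs = set xs" by auto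
  ultimately show "card {b \<in> (A \<union> set xs) \<inter> set xs. d b = Suc t} \<le> 2" by simp
qed

lemma path_through_root:
  assumes xs: "distinct xs" "set xs \<subseteq> V" "pedges xs \<subseteq> bfs" "v \<in> set xs"
  obtains as bs where "xs = rev as @ v # bs" "desc v as" "desc v bs"
proof -
  have "xs \<noteq> []" using xs(4) by auto
  then obtain as z bs where s: "xs = rev as @ z # bs" "desc z as" "desc z bs"
    using bfs_path_shape[OF xs(1) _ xs(2,3)] by blast
  have "v = z" using xs(4) s desc_levels[OF s(2)] desc_levels[OF s(3)] by auto
  then show ?thesis using that s by blast
qed

text \<open>
  If \<open>v\<close> is on the path, then the fire can enter \<open>A\<close> also through the neighbours of \<open>v\<close> in \<open>A\<close>; these and
  the path neighbours of \<open>v\<close> have to be protected in the first round.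
\<close>

lemma save_side_on_path:
  assumes xs: "xs = rev as @ v # bs" "desc v as" "desc v bs"
    and AB: "A \<union> B = V - set xs" "A \<inter> B = {}" and no: "\<And>u w. (u, w) \<in> R \<Longrightarrow> u \<in> A \<Longrightarrow> w \<notin> B"
    and few: "card (nbrs v \<inter> (A \<union> set xs)) \<le> 2"
  shows "card (A \<union> set xs - {v}) \<le> sn 2 G v"
proof (rule save_by_levels[where N = "set xs \<union> nbrs v"])
  have xsV: "set xs \<subseteq> V" using desc_levels[OF xs(2)] desc_levels[OF xs(3)] v_V by (auto simp: xs(1))
  show "A \<union> set xs - {v} \<subseteq> V" "v \<notin> A \<union> set xs - {v}" using xsV AB by auto
next
  fix u b assume h: "(u, b) \<in> R" "u \<notin> A \<union> set xs - {v}" "b \<in> A \<union> set xs - {v}"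
  show "b \<in> set xs \<union> nbrs v"
  proof (cases "u = v")
    case True then show ?thesis using h(1) by (simp add: nbrs_def)
  next
    case False
    then have "u \<in> B" using h R_V AB by auto
    then show ?thesis using no[of b u] sym_R[OF h(1)] h(3) by auto
  qed
next
  fix t
  let ?S = "{b \<in> (A \<union> set xs - {v}) \<inter> (set xs \<union> nbrs v). d b = Suc t}"
  show "card ?S \<le> 2"
  proof (cases "t = 0")
    case True
    have "set xs \<subseteq> V" using desc_levels[OF xs(2)] desc_levels[OF xs(3)] v_V by (auto simp: xs(1))
    then have "?S \<subseteq> nbrs v \<inter> (A \<union> set xs)" using True nbrs_d nbrs_V AB by auto
    then have "card ?S \<le> card (nbrs v \<inter> (A \<union> set xs))" using finite_nbrs by (intro card_mono) auto
    then show ?thesis using few by simp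
  next
    case False
    have inj: "inj_on d (set as)" "inj_on d (set bs)" using desc_levels[OF xs(2)] desc_levels[OF xs(3)] by auto
    have "?S \<subseteq> {b \<in> set as \<union> set bs. d b = Suc t}" using False nbrs_d by (auto simp: xs(1))
    then have "card ?S \<le> card {b \<in> set as \<union> set bs. d b = Suc t}" by (intro card_mono) auto
    then show ?thesis using level_le_2[OF inj, of "Suc t"] by simp
  qed
qed

text \<open>
  The neighbours \<open>l\<close> and \<open>a\<close> are protected first, and the fire spreads to \<open>k\<close> and \<open>b\<close>. Every geodesic to the half
  \<open>l # as\<close> of the path runs through \<open>l\<close>, so the fire comes to this half one round late, and the vertices
  of \<open>as\<close> may be protected one round after their distance. This leaves room in the second round for the
  neighbours of \<open>k\<close> in \<open>A\<close>: for one of them next to the successor of \<open>k\<close> on the path, and for two if the path ends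
  at \<open>k\<close>.
\<close>

lemma save_side_delayed:
  assumes xs: "xs = rev (l # as) @ v # k # bs" "desc v (l # as)" "desc v (k # bs)" "distinct xs"
    and AB: "A \<union> B = V - set xs" "A \<inter> B = {}" and no: "\<And>u w. (u, w) \<in> R \<Longrightarrow> u \<in> A \<Longrightarrow> w \<notin> B"
    and nb: "nbrs v = {k, l, a, b}" and ab: "a \<in> A" "b \<in> B"
    and delay: "\<And>x. x \<in> set as \<Longrightarrow> starts x = {l}"
    and leak: "card (nbrs k \<inter> A) \<le> (if bs = [] then 2 else 1)"
  shows "card (A \<union> set xs - {v, k}) \<le> sn 2 G v"
proof -
  let ?X = "A \<union> set xs - {v, k}"
  have la: "desc l as" and kb: "desc k bs" using xs(2,3) by auto
  have lk: "l \<in> V" "k \<in> V" "l \<noteq> v" "k \<noteq> v" using xs(2,3) by auto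
  have dl: "d l = 1" "d k = 1" using nb nbrs_d by auto
  note L = desc_levels[OF la] desc_levels[OF kb]
  have asd: "d x \<ge> 2" if "x \<in> set as" for x using L(1) that dl by force
  have bsd: "d x \<ge> 2" if "x \<in> set bs" for x using L(2) that dl by force
  have dis: "l \<noteq> k" "l \<notin> set as" "l \<notin> set bs" "k \<notin> set as" "k \<notin> set bs" "v \<notin> set as" "v \<notin> set bs" "set as \<inter> set bs = {}"
    using xs(4) by (auto simp: xs(1))
  have setxs: "set xs = {l, v, k} \<union> set as \<union> set bs" by (auto simp: xs(1))
  define leaks where "leaks = nbrs k \<inter> A - {a}"
  define \<tau> where "\<tau> x = (if x = l \<or> x = a then 1 else if x \<in> set as then Suc (d x) else if x \<in> set bs then d x
      else if x \<in> leaks then 2 else 0)" for x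
  show ?thesis
  proof (rule sn_ge_schedule[where \<tau> = \<tau>])
    show "finite V" by (rule finite_V)
    have "set xs \<subseteq> V" unfolding setxs using lk L v_V by auto
    moreover have "A \<subseteq> V" using AB(1) by blast
    ultimately show "?X \<subseteq> V" by blast
    show "v \<notin> ?X" by simp
  next
    fix t
    let ?S = "{x \<in> ?X. \<tau> x = Suc t}"
    consider "t = 0" | "t = 1" | "t \<ge> 2" by linarith
    then show "card ?S \<le> 2"
    proof cases
      case 1
      have "?S \<subseteq> {l, a}"
      proof
        fix x assume "x \<in> ?S"
        then have "\<tau> x = 1" using 1 by simp
        then show "x \<in> {l, a}" using asd[of x] bsd[of x] by (auto simp: \<tau>_def split: if_splits)
      qed
      then have "card ?S \<le> card {l, a}" by (intro card_mono) auto
      then show ?thesis by (simp add: card_insert_if split: if_splits)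
    next
      case 2
      have "?S \<subseteq> {x \<in> set bs. d x = 2} \<union> (nbrs k \<inter> A)"
      proof
        fix x assume "x \<in> ?S"
        then have "\<tau> x = 2" using 2 by simp
        then show "x \<in> {x \<in> set bs. d x = 2} \<union> (nbrs k \<inter> A)"
          using asd[of x] by (auto simp: \<tau>_def leaks_def split: if_splits)
      qed
      then have "card ?S \<le> card ({x \<in> set bs. d x = 2} \<union> (nbrs k \<inter> A))"
        using finite_nbrs by (intro card_mono) auto
      also have "\<dots> \<le> card {x \<in> set bs. d x = 2} + card (nbrs k \<inter> A)" by (rule card_Un_le)
      also have "\<dots> \<le> 2"
      proof (cases "bs = []")
        case True then show ?thesis using leak by simp
      next
        case False
        have "card {x \<in> set bs. d x = 2} \<le> 1" using level_le_1 L(2) by blast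
        then show ?thesis using leak False by simp
      qed
      finally show ?thesis .
    next
      case 3
      have "?S \<subseteq> {x \<in> set as. d x = t} \<union> {x \<in> set bs. d x = Suc t}"
      proof
        fix x assume "x \<in> ?S"
        then have "\<tau> x = Suc t" by simp
        then show "x \<in> {x \<in> set as. d x = t} \<union> {x \<in> set bs. d x = Suc t}"
          using 3 by (auto simp: \<tau>_def split: if_splits)
      qed
      then have "card ?S \<le> card ({x \<in> set as. d x = t} \<union> {x \<in> set bs. d x = Suc t})" by (intro card_mono) auto
      also have "\<dots> \<le> card {x \<in> set as. d x = t} + card {x \<in> set bs. d x = Suc t}" by (rule card_Un_le)
      also have "\<dots> \<le> 1 + 1" using level_le_1 L by (intro add_mono) blast+
      finally show ?thesis by simp
    qed
  next
    fix n u y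
    assume h: "(v, u) \<in> (R \<inter> (- ?X) \<times> (- ?X)) ^^ n" "u \<notin> ?X" "(u, y) \<in> R" "y \<in> ?X"
    have uV: "u \<in> V" using h(3) R_V by auto
    have walk: "(v, u) \<in> R ^^ n" by (rule walk_restrict[OF h(1)])
    then have walky: "(v, y) \<in> R ^^ Suc n" using h(3) by auto
    have dy: "d y \<le> Suc n" by (rule d_le[OF walky])
    have u: "u = v \<or> u = k \<or> u \<in> B" using h(2) uV AB(1) by blast
    have "y = l \<or> y \<in> set as \<or> y \<in> set bs \<or> y \<in> A" using h(4) unfolding setxs by blast
    then consider "y = l \<or> y = a" | "y \<in> set as" "y \<noteq> l" "y \<noteq> a" | "y \<in> set bs" "y \<notin> set as" "y \<noteq> l" "y \<noteq> a"
      | "y \<in> A" "y \<noteq> a" "y \<noteq> l" "y \<notin> set as" "y \<notin> set bs" by blast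
    then show "1 \<le> \<tau> y \<and> \<tau> y \<le> Suc n"
    proof cases
      case 1 then show ?thesis by (auto simp: \<tau>_def)
    next
      case 2
      \<comment> \<open>A walk of length \<open>d y\<close> would be a geodesic that starts with \<open>l\<close>, but \<open>l\<close> is in the saved set.\<close>
      have "d y \<noteq> Suc n"
      proof
        assume dn: "d y = Suc n"
        then have "n \<noteq> 0" using asd[OF 2(1)] by simp
        then obtain m where m: "n = Suc m" by (cases n) auto
        then obtain w where w: "(v, w) \<in> R \<inter> (- ?X) \<times> (- ?X)" "(w, u) \<in> (R \<inter> (- ?X) \<times> (- ?X)) ^^ m"
          using h(1) by (metis relpow_Suc_D2)
        have "(w, y) \<in> R ^^ n" using walk_restrict[OF w(2)] h(3) m by auto
        then have "w \<in> starts y" using w(1) dn by (auto simp: starts_def)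
        then have "w = l" using delay[OF 2(1)] by simp
        moreover have "l \<in> ?X" unfolding setxs using lk(3) dis(1) by blast
        ultimately show False using w(1) by auto
      qed
      then show ?thesis using 2 dy by (simp add: \<tau>_def)
    next
      case 3 then show ?thesis using dy bsd[OF 3(1)] by (simp add: \<tau>_def)
    next
      case 4
      have "u \<notin> B" using no[OF sym_R[OF h(3)] 4(1)] .
      moreover have "u \<noteq> v"
      proof
        assume "u = v"
        then have "y \<in> {k, l, a, b}" using h(3) unfolding nb[symmetric] by (simp add: nbrs_def)
        then show False using 4(1-3) h(4) ab(2) AB(2) by blast
      qed
      ultimately have "u = k" using u by blast
      then have "y \<in> leaks" using h(3) 4 by (simp add: leaks_def nbrs_def)
      moreover have "n \<noteq> 0" using walk \<open>u = k\<close> lk by (cases n) auto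
      ultimately show ?thesis using 4 by (simp add: \<tau>_def)
    qed
  qed
qed

lemma succ_pedges: "successively (\<lambda>a b. (a, b) \<in> R) xs \<Longrightarrow> pedges xs \<subseteq> edges G"
  by (induction xs rule: pedges.induct) (auto simp: edge_iff)

text \<open>
  Let \<open>y\<close> be the first vertex of the half \<open>l # as\<close> that a geodesic through \<open>b\<close> reaches. Before \<open>y\<close> this geodesic
  \<open>qs\<close> meets no vertex of the path: none of \<open>l # as\<close> by the choice of \<open>y\<close>, and none of \<open>k # bs'\<close>, since
  otherwise a geodesic to \<open>y\<close> would start with the preferred neighbour \<open>k\<close>. So \<open>qs\<close> runs through \<open>B\<close> and
  splits it. Both parts are bounded by two geodesics from \<open>v\<close> and contain no neighbour of \<open>v\<close>, so each can be
  saved, and the larger one is at least half of \<open>B\<close> and the path.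
\<close>

lemma save_half_side:
  assumes xs: "xs = rev (l # as) @ v # bs" "desc v (l # as)" "desc v bs" "distinct xs"
    and AB: "A \<union> B = V - set xs" "A \<inter> B = {}" and no: "\<And>u w. (u, w) \<in> R \<Longrightarrow> u \<in> A \<Longrightarrow> w \<notin> B"
    and nB: "nbrs v \<inter> B = {b}" and kb: "bs = k # bs'" "rk k < rk l"
    and split: "splits_along (edges G) (rev xs) B"
    and y: "y \<in> set (l # as)" "b \<in> starts y"
  shows "card (B \<union> set xs - {v}) \<le> 2 * sn 2 G v"
proof -
  have ex: "\<exists>x\<in>set (l # as). b \<in> starts x" using y by blast
  obtain as1 y as2 where ys: "l # as = as1 @ y # as2" "b \<in> starts y" "\<forall>x\<in>set as1. b \<notin> starts x"
    using split_list_first_propE[OF ex] by metis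
  have bb: "b \<in> nbrs v" "b \<in> B" using nB by auto
  have lbest: "best x = rk l" if "x \<in> set (l # as)" for x using desc_best[OF xs(2) that] by simp
  have kbest: "best x = rk k" if "x \<in> set bs" for x using desc_best[of k bs' x] xs(3) kb that by simp
  have L: "\<forall>y\<in>set (l # as). 0 < d y" "inj_on d (set (l # as))" "distinct (l # as)" "set (l # as) \<subseteq> V - {v}"
    using desc_levels[OF xs(2), unfolded d_v] by blast+
  have M: "\<forall>y\<in>set bs. 0 < d y" "inj_on d (set bs)" "set bs \<subseteq> V - {v}"
    using desc_levels[OF xs(3), unfolded d_v] by blast+
  have setxs: "set xs = set as1 \<union> {y} \<union> set as2 \<union> {v} \<union> set bs" unfolding xs(1) ys(1) by auto
  have yin: "y \<in> set (l # as)" "set as1 \<subseteq> set (l # as)" "set as2 \<subseteq> set (l # as)" unfolding ys(1) by auto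
  have dy: "desc v as1" "desc y as2" using xs(2) unfolding ys(1) desc_append by simp_all
  have as2y: "\<forall>x\<in>set as2. d y < d x" using desc_levels[OF dy(2)] by simp
  have kn: "k \<notin> starts y"
  proof
    assume "k \<in> starts y"
    then show False using best_le[of k y] lbest[OF yin(1)] kb(2) by simp
  qed
  obtain qs where qs: "hd (qs @ [y]) = b" "\<forall>q\<in>set qs. b \<in> starts q \<and> starts q \<subseteq> starts y \<and> d q < d y \<and> q \<in> V"
    "inj_on d (set qs)" "distinct qs" "successively (\<lambda>a b. (a, b) \<in> R) (v # qs @ [y])"
    using starts_geodesic[OF ys(2)] by blast
  have bxs: "b \<notin> set xs" using bb(2) AB(1) by blast
  have "y \<noteq> b" using bxs setxs by blast
  then have qne: "qs \<noteq> []" using qs(1) by auto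
  then have hdq: "hd qs = b" using qs(1) by simp
  have qxs: "q \<notin> set xs" if q: "q \<in> set qs" for q
  proof
    assume qin: "q \<in> set xs"
    have q': "b \<in> starts q" "starts q \<subseteq> starts y" "d q < d y" using qs(2) q by auto
    consider "q \<in> set as1" | "q = y" | "q \<in> set as2" | "q = v" | "q \<in> set bs" using qin unfolding setxs by blast
    then show False
    proof cases
      case 1 then show ?thesis using ys(3) q'(1) by blast
    next
      case 2 then show ?thesis using q'(3) by simp
    next
      case 3 then show ?thesis using as2y q'(3) by fastforce
    next
      case 4 then show ?thesis using q'(1) by (simp add: starts_def)
    next
      case 5
      then have "q \<in> V" "q \<noteq> v" using M(3) by auto
      then obtain w where w: "w \<in> starts q" "best q = rk w" using best_in by blast
      have "rk w = rk k" using w(2) kbest[OF 5] by simp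
      moreover have "w \<in> nbrs v" using w(1) starts_sub by blast
      moreover have "k \<in> nbrs v" using desc_best[of k bs' k] xs(3) kb(1) by (simp add: nbrs_def)
      ultimately have "w = k" using rk_inj by (auto simp: nbrs_def dest: inj_onD)
      then show ?thesis using w(1) q'(2) kn by blast
    qed
  qed
  have qB: "set qs \<subseteq> B"
  proof -
    have "set zs \<subseteq> B" if "successively (\<lambda>a b. (a, b) \<in> R) zs" "hd zs \<in> B" "\<forall>q\<in>set zs. q \<in> V - set xs" for zs
      using that
    proof (induction zs rule: pedges.induct)
      case (1 x y zs)
      have "y \<in> A \<union> B" using 1(4) AB(1) by simp
      moreover have "y \<notin> A" using no[of y x] sym_R[of x y] 1(2,3) by auto
      ultimately show ?case using 1 by auto
    qed auto
    moreover have "successively (\<lambda>a b. (a, b) \<in> R) qs"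
      using qs(5) by (simp add: successively_Cons successively_append_iff)
    ultimately show ?thesis using hdq bb(2) qs(2) qxs by blast
  qed
  have pq: "pedges (v # qs @ [y]) \<subseteq> edges G" using succ_pedges[OF qs(5)] .
  \<comment> \<open>read backwards, the path meets \<open>v\<close> before \<open>y\<close>\<close>
  have revxs: "rev xs = rev bs @ v # as1 @ y # as2" unfolding xs(1) ys(1) by simp
  obtain D1 D2 where D: "D1 \<union> D2 = B - set qs" "D1 \<inter> D2 = {}"
    "\<forall>u w. {u, w} \<in> edges G \<longrightarrow> u \<in> D1 \<longrightarrow> w \<in> D1 \<union> set qs \<union> set (v # as1 @ [y])"
    "\<forall>u w. {u, w} \<in> edges G \<longrightarrow> u \<in> D2 \<longrightarrow> w \<in> D2 \<union> set qs \<union> set (rev bs @ [v]) \<union> set (y # as2)"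
    using split[unfolded splits_along_def, rule_format, OF revxs qne qs(4) qB pq] by blast
  have nD: "nbrs v \<inter> (D1 \<union> D2) = {}"
  proof -
    have "b \<in> set qs" using hdq qne hd_in_set by blast
    then have "b \<notin> D1 \<union> D2" unfolding D(1) by simp
    moreover have "nbrs v \<inter> (D1 \<union> D2) \<subseteq> {b}" unfolding D(1) nB[symmetric] by auto
    ultimately show ?thesis by auto
  qed
  have qV: "set qs \<subseteq> V" and DV: "D1 \<union> D2 \<subseteq> V - set xs" using qs(2) D(1) AB(1) by auto
  have vq: "v \<notin> set qs" using qxs[of v] setxs by blast
  let ?X1 = "D1 \<union> set qs \<union> set as1 \<union> {y}"
  let ?X2 = "D2 \<union> set qs \<union> set bs \<union> {y} \<union> set as2"
  have injas: "inj_on d (set as1)" using L(2) yin(2) inj_on_subset by blast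
  have injy: "inj_on d (insert y (set qs))"
  proof -
    have "d y \<notin> d ` (set qs - {y})" using qs(2) by auto
    then show ?thesis using qs(3) by (simp add: inj_on_insert)
  qed
  have c1: "card ?X1 \<le> sn 2 G v"
  proof (rule save_by_levels[where N = "set qs \<union> set as1 \<union> {y}"])
    show "?X1 \<subseteq> V" using qV DV yin L(4) by blast
    show "v \<notin> ?X1" using vq DV setxs yin L(4) by blast
  next
    fix u b' assume h: "(u, b') \<in> R" "u \<notin> ?X1" "b' \<in> ?X1"
    show "b' \<in> set qs \<union> set as1 \<union> {y}"
    proof (rule ccontr)
      assume "b' \<notin> set qs \<union> set as1 \<union> {y}"
      then have b': "b' \<in> D1" using h(3) by blast
      have "{b', u} \<in> edges G" using sym_R[OF h(1)] edge_iff by blast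
      then have "u \<in> D1 \<union> set qs \<union> set (v # as1 @ [y])" using D(3) b' by blast
      then have "u = v" using h(2) by auto
      then have "b' \<in> nbrs v" using h(1) by (simp add: nbrs_def)
      then show False using nD b' by blast
    qed
  next
    fix t
    have "?X1 \<inter> (set qs \<union> set as1 \<union> {y}) = insert y (set qs) \<union> set as1" by auto
    then show "card {b \<in> ?X1 \<inter> (set qs \<union> set as1 \<union> {y}). d b = Suc t} \<le> 2"
      using level_le_2[OF injy injas, of "Suc t"] by simp
  qed
  have injy2: "inj_on d (insert y (set qs) \<union> set as2)"
  proof -
    have "inj_on d (set as2)" using L(2) yin(3) inj_on_subset by blast
    moreover have "d ` insert y (set qs) \<inter> d ` set as2 = {}" using qs(2) as2y by fastforce
    ultimately show ?thesis using injy by (auto simp: inj_on_Un)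
  qed
  have c2: "card ?X2 \<le> sn 2 G v"
  proof (rule save_by_levels[where N = "set qs \<union> set bs \<union> {y} \<union> set as2"])
    show "?X2 \<subseteq> V" using qV DV yin L(4) M(3) by blast
    show "v \<notin> ?X2" using vq DV setxs yin L(4) M(3) by blast
  next
    fix u b' assume h: "(u, b') \<in> R" "u \<notin> ?X2" "b' \<in> ?X2"
    show "b' \<in> set qs \<union> set bs \<union> {y} \<union> set as2"
    proof (rule ccontr)
      assume "b' \<notin> set qs \<union> set bs \<union> {y} \<union> set as2"
      then have b': "b' \<in> D2" using h(3) by blast
      have "{b', u} \<in> edges G" using sym_R[OF h(1)] edge_iff by blast
      then have "u \<in> D2 \<union> set qs \<union> set (rev bs @ [v]) \<union> set (y # as2)" using D(4) b' by blast
      then have "u = v" using h(2) by auto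
      then have "b' \<in> nbrs v" using h(1) by (simp add: nbrs_def)
      then show False using nD b' by blast
    qed
  next
    fix t
    have "?X2 \<inter> (set qs \<union> set bs \<union> {y} \<union> set as2) = (insert y (set qs) \<union> set as2) \<union> set bs" by auto
    then show "card {b \<in> ?X2 \<inter> (set qs \<union> set bs \<union> {y} \<union> set as2). d b = Suc t} \<le> 2"
      using level_le_2[OF injy2 M(2), of "Suc t"] by simp
  qed
  have "B \<union> set xs - {v} \<subseteq> ?X1 \<union> ?X2" using D(1) unfolding setxs by blast
  moreover have "finite (?X1 \<union> ?X2)"
  proof (rule finite_subset[OF _ finite_V])
    show "?X1 \<union> ?X2 \<subseteq> V" using qV DV yin L(4) M(3) by blast
  qed
  ultimately have "card (B \<union> set xs - {v}) \<le> card (?X1 \<union> ?X2)" by (rule card_mono[rotated])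
  also have "\<dots> \<le> card ?X1 + card ?X2" by (rule card_Un_le)
  finally show ?thesis using c1 c2 by simp
qed

definition sides :: "'a list \<Rightarrow> 'a set \<Rightarrow> 'a set \<Rightarrow> bool" where
  "sides xs A B \<longleftrightarrow> distinct xs \<and> set xs \<subseteq> V \<and> pedges xs \<subseteq> bfs \<and> length xs \<ge> 2 \<and>
     A \<union> B = V - set xs \<and> A \<inter> B = {} \<and> (\<forall>u w. (u, w) \<in> R \<longrightarrow> u \<in> A \<longrightarrow> w \<notin> B) \<and>
     3 * card (A - {v}) \<le> 2 * (card V - 1) \<and> 3 * card (B - {v}) \<le> 2 * (card V - 1) \<and>
     splits_along (edges G) xs A \<and> splits_along (edges G) (rev xs) A \<and>
     splits_along (edges G) xs B \<and> splits_along (edges G) (rev xs) B"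

lemma ex_sides: "separable V (edges G) v \<Longrightarrow> \<exists>xs A B. sides xs A B"
  unfolding separable_def sides_def using bfs_spanning bfs_edges by (simp add: edge_iff)

lemma sides_swap: "sides xs A B \<Longrightarrow> sides xs B A"
  unfolding sides_def using sym_R by blast

lemma sides_rev: "sides xs A B \<Longrightarrow> sides (rev xs) A B"
  unfolding sides_def by simp

lemma card_complement:
  assumes "A \<union> B = V - set xs" "A \<inter> B = {}" "set xs \<subseteq> V"
  shows "A \<union> set xs = V - B" "finite B" "B \<subseteq> V" "card (A \<union> set xs) = card V - card B" "card B \<le> card V"
proof -
  show "A \<union> set xs = V - B" using assms by blast
  moreover show "B \<subseteq> V" using assms by blast
  ultimately show "finite B" "card (A \<union> set xs) = card V - card B" "card B \<le> card V"
    using finite_V finite_subset card_Diff_subset card_mono by metis+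
qed

lemma sides_off_path:
  assumes "sides xs A B" "v \<notin> set xs"
  shows "card V - 1 \<le> 3 * sn 2 G v"
proof -
  have "card V - 1 \<le> 3 * sn 2 G v" if s: "sides xs A B" and v: "v \<in> B" for A B
  proof -
    have s': "distinct xs" "set xs \<subseteq> V" "pedges xs \<subseteq> bfs" "xs \<noteq> []" "A \<union> B = V - set xs" "A \<inter> B = {}"
      "\<And>u w. (u, w) \<in> R \<Longrightarrow> u \<in> A \<Longrightarrow> w \<notin> B" "3 * card (B - {v}) \<le> 2 * (card V - 1)"
      using s by (auto simp: sides_def)
    note cc = card_complement[OF s'(5,6,2)]
    have "card (V - B) \<le> sn 2 G v" using save_side_off_path[OF s'(1-7) v] cc(1) by simp
    moreover have "card (V - B) = card V - card B" using cc by metis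
    moreover have "card (B - {v}) = card B - 1" using v cc(2) by simp
    moreover have "card B > 0" using v cc(2) card_gt_0_iff by blast
    ultimately show ?thesis using s'(8) cc(5) by linarith
  qed
  moreover have "v \<in> A \<or> v \<in> B" using assms v_V unfolding sides_def by blast
  ultimately show ?thesis using assms(1) sides_swap by blast
qed

lemma sides_on_path:
  assumes s: "sides xs A B" and v: "v \<in> set xs" and few: "card (nbrs v \<inter> (A \<union> set xs)) \<le> 2"
  shows "card V - 1 \<le> 3 * sn 2 G v"
proof -
  have s': "distinct xs" "set xs \<subseteq> V" "pedges xs \<subseteq> bfs" "A \<union> B = V - set xs" "A \<inter> B = {}"
    "\<And>u w. (u, w) \<in> R \<Longrightarrow> u \<in> A \<Longrightarrow> w \<notin> B" "3 * card (B - {v}) \<le> 2 * (card V - 1)"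
    using s by (auto simp: sides_def)
  note cc = card_complement[OF s'(4,5,2)]
  obtain as bs where sh: "xs = rev as @ v # bs" "desc v as" "desc v bs"
    using path_through_root[OF s'(1-3) v] by blast
  have "card (A \<union> set xs - {v}) \<le> sn 2 G v" by (rule save_side_on_path[OF sh s'(4-6) few])
  moreover have "card (A \<union> set xs - {v}) = card (A \<union> set xs) - 1" using v by simp
  moreover have "v \<notin> B" using s'(4) v by blast
  then have "card (B - {v}) = card B" by simp
  ultimately show ?thesis using s'(7) cc(4,5) by linarith
qed

lemma nbrs_split:
  assumes "sides xs A B"
  shows "card (nbrs v) = card (nbrs v \<inter> A) + card (nbrs v \<inter> B) + card (nbrs v \<inter> set xs)"
    "card (nbrs v \<inter> (A \<union> set xs)) = card (nbrs v \<inter> A) + card (nbrs v \<inter> set xs)"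
    "card (nbrs v \<inter> (B \<union> set xs)) = card (nbrs v \<inter> B) + card (nbrs v \<inter> set xs)"
proof -
  have AB: "A \<union> B = V - set xs" "A \<inter> B = {}" using assms by (auto simp: sides_def)
  have f: "finite (nbrs v \<inter> S)" for S using finite_nbrs by simp
  show 2: "card (nbrs v \<inter> (A \<union> set xs)) = card (nbrs v \<inter> A) + card (nbrs v \<inter> set xs)"
    unfolding Int_Un_distrib using AB f by (intro card_Un_disjoint) auto
  show "card (nbrs v \<inter> (B \<union> set xs)) = card (nbrs v \<inter> B) + card (nbrs v \<inter> set xs)"
    unfolding Int_Un_distrib using AB f by (intro card_Un_disjoint) auto
  have "nbrs v = (nbrs v \<inter> (A \<union> set xs)) \<union> (nbrs v \<inter> B)" using nbrs_V AB by blast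
  moreover have "(nbrs v \<inter> (A \<union> set xs)) \<inter> (nbrs v \<inter> B) = {}" using AB by blast
  ultimately have "card (nbrs v) = card (nbrs v \<inter> (A \<union> set xs)) + card (nbrs v \<inter> B)"
    using f card_Un_disjoint by metis
  then show "card (nbrs v) = card (nbrs v \<inter> A) + card (nbrs v \<inter> B) + card (nbrs v \<inter> set xs)" using 2 by simp
qed

lemma nbrs_on_path:
  assumes "xs = rev as @ v # bs" "desc v as" "desc v bs"
  shows "nbrs v \<inter> set xs = set (take 1 as) \<union> set (take 1 bs)"
proof -
  have one: "x \<in> nbrs v \<longleftrightarrow> x \<in> set (take 1 ys)" if ys: "desc v ys" "x \<in> set ys" for ys x
  proof (cases ys)
    case Nil then show ?thesis using ys by simp
  next
    case (Cons y zs)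
    have y: "d y = 1" "y \<in> V" using ys(1) Cons par(2)[of y] by auto
    show ?thesis
    proof (cases "x = y")
      case True then show ?thesis using Cons y nbrs_d by simp
    next
      case False
      then have "x \<in> set zs" using ys(2) Cons by simp
      then have "d x \<noteq> 1" using desc_levels[of y zs] ys(1) Cons y(1) by fastforce
      then show ?thesis using False Cons nbrs_d[of x] by simp
    qed
  qed
  have "v \<notin> nbrs v" using nbrs_d by simp
  moreover have "set (take 1 as) \<subseteq> set as" "set (take 1 bs) \<subseteq> set bs" by (rule set_take_subset)+
  ultimately show ?thesis using one[OF assms(2)] one[OF assms(3)] by (auto simp: assms(1))
qed

lemma card_nbrs_on_path:
  assumes "xs = rev as @ v # bs" "desc v as" "desc v bs" "length xs \<ge> 2"
  shows "1 \<le> card (nbrs v \<inter> set xs)" "card (nbrs v \<inter> set xs) \<le> 2"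
proof -
  note nx = nbrs_on_path[OF assms(1-3)]
  have "nbrs v \<inter> set xs \<noteq> {}" unfolding nx using assms(1,4) by (cases as; cases bs) auto
  then show "1 \<le> card (nbrs v \<inter> set xs)" using finite_nbrs by (simp add: Suc_le_eq card_gt_0_iff)
  have "card (set (take 1 as) \<union> set (take 1 bs)) \<le> card (set (take 1 as)) + card (set (take 1 bs))" by (rule card_Un_le)
  also have "\<dots> \<le> 1 + 1" using card_length[of "take 1 as"] card_length[of "take 1 bs"] by (intro add_mono) auto
  finally show "card (nbrs v \<inter> set xs) \<le> 2" unfolding nx by simp
qed

text \<open>
  The path contains a neighbour of \<open>v\<close>. If it contains two, the third one is missing on one of the sides;
  if it contains one, then one of the sides has at most one of the two others.
\<close>

theorem save_degree_3:
  assumes sep: "separable V (edges G) v" and deg: "card (nbrs v) \<le> 3"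
  shows "card V - 1 \<le> 3 * sn 2 G v"
proof -
  obtain xs A B where s: "sides xs A B" using ex_sides[OF sep] by blast
  show ?thesis
  proof (cases "v \<in> set xs")
    case False then show ?thesis by (rule sides_off_path[OF s])
  next
    case True
    have s': "distinct xs" "set xs \<subseteq> V" "pedges xs \<subseteq> bfs" "length xs \<ge> 2" using s by (auto simp: sides_def)
    obtain as bs where sh: "xs = rev as @ v # bs" "desc v as" "desc v bs"
      using path_through_root[OF s'(1-3) True] by blast
    note card_nbrs_on_path[OF sh s'(4)]
    then have "card (nbrs v \<inter> (A \<union> set xs)) \<le> 2 \<or> card (nbrs v \<inter> (B \<union> set xs)) \<le> 2"
      using nbrs_split[OF s] deg by presburger
    then show ?thesis using sides_on_path[OF s True] sides_on_path[OF sides_swap[OF s] True] by blast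
  qed
qed

text \<open>
  Unless \<open>save_half_side\<close> applies to one of the sides, all geodesics to the half below \<open>l\<close> start with \<open>l\<close>. Of the at
  most five neighbours of \<open>k\<close> one is \<open>v\<close> and, if the path goes on, one is on the path. The others can be more
  than \<open>save_side_delayed\<close> allows on at most one of the two sides.
\<close>

lemma save_opposite:
  assumes s: "sides xs A B" and xs: "xs = rev (l # as) @ v # k # bs" "desc v (l # as)" "desc v (k # bs)"
    and nA: "nbrs v \<inter> A = {a}" and nB: "nbrs v \<inter> B = {b}" and r: "rk k < rk l" and deg: "card (nbrs k) \<le> 5"
  shows "card V - 1 \<le> 6 * sn 2 G v \<or> card V - 1 \<le> 3 * sn 2 G v + 3"
proof -
  have s': "distinct xs" "set xs \<subseteq> V" "A \<union> B = V - set xs" "A \<inter> B = {}"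
    "\<And>u w. (u, w) \<in> R \<Longrightarrow> u \<in> A \<Longrightarrow> w \<notin> B" "\<And>u w. (u, w) \<in> R \<Longrightarrow> u \<in> B \<Longrightarrow> w \<notin> A"
    "3 * card (A - {v}) \<le> 2 * (card V - 1)" "3 * card (B - {v}) \<le> 2 * (card V - 1)"
    "splits_along (edges G) (rev xs) A" "splits_along (edges G) (rev xs) B"
    using s sides_swap[OF s] by (auto simp: sides_def)
  have BA: "B \<union> A = V - set xs" "B \<inter> A = {}" using s'(3,4) by auto
  note ccB = card_complement[OF s'(3,4,2)] and ccA = card_complement[OF BA s'(2)]
  have vxs: "v \<in> set xs" by (simp add: xs(1))
  have vn: "v \<notin> A" "v \<notin> B" using s'(3) vxs by blast+
  have bal: "3 * card A \<le> 2 * (card V - 1)" "3 * card B \<le> 2 * (card V - 1)" using s'(7,8) vn by simp_all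
  have half: "card V - 1 \<le> 6 * sn 2 G v" if "y \<in> set (l # as)" "c \<in> starts y" "c = a \<or> c = b" for y c
  proof (cases "c = b")
    case True
    have "card (B \<union> set xs - {v}) \<le> 2 * sn 2 G v"
      using save_half_side[OF xs s'(1,3,4,5) nB refl r s'(10) that(1)] that(2) True by simp
    moreover have "card (B \<union> set xs - {v}) = card (B \<union> set xs) - 1" using vxs by simp
    ultimately show ?thesis using ccA(4,5) bal by linarith
  next
    case False
    have "card (A \<union> set xs - {v}) \<le> 2 * sn 2 G v"
      using save_half_side[OF xs s'(1) BA s'(6) nA refl r s'(9) that(1)] that(2,3) False by simp
    moreover have "card (A \<union> set xs - {v}) = card (A \<union> set xs) - 1" using vxs by simp
    ultimately show ?thesis using ccB(4,5) bal by linarith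
  qed
  show ?thesis
  proof (cases "\<exists>y\<in>set (l # as). a \<in> starts y \<or> b \<in> starts y")
    case True
    then show ?thesis using half by blast
  next
    case False
    have nb: "nbrs v = {k, l, a, b}"
    proof -
      have "nbrs v = (nbrs v \<inter> A) \<union> (nbrs v \<inter> B) \<union> (nbrs v \<inter> set xs)" using nbrs_V s'(3) by blast
      then show ?thesis unfolding nA nB nbrs_on_path[OF xs] by auto
    qed
    have kn: "k \<notin> starts x" if "x \<in> set (l # as)" for x
    proof
      assume "k \<in> starts x"
      then show False using best_le[of k x] desc_best[OF xs(2) that] r by simp
    qed
    have delay: "starts x = {l}" if x: "x \<in> set as" for x
    proof -
      have "x \<in> V" "x \<noteq> v" using desc_levels[OF xs(2)] x by auto
      then have "starts x \<noteq> {}" by (rule starts_nonempty)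
      moreover have "starts x \<subseteq> {k, l, a, b}" using starts_sub nb by blast
      moreover have "k \<notin> starts x" "a \<notin> starts x" "b \<notin> starts x" using kn[of x] x False by auto
      ultimately show ?thesis by blast
    qed
    have ab: "a \<in> A" "b \<in> B" using nA nB by auto
    have kV: "k \<in> V" "k \<noteq> v" using xs(3) by auto
    have kxs: "k \<in> set xs" by (simp add: xs(1))
    let ?c = "if bs = [] then 2 else 1 :: nat"
    have leak: "card (nbrs k \<inter> A) \<le> ?c \<or> card (nbrs k \<inter> B) \<le> ?c"
    proof -
      have vk: "v \<in> nbrs k" using nb sym_R[of v k] by (auto simp: nbrs_def)
      have rest: "card (nbrs k \<inter> A) + card (nbrs k \<inter> B) + card S \<le> 5"
        if S: "S \<subseteq> nbrs k \<inter> set xs" for S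
      proof -
        have f: "finite (nbrs k \<inter> U)" for U using finite_nbrs by simp
        have fS: "finite S" using S f finite_subset by blast
        have "card (nbrs k \<inter> A \<union> nbrs k \<inter> B) = card (nbrs k \<inter> A) + card (nbrs k \<inter> B)"
          using s'(4) f by (intro card_Un_disjoint) auto
        moreover have "card (nbrs k \<inter> A \<union> nbrs k \<inter> B \<union> S) = card (nbrs k \<inter> A \<union> nbrs k \<inter> B) + card S"
          using S s'(3) f fS by (intro card_Un_disjoint) auto
        moreover have "card (nbrs k \<inter> A \<union> nbrs k \<inter> B \<union> S) \<le> card (nbrs k)"
          using S finite_nbrs by (intro card_mono) auto
        ultimately show ?thesis using deg by simp
      qed
      show ?thesis
      proof (cases bs)
        case Nil
        have "card (nbrs k \<inter> A) + card (nbrs k \<inter> B) \<le> 4" using rest[of "{v}"] vk vxs by simp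
        then have "card (nbrs k \<inter> A) \<le> 2 \<or> card (nbrs k \<inter> B) \<le> 2" by presburger
        then show ?thesis using Nil by simp
      next
        case (Cons c cs)
        have "c \<noteq> v" "c \<in> V" "par c = k" using xs(3) Cons by auto
        then have "c \<in> nbrs k" using par(1)[of c] by (simp add: nbrs_def)
        moreover have "c \<in> set xs" by (simp add: xs(1) Cons)
        ultimately have "card (nbrs k \<inter> A) + card (nbrs k \<inter> B) + card {v, c} \<le> 5"
          using vk vxs by (intro rest) simp
        then have "card (nbrs k \<inter> A) + card (nbrs k \<inter> B) \<le> 3" using \<open>c \<noteq> v\<close> by simp
        then have "card (nbrs k \<inter> A) \<le> 1 \<or> card (nbrs k \<inter> B) \<le> 1" by presburger
        then show ?thesis using Cons by simp
      qed
    qed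
    have fin: "card (Y \<union> set xs - {v, k}) = card (Y \<union> set xs) - 2" for Y
      using vxs kxs kV by (subst card_Diff_subset) auto
    from leak show ?thesis
    proof
      assume "card (nbrs k \<inter> A) \<le> ?c"
      from save_side_delayed[OF xs s'(1,3,4,5) nb ab delay this] have "card (A \<union> set xs - {v, k}) \<le> sn 2 G v" .
      then show ?thesis unfolding fin using ccB(4,5) bal by linarith
    next
      assume le: "card (nbrs k \<inter> B) \<le> ?c"
      have nb': "nbrs v = {k, l, b, a}" using nb by auto
      from save_side_delayed[OF xs s'(1) BA s'(6) nb' ab(2,1) delay le]
      have "card (B \<union> set xs - {v, k}) \<le> sn 2 G v" .
      then show ?thesis unfolding fin using ccA(4,5) bal by linarith
    qed
  qed
qed

text \<open>
  If the path leaves \<open>v\<close> on both sides and separates the other two neighbours from each other, then the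
  neighbour of smaller rank on the path has degree at most 5; in all other cases one side has so few
  neighbours of \<open>v\<close> that the first round suffices.
\<close>

theorem save_degree_4:
  assumes sep: "separable V (edges G) v" and deg: "card (nbrs v) = 4"
    and low: "\<And>k l. k \<in> nbrs v \<Longrightarrow> l \<in> nbrs v \<Longrightarrow> rk k < rk l \<Longrightarrow> card (nbrs k) \<le> 5"
  shows "card V - 1 \<le> 6 * sn 2 G v \<or> card V - 1 \<le> 3 * sn 2 G v + 3"
proof -
  obtain xs A B where s: "sides xs A B" using ex_sides[OF sep] by blast
  show ?thesis
  proof (cases "v \<in> set xs")
    case False then show ?thesis using sides_off_path[OF s] by simp
  next
    case True
    have s': "distinct xs" "set xs \<subseteq> V" "pedges xs \<subseteq> bfs" "length xs \<ge> 2" using s by (auto simp: sides_def)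
    obtain as bs where sh: "xs = rev as @ v # bs" "desc v as" "desc v bs"
      using path_through_root[OF s'(1-3) True] by blast
    note nx = nbrs_on_path[OF sh]
    show ?thesis
    proof (cases "card (nbrs v \<inter> (A \<union> set xs)) \<le> 2 \<or> card (nbrs v \<inter> (B \<union> set xs)) \<le> 2")
      case True
      then have "card V - 1 \<le> 3 * sn 2 G v"
        using sides_on_path[OF s \<open>v \<in> set xs\<close>] sides_on_path[OF sides_swap[OF s] \<open>v \<in> set xs\<close>] by blast
      then show ?thesis by simp
    next
      case False
      note ge = card_nbrs_on_path(1)[OF sh s'(4)] and le = card_nbrs_on_path(2)[OF sh s'(4)]
      have c: "card (nbrs v \<inter> set xs) = 2" "card (nbrs v \<inter> A) = 1" "card (nbrs v \<inter> B) = 1"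
        using nbrs_split[OF s] deg False ge le by linarith+
      obtain a b where ab: "nbrs v \<inter> A = {a}" "nbrs v \<inter> B = {b}" using c(2,3) by (meson card_1_singletonE)
      obtain l as' k bs' where lk: "as = l # as'" "bs = k # bs'"
        using c(1) unfolding nx by (cases as; cases bs) auto
      have lkn: "l \<in> nbrs v" "k \<in> nbrs v" using nx lk by auto
      have "l \<noteq> k" using s'(1) sh(1) lk by auto
      then have "rk l \<noteq> rk k" using rk_inj lkn by (auto simp: nbrs_def dest: inj_onD)
      then consider "rk k < rk l" | "rk l < rk k" by linarith
      then show ?thesis
      proof cases
        case 1
        show ?thesis
          using save_opposite[OF s sh(1)[unfolded lk] _ _ ab 1 low[OF lkn(2,1) 1]] sh(2,3) lk by blast
      next
        case 2
        have "rev xs = rev (k # bs') @ v # l # as'" using sh(1) lk by simp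
        then show ?thesis
          using save_opposite[OF sides_rev[OF s] _ _ _ ab 2 low[OF lkn 2]] sh(2,3) lk by blast
      qed
    qed
  qed
qed

end

section \<open>Discharging\<close>

locale separable_graph =
  fixes G :: "'a pair_pre_digraph"
  assumes fire: "v \<in> pverts G \<Longrightarrow> fire_graph (pverts G) (parcs G) v"
    and sep: "v \<in> pverts G \<Longrightarrow> separable (pverts G) (edges G) v"
    and two: "card (pverts G) \<ge> 2"
begin

definition nb :: "'a \<Rightarrow> 'a set" where "nb u = {w. (u, w) \<in> parcs G}"
definition deg :: "'a \<Rightarrow> nat" where "deg u = card (nb u)"
definition high :: "'a \<Rightarrow> bool" where "high u \<longleftrightarrow> deg u \<ge> 6"
definition crowded :: "'a \<Rightarrow> bool" where "crowded u \<longleftrightarrow> deg u = 4 \<and> card {w \<in> nb u. high w} \<ge> 2"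

lemma fin: "finite (pverts G)" using two card.infinite by force

lemma graph_facts:
  "parcs G \<subseteq> pverts G \<times> pverts G" "(u, w) \<in> parcs G \<Longrightarrow> (w, u) \<in> parcs G" "(u, u) \<notin> parcs G"
proof -
  have "pverts G \<noteq> {}" using two by auto
  then obtain v where "v \<in> pverts G" by blast
  from fire[OF this] show "parcs G \<subseteq> pverts G \<times> pverts G" "(u, w) \<in> parcs G \<Longrightarrow> (w, u) \<in> parcs G" "(u, u) \<notin> parcs G"
    by (simp_all add: fire_graph_def)
qed

lemma nb_sub: "nb u \<subseteq> pverts G - {u}" using graph_facts by (auto simp: nb_def)
lemma finite_nb: "finite (nb u)" using nb_sub fin finite_subset by blast

lemma deg_less: "u \<in> pverts G \<Longrightarrow> deg u < card (pverts G)"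
proof -
  assume u: "u \<in> pverts G"
  have "deg u \<le> card (pverts G - {u})" unfolding deg_def using nb_sub fin by (intro card_mono) auto
  also have "\<dots> < card (pverts G)" using u fin by (intro card_Diff1_less)
  finally show ?thesis .
qed

lemma deg_pos: "u \<in> pverts G \<Longrightarrow> deg u \<ge> 1"
proof -
  assume u: "u \<in> pverts G"
  interpret fire_graph "pverts G" "parcs G" u by (rule fire[OF u])
  have "pverts G \<noteq> {u}" using two by auto
  then obtain w where w: "w \<in> pverts G" "w \<noteq> u" using u by auto
  then have "(u, w) \<in> (parcs G)\<^sup>*" using conn u by blast
  then obtain x where "(u, x) \<in> parcs G" using w(2) by (metis converse_rtranclE)
  then have "nb u \<noteq> {}" by (auto simp: nb_def)
  then show ?thesis using finite_nb by (simp add: deg_def Suc_le_eq card_gt_0_iff)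
qed

lemma ex_rank: "\<exists>rk :: 'a \<Rightarrow> nat. inj_on rk (nb v)"
  using finite_imp_inj_to_nat_seg[OF finite_nb] by blast

lemma save_low:
  assumes v: "v \<in> pverts G" and deg: "deg v \<le> 2"
  shows "card (pverts G) - 1 \<le> sn 2 G v"
proof -
  obtain rk :: "'a \<Rightarrow> nat" where rk: "inj_on rk (nb v)" using ex_rank by blast
  interpret fire_rank G v rk using fire[OF v] rk by unfold_locales (auto simp: fire_graph_def nb_def)
  have "card (pverts G - {v}) \<le> sn 2 G v"
  proof (rule save_by_levels[where N = "nb v"])
    show "pverts G - {v} \<subseteq> pverts G" "v \<notin> pverts G - {v}" by auto
    show "b \<in> nb v" if "(u, b) \<in> parcs G" "u \<notin> pverts G - {v}" "b \<in> pverts G - {v}" for u b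
      using that graph_facts(1) by (auto simp: nb_def)
    show "card {b \<in> (pverts G - {v}) \<inter> nb v. d b = Suc t} \<le> 2" for t
    proof -
      have "card {b \<in> (pverts G - {v}) \<inter> nb v. d b = Suc t} \<le> card (nb v)" using finite_nb by (intro card_mono) auto
      then show ?thesis using deg by (simp add: deg_def)
    qed
  qed
  then show ?thesis using v fin by simp
qed

lemma save_deg_3:
  assumes v: "v \<in> pverts G" and deg: "deg v \<le> 3"
  shows "card (pverts G) - 1 \<le> 3 * sn 2 G v"
proof -
  obtain rk :: "'a \<Rightarrow> nat" where rk: "inj_on rk (nb v)" using ex_rank by blast
  interpret fire_rank G v rk using fire[OF v] rk by unfold_locales (auto simp: fire_graph_def nb_def)
  have "nbrs v = nb v" by (simp add: nbrs_def nb_def)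
  then show ?thesis using save_degree_3[OF sep[OF v]] deg by (simp add: deg_def)
qed

text \<open>
  A neighbour of degree at least 6 gets the largest rank, so it is never the neighbour that is given up
  to the fire.
\<close>

lemma save_deg_4:
  assumes v: "v \<in> pverts G" and deg4: "deg v = 4" and nc: "\<not> crowded v"
  shows "card (pverts G) - 1 \<le> 6 * sn 2 G v \<or> card (pverts G) - 1 \<le> 3 * sn 2 G v + 3"
proof -
  obtain f :: "'a \<Rightarrow> nat" and n where f: "f ` nb v = {i. i < n}" "inj_on f (nb v)"
    using finite_imp_inj_to_nat_seg[OF finite_nb] by blast
  define rk where "rk w = (if high w then n else f w)" for w
  have fn: "f w < n" if "w \<in> nb v" for w using f(1) that by blast
  have "card {w \<in> nb v. high w} \<le> 1" using nc deg4 by (simp add: crowded_def)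
  then have uni: "x = y" if "x \<in> nb v" "high x" "y \<in> nb v" "high y" for x y
    using that finite_nb by (auto simp: card_le_Suc0_iff_eq)
  have rk: "inj_on rk (nb v)"
  proof (rule inj_onI)
    fix x y assume xy: "x \<in> nb v" "y \<in> nb v" "rk x = rk y"
    show "x = y"
    proof (cases "high x \<or> high y")
      case True
      then have "high x \<and> high y" using xy fn[of x] fn[of y] by (auto simp: rk_def split: if_splits)
      then show ?thesis using uni xy by blast
    next
      case False
      then show ?thesis using xy inj_onD[OF f(2)] by (simp add: rk_def)
    qed
  qed
  interpret fire_rank G v rk using fire[OF v] rk by unfold_locales (auto simp: fire_graph_def nb_def)
  have eq: "nbrs u = nb u" for u by (simp add: nbrs_def nb_def)
  have low: "card (nbrs k) \<le> 5" if "k \<in> nbrs v" "l \<in> nbrs v" "rk k < rk l" for k l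
  proof -
    have "\<not> high k" using that fn[of l] by (auto simp: rk_def eq split: if_splits)
    then show ?thesis by (simp add: high_def deg_def eq)
  qed
  show ?thesis using save_degree_4[OF sep[OF v] _ low] deg4 by (simp add: eq deg_def)
qed

text \<open>
  Two vertices protected in the first round are saved in any case; this covers the small graphs for which
  the fractions of \<open>n\<close> above say little.
\<close>

lemma save_two:
  assumes v: "v \<in> pverts G" and n: "card (pverts G) \<ge> 3"
  shows "2 \<le> sn 2 G v"
proof -
  have "card (pverts G - {v}) \<ge> 2" using v n fin by simp
  then obtain X where X: "X \<subseteq> pverts G - {v}" "card X = 2" by (meson obtain_subset_with_card_n)
  have fX: "finite X" using X(2) card.infinite by force
  have "card X \<le> sn 2 G v"
  proof (rule sn_ge_schedule[OF fin, where \<tau> = "\<lambda>_. 1"])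
    show "X \<subseteq> pverts G" "v \<notin> X" using X by auto
    show "card {b \<in> X. (1::nat) = Suc t} \<le> 2" for t
      using X(2) card_mono[OF fX, of "{b \<in> X. (1::nat) = Suc t}"] by auto
  qed simp
  then show ?thesis using X by simp
qed

definition transfer :: "'a \<Rightarrow> 'a \<Rightarrow> real" where
  "transfer u w = (if crowded u \<and> high w \<and> w \<in> nb u then 1 / 4 else 0)"

definition charge :: "'a \<Rightarrow> real" where
  "charge u = 9 / 2 - real (deg u) - (\<Sum>w\<in>pverts G. transfer u w) + (\<Sum>w\<in>pverts G. transfer w u)"

lemma sum_charge: "(\<Sum>u\<in>pverts G. charge u) = (\<Sum>u\<in>pverts G. 9 / 2 - real (deg u))"
proof -
  have "(\<Sum>u\<in>pverts G. \<Sum>w\<in>pverts G. transfer u w) = (\<Sum>u\<in>pverts G. \<Sum>w\<in>pverts G. transfer w u)"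
    by (rule sum.swap)
  then show ?thesis by (simp add: charge_def sum.distrib sum_subtractf)
qed

lemma sum_if_quarter: "(\<Sum>w\<in>pverts G. if P w \<and> w \<in> nb u then 1 / 4 else 0) = real (card {w \<in> nb u. P w}) / 4"
proof -
  have "(\<Sum>w\<in>pverts G. if P w \<and> w \<in> nb u then 1 / 4 else (0::real)) = (\<Sum>w\<in>{w \<in> pverts G. P w \<and> w \<in> nb u}. 1 / 4)"
    by (rule sum.inter_filter[OF fin, symmetric])
  also have "{w \<in> pverts G. P w \<and> w \<in> nb u} = {w \<in> nb u. P w}" using nb_sub by auto
  finally show ?thesis by simp
qed

lemma charge_crowded: "crowded u \<Longrightarrow> charge u \<le> 0"
proof -
  assume c: "crowded u"
  then have "\<not> high u" "deg u = 4" by (auto simp: crowded_def high_def)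
  have "(\<Sum>w\<in>pverts G. transfer u w) = real (card {w \<in> nb u. high w}) / 4"
    unfolding transfer_def using c sum_if_quarter[of high u] by simp
  moreover have "(\<Sum>w\<in>pverts G. transfer w u) = 0" unfolding transfer_def using \<open>\<not> high u\<close> by simp
  moreover have "real (card {w \<in> nb u. high w}) \<ge> 2" using c by (simp add: crowded_def)
  ultimately show ?thesis unfolding charge_def using \<open>deg u = 4\<close> by simp
qed

lemma charge_high: "high u \<Longrightarrow> charge u \<le> 9 / 2 - 3 / 4 * real (deg u)"
proof -
  assume h: "high u"
  then have "\<not> crowded u" by (auto simp: crowded_def high_def)
  then have "(\<Sum>w\<in>pverts G. transfer u w) = 0" by (simp add: transfer_def)
  moreover have "(\<Sum>w\<in>pverts G. transfer w u) \<le> real (deg u) / 4"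
  proof -
    have "w \<in> nb u \<longleftrightarrow> u \<in> nb w" for w using graph_facts(2) by (auto simp: nb_def)
    then have "(\<Sum>w\<in>pverts G. transfer w u) = (\<Sum>w\<in>pverts G. if crowded w \<and> w \<in> nb u then 1 / 4 else 0)"
      using h by (intro sum.cong) (auto simp: transfer_def)
    also have "\<dots> = real (card {w \<in> nb u. crowded w}) / 4" by (rule sum_if_quarter)
    also have "card {w \<in> nb u. crowded w} \<le> card (nb u)" using finite_nb by (intro card_mono) auto
    then have "real (card {w \<in> nb u. crowded w}) / 4 \<le> real (deg u) / 4" by (simp add: deg_def)
    finally show ?thesis .
  qed
  ultimately show ?thesis unfolding charge_def by simp
qed

lemma charge_other: "\<not> high u \<Longrightarrow> \<not> crowded u \<Longrightarrow> charge u = 9 / 2 - real (deg u)"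
  by (simp add: charge_def transfer_def)

text \<open>
  At degree 4 the bound \<open>n/9 + 1/3\<close> follows from the separator for \<open>n \<ge> 9\<close> and from the two protected
  vertices for \<open>n \<le> 15\<close>. At degree \<open>d \<ge> 6\<close> the negative charge contributes \<open>n (d - 6)/6\<close>, and \<open>n > d\<close>.
\<close>

lemma saved_vs_charge:
  assumes u: "u \<in> pverts G"
  defines "n \<equiv> real (card (pverts G))"
  shows "real (sn 2 G u) - 2 / 9 * n * charge u \<ge> 2 / 3 * (real (deg u) - 7 / 2)"
    "real (sn 2 G u) - 2 / 9 * n * charge u \<ge> -1"
proof -
  let ?s = "real (sn 2 G u)"
  have n2: "n \<ge> 2" using two by (simp add: n_def)
  have degn: "real (deg u) + 1 \<le> n" using deg_less[OF u] by (simp add: n_def)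
  have s2: "?s \<ge> 2" if "deg u \<ge> 2"
    using save_two[OF u] deg_less[OF u] that by simp
  have "?s - 2 / 9 * n * charge u \<ge> 2 / 3 * (real (deg u) - 7 / 2) \<and> ?s - 2 / 9 * n * charge u \<ge> -1"
  proof (cases "high u")
    case True
    then have d6: "real (deg u) \<ge> 6" by (simp add: high_def)
    have "2 / 9 * n * charge u \<le> 2 / 9 * n * (9 / 2 - 3 / 4 * real (deg u))"
      using charge_high[OF True] n2 by (intro mult_left_mono) auto
    also have "\<dots> = - (n * (real (deg u) - 6)) / 6" by (simp add: field_simps)
    finally have "2 / 9 * n * charge u \<le> - (n * (real (deg u) - 6)) / 6" .
    moreover have "n * (real (deg u) - 6) \<ge> 7 * (real (deg u) - 6)"
      using degn d6 by (intro mult_right_mono) auto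
    moreover have "?s \<ge> 2" using s2 d6 by simp
    ultimately show ?thesis using d6 by (simp add: field_simps)
  next
    case nh: False
    show ?thesis
    proof (cases "crowded u")
      case True
      have "2 / 9 * n * charge u \<le> 0" using charge_crowded[OF True] n2 by (simp add: mult_nonneg_nonpos)
      moreover have "deg u = 4" using True by (simp add: crowded_def)
      ultimately show ?thesis using s2 by simp
    next
      case nc: False
      have ch: "charge u = 9 / 2 - real (deg u)" by (rule charge_other[OF nh nc])
      have n1: "real (card (pverts G) - 1) = n - 1" using two by (simp add: n_def of_nat_diff)
      have le5: "deg u \<le> 5" using nh by (simp add: high_def)
      consider "deg u = 1" | "deg u = 2" | "deg u = 3" | "deg u = 4" | "deg u = 5"
        using deg_pos[OF u] le5 by linarith
      then show ?thesis
      proof cases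
        case 1
        have "n - 1 \<le> ?s" using save_low[OF u] 1 n1 by (metis of_nat_le_iff one_le_numeral)
        then show ?thesis using n2 1 by (simp add: ch field_simps)
      next
        case 2
        have "n - 1 \<le> ?s" using save_low[OF u] 2 n1 by (metis of_nat_le_iff order_refl)
        then show ?thesis using n2 2 by (simp add: ch field_simps)
      next
        case 3
        have "card (pverts G) - 1 \<le> 3 * sn 2 G u" using save_deg_3[OF u] 3 by simp
        then have "n - 1 \<le> 3 * ?s" using n1 by (metis of_nat_le_iff of_nat_mult of_nat_numeral)
        then show ?thesis using 3 by (simp add: ch field_simps)
      next
        case 4
        have "n - 1 \<le> 6 * ?s \<or> n - 1 \<le> 3 * ?s + 3"
          using save_deg_4[OF u 4 nc] n1 by linarith
        moreover have "?s \<ge> 2" using s2 4 by simp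
        ultimately have "?s \<ge> n / 9 + 1 / 3" by linarith
        then show ?thesis using 4 by (simp add: ch field_simps)
      next
        case 5
        have "?s \<ge> 2" using s2 5 by simp
        then show ?thesis using 5 degn by (simp add: ch field_simps)
      qed
    qed
  qed
  then show "?s - 2 / 9 * n * charge u \<ge> 2 / 3 * (real (deg u) - 7 / 2)" "?s - 2 / 9 * n * charge u \<ge> -1"
    by auto
qed

lemma sum_deg: "(\<Sum>u\<in>pverts G. deg u) = 2 * card (edges G)"
proof -
  have finR: "finite (parcs G)" using graph_facts(1) fin finite_subset by blast
  have im: "edges G = (\<lambda>(u, w). {u, w}) ` parcs G" by (auto simp: edges_def)
  have "parcs G = Sigma (pverts G) nb" using graph_facts(1) by (auto simp: nb_def)
  then have "card (parcs G) = (\<Sum>u\<in>pverts G. deg u)" using fin finite_nb by (simp add: deg_def)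
  moreover have "card (parcs G) = (\<Sum>e\<in>edges G. card {a \<in> parcs G. (\<lambda>(u, w). {u, w}) a = e})"
    using sum.group[OF finR, of "edges G" "\<lambda>(u, w). {u, w}" "\<lambda>_. 1::nat"] finR im by simp
  moreover have "card {a \<in> parcs G. (\<lambda>(u, w). {u, w}) a = e} = 2" if e: "e \<in> edges G" for e
  proof -
    obtain u w where uw: "e = {u, w}" "(u, w) \<in> parcs G" using e by (auto simp: edges_def)
    have "u \<noteq> w" using uw(2) graph_facts(3) by blast
    have "{a \<in> parcs G. (\<lambda>(u, w). {u, w}) a = e} = {(u, w), (w, u)}"
      using uw graph_facts(2) by (auto simp: doubleton_eq_iff)
    then show ?thesis using \<open>u \<noteq> w\<close> by simp
  qed
  ultimately show ?thesis by simp
qed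

theorem surviving_rate_ge:
  assumes avg: "2 * real (card (edges G)) / real (card (pverts G)) = 9 / 2 - \<epsilon>"
  shows "\<epsilon> \<le> 1 \<Longrightarrow> surviving_rate 2 G \<ge> 2 / 9 * \<epsilon>"
    "surviving_rate 2 G \<ge> 2 / 9 * \<epsilon> - 1 / real (card (pverts G))"
proof -
  let ?V = "pverts G"
  define n where "n = real (card ?V)"
  define S where "S = (\<Sum>u\<in>?V. real (sn 2 G u))"
  have n0: "n > 0" using two by (simp add: n_def)
  have sd: "(\<Sum>u\<in>?V. real (deg u)) = (9 / 2 - \<epsilon>) * n"
  proof -
    have "(\<Sum>u\<in>?V. real (deg u)) = 2 * real (card (edges G))"
      using sum_deg by (metis of_nat_mult of_nat_numeral of_nat_sum)
    also have "\<dots> = (9 / 2 - \<epsilon>) * n" using avg n0 by (simp add: n_def field_simps)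
    finally show ?thesis .
  qed
  have sc: "(\<Sum>u\<in>?V. charge u) = \<epsilon> * n"
    unfolding sum_charge sum_subtractf sd by (simp add: n_def algebra_simps)
  have tot: "(\<Sum>u\<in>?V. real (sn 2 G u) - 2 / 9 * n * charge u) = S - 2 / 9 * \<epsilon> * n\<^sup>2"
    unfolding sum_subtractf sum_distrib_left[symmetric] sc S_def by (simp add: power2_eq_square)
  have rate: "surviving_rate 2 G = S / n\<^sup>2" by (simp add: surviving_rate_def S_def n_def)
  show "surviving_rate 2 G \<ge> 2 / 9 * \<epsilon>" if "\<epsilon> \<le> 1"
  proof -
    have "(\<Sum>u\<in>?V. 2 / 3 * (real (deg u) - 7 / 2)) \<le> S - 2 / 9 * \<epsilon> * n\<^sup>2"
      unfolding tot[symmetric] by (intro sum_mono saved_vs_charge(1)[folded n_def])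
    moreover have "(\<Sum>u\<in>?V. 2 / 3 * (real (deg u) - 7 / 2)) = 2 / 3 * ((1 - \<epsilon>) * n)"
      unfolding sum_distrib_left[symmetric] sum_subtractf sd by (simp add: n_def algebra_simps)
    moreover have "(1 - \<epsilon>) * n \<ge> 0" using that n0 by simp
    ultimately have "2 / 9 * \<epsilon> * n\<^sup>2 \<le> S" by linarith
    then show ?thesis unfolding rate using n0 by (simp add: field_simps)
  qed
  have "(\<Sum>u\<in>?V. -1) \<le> S - 2 / 9 * \<epsilon> * n\<^sup>2"
    unfolding tot[symmetric] by (intro sum_mono saved_vs_charge(2)[folded n_def])
  then have "2 / 9 * \<epsilon> * n\<^sup>2 - n \<le> S" by (simp add: n_def)
  then have "(2 / 9 * \<epsilon> * n\<^sup>2 - n) / n\<^sup>2 \<le> S / n\<^sup>2" by (rule divide_right_mono) simp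
  moreover have "(2 / 9 * \<epsilon> * n\<^sup>2 - n) / n\<^sup>2 = 2 / 9 * \<epsilon> - 1 / n"
    using n0 by (simp add: field_simps power2_eq_square)
  ultimately show "surviving_rate 2 G \<ge> 2 / 9 * \<epsilon> - 1 / real (card (pverts G))"
    unfolding rate n_def by simp
qed

end

section \<open>Planar graphs\<close>

lemma pair_graph_fire_graph:
  assumes "pair_graph G" "Digraph_Component.connected (with_proj G)" "v \<in> pverts G"
  shows "fire_graph (pverts G) (parcs G) v"
proof -
  interpret pair_graph G by fact
  show ?thesis
  proof
    show "finite (pverts G)" by (rule pair_finite_verts)
    show "parcs G \<subseteq> pverts G \<times> pverts G" using in_arcsD1 in_arcsD2 by auto
    show "(w, u) \<in> parcs G" if "(u, w) \<in> parcs G" for u w using arcs_symmetric that .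
    show "(u, u) \<notin> parcs G" for u using no_loops' by blast
    show "v \<in> pverts G" by fact
  next
    fix u w assume uw: "u \<in> pverts G" "w \<in> pverts G"
    then have "u \<rightarrow>\<^sup>*\<^bsub>mk_symmetric (with_proj G)\<^esub> w"
      using assms(2) unfolding connected_def strongly_connected_def by simp
    then have "(u, w) \<in> (arcs_ends (mk_symmetric (with_proj G)))\<^sup>*"
      unfolding reachable_def by (rule rtrancl_on_rtranclI)
    moreover have "arcs_ends (mk_symmetric (with_proj G)) \<subseteq> parcs G"
      using arcs_symmetric by (auto simp: parcs_mk_symmetric)
    ultimately show "(u, w) \<in> (parcs G)\<^sup>*" using rtrancl_mono by blast
  qed
qed

lemma planar_drawing_plane_graph:
  assumes "pair_graph G" and pl: "planar_drawing G p \<gamma>"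
  shows "plane_graph (pverts G) (edges G) p (\<lambda>e. path_image (\<gamma> e))"
proof -
  have drawn: "arc_between (path_image (\<gamma> {u, w})) (p u) (p w)" if e: "{u, w} \<in> edges G" for u w
  proof -
    have "arc (\<gamma> {u, w})" "{pathstart (\<gamma> {u, w}), pathfinish (\<gamma> {u, w})} = {p u, p w}"
      using pl e by (simp_all add: planar_drawing_def)
    then show ?thesis
      using arc_betweenI[of "\<gamma> {u, w}"] arc_between_sym[OF arc_betweenI[of "\<gamma> {u, w}"]]
      by (auto simp: doubleton_eq_iff)
  qed
  interpret pair_graph G by fact
  show ?thesis
  proof
    show "finite (pverts G)" by (rule pair_finite_verts)
    show "\<exists>u w. e = {u, w} \<and> u \<in> pverts G \<and> w \<in> pverts G \<and> u \<noteq> w" if "e \<in> edges G" for e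
      using that in_arcsD1 in_arcsD2 no_loops' unfolding edges_def by blast
    show "inj_on p (pverts G)" using pl by (simp add: planar_drawing_def)
    show "path_image (\<gamma> e) \<inter> p ` pverts G = p ` e" if "e \<in> edges G" for e
      using pl that by (simp add: planar_drawing_def)
    show "path_image (\<gamma> e) \<inter> path_image (\<gamma> f) = p ` (e \<inter> f)" if "e \<in> edges G" "f \<in> edges G" "e \<noteq> f" for e f
      using pl that by (simp add: planar_drawing_def)
    show "arc_between (path_image (\<gamma> {u, w})) (p u) (p w)" if "{u, w} \<in> edges G" for u w
      using drawn that .
  qed
qed

lemma planar_separable:
  assumes G: "pair_graph G" "planar G" and v: "v \<in> pverts G" and two: "card (pverts G) \<ge> 2"
  shows "separable (pverts G) (edges G) v"
  unfolding separable_def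
proof (intro allI impI)
  fix T assume T: "spanning_connected (pverts G) T" "T \<subseteq> edges G"
  obtain p \<gamma> where "planar_drawing G p \<gamma>" using G(2) by (auto simp: planar_def)
  note pg = planar_drawing_plane_graph[OF G(1) this]
  have fin: "finite (pverts G)" using two card.infinite by force
  \<comment> \<open>weight 0 at the vertex on fire, so that it is not counted on the side on which it lies\<close>
  define w :: "'a \<Rightarrow> real" where "w u = (if u = v then 0 else 1)" for u
  have w0: "w u \<ge> 0" for u by (simp add: w_def)
  have sw: "sum w A = real (card (A - {v}))" if A: "A \<subseteq> pverts G" for A
  proof -
    have fA: "finite A" using A fin finite_subset by blast
    have "sum w A = sum w (A - {v})" using fA by (intro sum.mono_neutral_right) (auto simp: w_def)
    also have "\<dots> = sum (\<lambda>_. 1) (A - {v})" by (intro sum.cong) (auto simp: w_def)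
    finally show ?thesis by simp
  qed
  have swV: "sum w (pverts G) = real (card (pverts G) - 1)" using sw[of "pverts G"] v fin by simp
  obtain xs A B where s: "distinct xs" "set xs \<subseteq> pverts G" "pedges xs \<subseteq> T" "length xs \<ge> 2"
    "A \<union> B = pverts G - set xs" "A \<inter> B = {}" "\<And>u w. {u, w} \<in> edges G \<Longrightarrow> u \<in> A \<Longrightarrow> w \<notin> B"
    "3 * sum w A \<le> 2 * sum w (pverts G)" "3 * sum w B \<le> 2 * sum w (pverts G)"
    "splits_along (edges G) xs A" "splits_along (edges G) (rev xs) A"
    "splits_along (edges G) xs B" "splits_along (edges G) (rev xs) B"
    using planar_path_separator[where w = w, OF pg T w0 two] by blast
  have AB: "A \<subseteq> pverts G" "B \<subseteq> pverts G" using s(5) by blast+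
  have "3 * card (A - {v}) \<le> 2 * (card (pverts G) - 1)" "3 * card (B - {v}) \<le> 2 * (card (pverts G) - 1)"
    using s(8,9) unfolding sw[OF AB(1)] sw[OF AB(2)] swV by linarith+
  moreover have "\<forall>u w. {u, w} \<in> edges G \<longrightarrow> u \<in> A \<longrightarrow> w \<notin> B" using s(7) by blast
  ultimately show "\<exists>xs A B. distinct xs \<and> set xs \<subseteq> pverts G \<and> pedges xs \<subseteq> T \<and> length xs \<ge> 2 \<and>
      A \<union> B = pverts G - set xs \<and> A \<inter> B = {} \<and> (\<forall>u w. {u, w} \<in> edges G \<longrightarrow> u \<in> A \<longrightarrow> w \<notin> B) \<and>
      3 * card (A - {v}) \<le> 2 * (card (pverts G) - 1) \<and> 3 * card (B - {v}) \<le> 2 * (card (pverts G) - 1) \<and>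
      splits_along (edges G) xs A \<and> splits_along (edges G) (rev xs) A \<and>
      splits_along (edges G) xs B \<and> splits_along (edges G) (rev xs) B"
    using s(1-6,10-13) by (intro exI conjI)
qed

theorem theorem1p2:
  fixes G :: "'a pair_pre_digraph" and n m :: nat and \<epsilon> :: real
  assumes "pair_graph G"
    and "Digraph_Component.connected (with_proj G)"
    and "planar G"
    and "n = card (pverts G)"
    and "n \<ge> 2"
    and "m = card (edges G)"
    and "0 < \<epsilon>" and "\<epsilon> \<le> 5 / 2"
    and "2 * real m / real n = 9 / 2 - \<epsilon>"
  shows "surviving_rate 2 G \<ge> (if \<epsilon> \<le> 1 then 2 / 9 * \<epsilon> else 2 / 9 * \<epsilon> - 1 / real n)"
proof -
  have two: "card (pverts G) \<ge> 2" using assms(4,5) by simp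
  interpret separable_graph G
  proof (rule separable_graph.intro)
    show "fire_graph (pverts G) (parcs G) v" if "v \<in> pverts G" for v
      by (rule pair_graph_fire_graph[OF assms(1,2) that])
    show "separable (pverts G) (edges G) v" if "v \<in> pverts G" for v
      by (rule planar_separable[OF assms(1,3) that two])
  qed (rule two)
  show ?thesis
    using surviving_rate_ge[of \<epsilon>] assms(4,6,9) by simp
qed

end
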